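(* Let $p\ge3$, $a\in\mathbb S^{p-1}$, and let $\psi:(-1,0)\cup(0,1)\to\mathbb R$ be Borel and finite almost everywhere, with $T_\psi(u):=\psi(a^\top u)\{a-(a^\top u)u\}$ on $\mathbb S^{p-1}$ away from $a^\perp$ (defined arbitrarily on that null set). Assume the equivalent conditions (i) for Haar-almost every oriented two-plane $P$, $\mathcal L\{T_\psi(U)^\top V\mid P\}=\mathrm{Cauchy}(0,1)$; (ii) $|\psi(t)|=1/|t|$ for Lebesgue-almost every $t\in(-1,1)$, and suppose that $T_\psi$ is antipodally odd, $T_\psi(-u)=-T_\psi(u)$. On each oriented plane $P$ set $$F_P(\phi):=-T_\psi(U_\phi)^\top V_\phi,\qquad b_P(e^{2i\phi}):=\frac{1+iF_P(\phi)}{1-iF_P(\phi)} .$$ If $b_P$ is the boundary function of a member of $H^\infty(\mathbb D)$ for Haar-almost every $P$, then $$T_\psi(u)=\frac{a}{a^\top u}-u\quad\text{for Haar-almost every }u.$$ The converse also holds: if $T_\psi(u)=\frac a{a^\top u}-u$ almost everywhere, then $b_P$ is the boundary function of a member of $H^\infty(\mathbb D)$ for Haar-almost every $P$.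
   Context: $(U,V)$ is a Haar-distributed orthonormal two-frame in $\mathbb R^p$ (the first two columns of a Haar matrix in $O(p)$), $P=\operatorname{span}\{U,V\}$ carries the orientation induced by the frame, and $\mathcal L\{\cdot\mid P\}$ is the conditional law given $P$. For an oriented plane $P$ with a positive orthonormal basis $(e_1,e_2)$, $U_\phi=e_1\cos\phi+e_2\sin\phi$ and $V_\phi=-e_1\sin\phi+e_2\cos\phi$; changing the basis only rotates the phase $\phi$. Antipodal oddness makes $F_P$ $\pi$-periodic, so $b_P$ is well defined (almost everywhere) on the unit circle. $H^\infty(\mathbb D)$ is the algebra of bounded analytic functions on the open unit disk; the boundary function is the almost-everywhere radial limit. *)

theory Defs
  imports "HOL-Probability.Probability"
begin

subsection \<open>Haar-distributed two-frames\<close>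

definition orthogonal_group :: "(real ^ 'n ^ 'n) set" where
  "orthogonal_group = {Q. orthogonal_matrix Q}"

definition haar_orthogonal :: "(real ^ 'n ^ 'n) measure \<Rightarrow> bool" where
  "haar_orthogonal \<mu> \<longleftrightarrow>
     prob_space \<mu> \<and>
     space \<mu> = orthogonal_group \<and>
     sets \<mu> = sets (restrict_space borel orthogonal_group) \<and>
     (\<forall>R\<in>orthogonal_group. distr \<mu> \<mu> (\<lambda>Q. R ** Q) = \<mu>)"

type_synonym 'n frame = "(real ^ 'n) \<times> (real ^ 'n)"

definition two_frames :: "'n::finite frame set" where
  "two_frames = {(u, v). norm u = 1 \<and> norm v = 1 \<and> u \<bullet> v = 0}"

definition frame_space :: "'n::finite frame measure" where
  "frame_space = restrict_space borel two_frames"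

text \<open>
  The index type is unordered, so ``the first two columns'' are the columns at any two
  distinct indices; by invariance of Haar measure the law does not depend on them.
\<close>

definition haar_two_frame :: "'n::finite frame measure \<Rightarrow> bool" where
  "haar_two_frame M \<longleftrightarrow>
     (\<exists>\<mu> i j. haar_orthogonal \<mu> \<and> i \<noteq> j \<and>
        M = distr \<mu> frame_space (\<lambda>Q. (column i Q, column j Q)))"

definition sphere_law :: "'n::finite frame measure \<Rightarrow> (real ^ 'n) measure" where
  "sphere_law M = distr M (restrict_space borel (sphere 0 1)) fst"

lemma measurable_columns: "haar_orthogonal \<mu> \<Longrightarrow> i \<noteq> j \<Longrightarrow> (\<lambda>Q. (column i Q, column j Q)) \<in> \<mu> \<rightarrow>\<^sub>M (frame_space :: 'n::finite frame measure)"
proof -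
  assume h: "haar_orthogonal \<mu>" and ij: "i \<noteq> j"
  have c: "(\<lambda>Q::real^'n^'n. (column i Q, column j Q)) \<in> borel \<rightarrow>\<^sub>M borel"
    unfolding column_def by (intro borel_measurable_continuous_onI continuous_intros)
  have s: "sets \<mu> = sets (restrict_space borel orthogonal_group)" "space \<mu> = orthogonal_group" using h by (auto simp: haar_orthogonal_def)
  show ?thesis unfolding frame_space_def
    apply (subst measurable_cong_sets[OF s(1) refl])
    apply (rule measurable_restrict_space2)
     apply (auto simp: space_restrict_space orthogonal_group_def two_frames_def)
    subgoal by (simp add: orthogonal_matrix_orthonormal_columns)
    subgoal by (simp add: orthogonal_matrix_orthonormal_columns)
    subgoal using ij by (simp add: orthogonal_matrix_orthonormal_columns orthogonal_def)
    using c by (rule measurable_restrict_space1)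
qed

lemma measurable_frame_fst: "fst \<in> (frame_space :: 'n::finite frame measure) \<rightarrow>\<^sub>M restrict_space borel (sphere 0 1)"
  unfolding frame_space_def
  by (rule measurable_restrict_space3) (auto simp: two_frames_def borel_measurable_continuous_onI continuous_on_fst)

subsection \<open>Oriented planes\<close>

text \<open>
  \<open>rotate_frame \<phi> (e1, e2)\<close> is the frame \<open>(U_\<phi>, V_\<phi>)\<close>.  An oriented plane is encoded as
  the set of all its positive orthonormal bases; lemma \<open>oriented_plane_eq_iff\<close> below shows
  that this is the same datum as the plane together with its orientation.
\<close>

definition rotate_frame :: "real \<Rightarrow> 'n::finite frame \<Rightarrow> 'n frame" where
  "rotate_frame \<phi> e =
     (cos \<phi> *\<^sub>R fst e + sin \<phi> *\<^sub>R snd e, - sin \<phi> *\<^sub>R fst e + cos \<phi> *\<^sub>R snd e)"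

definition oriented_plane :: "'n::finite frame \<Rightarrow> 'n frame set" where
  "oriented_plane e = range (\<lambda>\<phi>. rotate_frame \<phi> e)"

definition oriented_planes :: "'n::finite frame set set" where
  "oriented_planes = oriented_plane ` two_frames"

text \<open>
  The oriented Grassmannian carries the quotient sigma-algebra of the frame space, so the
  events generated by \<open>P\<close> are the Borel sets of frames that are invariant under rotation of
  the frame within its plane.
\<close>

definition plane_space :: "'n::finite frame set measure" where
  "plane_space = sigma oriented_planes
     {A. A \<subseteq> oriented_planes \<and> {e \<in> two_frames. oriented_plane e \<in> A} \<in> sets frame_space}"

definition plane_law :: "'n::finite frame measure \<Rightarrow> 'n frame set measure" where
  "plane_law M = distr M plane_space oriented_plane"

lemma measurable_oriented_plane: "oriented_plane \<in> frame_space \<rightarrow>\<^sub>M (plane_space :: 'n::finite frame set measure)"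
  unfolding plane_space_def
  by (rule measurable_measure_of) (auto simp: oriented_planes_def frame_space_def space_restrict_space vimage_def Int_def conj_commute)

lemma oriented_plane_eq_iff:
  fixes u v u' v' :: "real ^ 'n"
  assumes "(u, v) \<in> two_frames" "(u', v') \<in> two_frames"
  shows "oriented_plane (u, v) = oriented_plane (u', v') \<longleftrightarrow>
     span {u, v} = span {u', v'} \<and> (u \<bullet> u') * (v \<bullet> v') - (u \<bullet> v') * (v \<bullet> u') > 0"
proof -
  have fr: "norm u = 1" "norm v = 1" "u \<bullet> v = 0" "norm u' = 1" "norm v' = 1" "u' \<bullet> v' = 0"
    using assms by (auto simp: two_frames_def)
  have ip: "u \<bullet> u = 1" "v \<bullet> v = 1" "v \<bullet> u = 0"
    using fr by (auto simp: norm_eq_1 inner_commute)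
  have ip': "u' \<bullet> u' = 1" "v' \<bullet> v' = 1"
    using fr by (auto simp: norm_eq_1)
  show ?thesis
  proof
    assume eq: "oriented_plane (u, v) = oriented_plane (u', v')"
    have "(u', v') = rotate_frame 0 (u', v')"
      by (simp add: rotate_frame_def)
    then have "(u', v') \<in> oriented_plane (u, v)"
      unfolding eq by (auto simp: oriented_plane_def)
    then obtain \<phi> where \<phi>: "u' = cos \<phi> *\<^sub>R u + sin \<phi> *\<^sub>R v" "v' = - sin \<phi> *\<^sub>R u + cos \<phi> *\<^sub>R v"
      by (auto simp: oriented_plane_def rotate_frame_def)
    have sc: "cos \<phi> * cos \<phi> + sin \<phi> * sin \<phi> = 1"
      using sin_cos_squared_add3 by (simp add: add.commute)
    have "cos \<phi> *\<^sub>R u' - sin \<phi> *\<^sub>R v' = (cos \<phi> * cos \<phi> + sin \<phi> * sin \<phi>) *\<^sub>R u"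
      by (simp add: \<phi> algebra_simps del: sin_cos_squared_add3)
    then have u: "u = cos \<phi> *\<^sub>R u' - sin \<phi> *\<^sub>R v'"
      by (simp only: sc scaleR_one)
    have "sin \<phi> *\<^sub>R u' + cos \<phi> *\<^sub>R v' = (cos \<phi> * cos \<phi> + sin \<phi> * sin \<phi>) *\<^sub>R v"
      by (simp add: \<phi> algebra_simps del: sin_cos_squared_add3)
    then have v: "v = sin \<phi> *\<^sub>R u' + cos \<phi> *\<^sub>R v'"
      by (simp only: sc scaleR_one)
    have comb: "c *\<^sub>R x + d *\<^sub>R y \<in> span {x, y}" "c *\<^sub>R x - d *\<^sub>R y \<in> span {x, y}"
      for c d and x y :: "real ^ 'n"
      by (intro span_add span_diff span_scale span_base; simp)+
    have "u' \<in> span {u, v}" "v' \<in> span {u, v}"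
      unfolding \<phi> by (fact comb)+
    then have "span {u', v'} \<subseteq> span {u, v}"
      by (intro span_minimal) auto
    moreover have "u \<in> span {u', v'}" "v \<in> span {u', v'}"
      using comb(2)[of "cos \<phi>" u' "sin \<phi>" v'] comb(1)[of "sin \<phi>" u' "cos \<phi>" v']
      by (simp_all only: u[symmetric] v[symmetric])
    then have "span {u, v} \<subseteq> span {u', v'}"
      by (intro span_minimal) auto
    moreover have "u \<bullet> u' = cos \<phi>" "v \<bullet> v' = cos \<phi>" "u \<bullet> v' = - sin \<phi>" "v \<bullet> u' = sin \<phi>"
      using ip fr(3) by (simp_all add: \<phi> inner_add_right inner_diff_right)
    ultimately show "span {u, v} = span {u', v'} \<and> (u \<bullet> u') * (v \<bullet> v') - (u \<bullet> v') * (v \<bullet> u') > 0"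
      using sc by auto
  next
    assume *: "span {u, v} = span {u', v'} \<and> (u \<bullet> u') * (v \<bullet> v') - (u \<bullet> v') * (v \<bullet> u') > 0"
    then have "u' \<in> span {u, v}" "v' \<in> span {u, v}"
      by (auto intro: span_base)
    then obtain \<alpha> \<beta> \<gamma> \<delta> where co: "u' = \<alpha> *\<^sub>R u + \<beta> *\<^sub>R v" "v' = \<gamma> *\<^sub>R u + \<delta> *\<^sub>R v"
      by (auto simp: span_insert span_breakdown_eq algebra_simps eq_diff_eq)
    have h: "\<alpha> * \<alpha> + \<beta> * \<beta> = 1" "\<gamma> * \<gamma> + \<delta> * \<delta> = 1" "\<alpha> * \<gamma> + \<beta> * \<delta> = 0"
      using ip' fr(3,6) ip(1,2) unfolding co by (simp_all add: inner_add_right inner_add_left inner_commute mult.commute)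
    have pos: "\<alpha> * \<delta> - \<gamma> * \<beta> > 0"
      using * ip fr(3) unfolding co by (simp add: inner_add_right)
    have "(\<alpha> * \<delta> - \<gamma> * \<beta>)\<^sup>2 =
        (\<alpha> * \<alpha> + \<beta> * \<beta>) * (\<gamma> * \<gamma> + \<delta> * \<delta>) - (\<alpha> * \<gamma> + \<beta> * \<delta>)\<^sup>2"
      by (simp add: power2_eq_square algebra_simps)
    then have d: "\<alpha> * \<delta> - \<gamma> * \<beta> = 1"
      using h pos by (simp add: power2_eq_1_iff)
    have "\<delta> = (\<alpha> * \<alpha> + \<beta> * \<beta>) * \<delta>"
      using h(1) by simp
    also have "\<dots> = \<alpha> * (\<alpha> * \<delta> - \<gamma> * \<beta>) + \<beta> * (\<alpha> * \<gamma> + \<beta> * \<delta>)"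
      by (simp add: algebra_simps)
    finally have \<delta>: "\<delta> = \<alpha>"
      using d h(3) by simp
    have "\<gamma> = (\<alpha> * \<alpha> + \<beta> * \<beta>) * \<gamma>"
      using h(1) by simp
    also have "\<dots> = \<alpha> * (\<alpha> * \<gamma> + \<beta> * \<delta>) - \<beta> * (\<alpha> * \<delta> - \<gamma> * \<beta>)"
      by (simp add: algebra_simps)
    finally have \<gamma>: "\<gamma> = - \<beta>"
      using d h(3) by simp
    obtain t where t: "\<alpha> = cos t" "\<beta> = sin t"
      using h(1) sincos_total_2pi[of \<alpha> \<beta>] by (auto simp: power2_eq_square)
    have r: "rotate_frame \<phi> (u', v') = rotate_frame (\<phi> + t) (u, v)" for \<phi>
      by (simp add: rotate_frame_def co \<gamma> \<delta> t cos_add sin_add algebra_simps)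
    have s: "rotate_frame \<phi> (u, v) = rotate_frame (\<phi> - t) (u', v')" for \<phi>
      by (simp add: r)
    show "oriented_plane (u, v) = oriented_plane (u', v')"
      unfolding oriented_plane_def
    proof (intro subset_antisym image_subsetI)
      show "rotate_frame \<phi> (u, v) \<in> range (\<lambda>\<phi>. rotate_frame \<phi> (u', v'))" for \<phi>
        unfolding s by (rule rangeI)
      show "rotate_frame \<phi> (u', v') \<in> range (\<lambda>\<phi>. rotate_frame \<phi> (u, v))" for \<phi>
        unfolding r by (rule rangeI)
    qed
  qed
qed

subsection \<open>Conditional laws\<close>

text \<open>\<open>K\<close> is a regular version of the conditional law of \<open>X\<close> given \<open>Y\<close>.\<close>

definition conditional_law ::
  "'w measure \<Rightarrow> ('w \<Rightarrow> 'x) \<Rightarrow> 'x measure \<Rightarrow> ('w \<Rightarrow> 'y) \<Rightarrow> 'y measure \<Rightarrow> ('y \<Rightarrow> 'x measure) \<Rightarrow> bool"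
where
  "conditional_law M X N Y S K \<longleftrightarrow>
     X \<in> M \<rightarrow>\<^sub>M N \<and> Y \<in> M \<rightarrow>\<^sub>M S \<and> K \<in> S \<rightarrow>\<^sub>M prob_algebra N \<and>
     (\<forall>A\<in>sets S. \<forall>B\<in>sets N.
        emeasure M {\<omega> \<in> space M. Y \<omega> \<in> A \<and> X \<omega> \<in> B} =
        (\<integral>\<^sup>+ y\<in>A. emeasure (K y) B \<partial>distr M S Y))"

definition std_cauchy :: "real measure" where
  "std_cauchy = density lborel (\<lambda>x. ennreal (1 / (pi * (1 + x\<^sup>2))))"

subsection \<open>The field and its phase function\<close>

text \<open>
  \<open>T\<close> is a Borel version of the field of \<open>\<psi>\<close>: its values on the null set orthogonal to \<open>a\<close>
  are arbitrary.  At \<open>u = a\<close> and \<open>u = - a\<close>, where \<open>\<psi>\<close> is evaluated outside its domain, the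
  tangential factor vanishes; infinite values of \<open>\<psi>\<close> occur only on a null set, where
  \<open>real_of_ereal\<close> turns them into \<open>0\<close>.
\<close>

definition field_of :: "(real \<Rightarrow> ereal) \<Rightarrow> real ^ 'n \<Rightarrow> (real ^ 'n \<Rightarrow> real ^ 'n) \<Rightarrow> bool" where
  "field_of \<psi> a T \<longleftrightarrow>
     T \<in> borel_measurable (restrict_space borel (sphere 0 1)) \<and>
     (\<forall>u\<in>sphere 0 1. a \<bullet> u \<noteq> 0 \<longrightarrow>
        T u = real_of_ereal (\<psi> (a \<bullet> u)) *\<^sub>R (a - (a \<bullet> u) *\<^sub>R u))"

definition phase_fun :: "(real ^ 'n \<Rightarrow> real ^ 'n) \<Rightarrow> 'n::finite frame \<Rightarrow> real \<Rightarrow> real" where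
  "phase_fun T e \<phi> = - (T (fst (rotate_frame \<phi> e)) \<bullet> snd (rotate_frame \<phi> e))"

text \<open>
  The branch \<open>\<phi> = Arg w / 2\<close> solves \<open>w = cis (2 * \<phi>)\<close>; the other solutions differ by
  multiples of \<open>pi\<close>, hence lemma \<open>phase_cayley_cis\<close>.
\<close>

definition phase_cayley ::
  "(real ^ 'n \<Rightarrow> real ^ 'n) \<Rightarrow> 'n::finite frame \<Rightarrow> complex \<Rightarrow> complex" where
  "phase_cayley T e w =
     (1 + \<i> * of_real (phase_fun T e (Arg w / 2))) / (1 - \<i> * of_real (phase_fun T e (Arg w / 2)))"

lemma phase_fun_periodic:
  assumes "T (- fst (rotate_frame \<phi> e)) = - T (fst (rotate_frame \<phi> e))"
  shows "phase_fun T e (\<phi> + pi) = phase_fun T e \<phi>"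
  using assms by (simp add: phase_fun_def rotate_frame_def inner_diff_right algebra_simps)

lemma phase_cayley_cis:
  assumes "\<And>\<phi>. phase_fun T e (\<phi> + pi) = phase_fun T e \<phi>"
  shows "phase_cayley T e (cis (2 * \<phi>)) =
     (1 + \<i> * of_real (phase_fun T e \<phi>)) / (1 - \<i> * of_real (phase_fun T e \<phi>))"
proof -
  have int: "phase_fun T e (\<phi> + of_int k * pi) = phase_fun T e \<phi>" for k :: int and \<phi>
  proof (induction k rule: int_induct[where k = 0])
    case (step1 i)
    then show ?case
      using assms[of "\<phi> + of_int i * pi"] by (simp add: algebra_simps)
  next
    case (step2 i)
    then show ?case
      using assms[of "\<phi> + of_int (i - 1) * pi"] by (simp add: algebra_simps)
  qed simp
  have "cis (Arg (cis (2 * \<phi>))) = cis (2 * \<phi>)"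
    using cis_Arg[of "cis (2 * \<phi>)"] by (simp add: sgn_div_norm)
  then obtain k :: int where "Arg (cis (2 * \<phi>)) = 2 * \<phi> + 2 * pi * of_int k"
    by (metis cis.sel(1,2) sin_cos_eq_iff Ints_cases mult.commute)
  then have "Arg (cis (2 * \<phi>)) / 2 = \<phi> + of_int k * pi"
    by simp
  then show ?thesis
    by (simp only: phase_cayley_def int)
qed

subsection \<open>Bounded analytic functions and their boundary values\<close>

definition H_infinity :: "(complex \<Rightarrow> complex) set" where
  "H_infinity = {f. f holomorphic_on ball 0 1 \<and> bounded (f ` ball 0 1)}"

definition boundary_function :: "(complex \<Rightarrow> complex) \<Rightarrow> (complex \<Rightarrow> complex) \<Rightarrow> bool" where
  "boundary_function f b \<longleftrightarrow>
     (AE \<theta> in lborel. ((\<lambda>r. f (of_real r * cis \<theta>)) \<longlongrightarrow> b (cis \<theta>)) (at_left 1))"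

subsection \<open>The two equivalent conditions\<close>

definition conditionally_cauchy :: "'n::finite frame measure \<Rightarrow> (real ^ 'n \<Rightarrow> real ^ 'n) \<Rightarrow> bool" where
  "conditionally_cauchy M T \<longleftrightarrow>
     (\<exists>K. conditional_law M (\<lambda>(u, v). T u \<bullet> v) borel oriented_plane plane_space K \<and>
          (AE P in plane_law M. K P = std_cauchy))"

definition reciprocal_modulus :: "(real \<Rightarrow> ereal) \<Rightarrow> bool" where
  "reciprocal_modulus \<psi> \<longleftrightarrow>
     (AE t in lborel. t \<in> {-1<..<1} \<longrightarrow> \<bar>\<psi> t\<bar> = ereal (1 / \<bar>t\<bar>))"

end

theory Submission
  imports Defs "HOL-Complex_Analysis.Conformal_Mappings" "HOL-Real_Asymp.Real_Asymp"
begin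

text \<open>
  Fix an oriented plane with positive orthonormal basis \<open>(e\<^sub>1, e\<^sub>2)\<close>, and let \<open>r\<close> be the length of
  the projection of \<open>a\<close> to it.  For a suitable phase \<open>\<phi>\<^sub>0\<close> and \<open>\<alpha> = \<phi> - \<phi>\<^sub>0\<close> one has
  \<open>a \<bullet> U\<^sub>\<phi> = r cos \<alpha>\<close> and \<open>a \<bullet> V\<^sub>\<phi> = - r sin \<alpha>\<close>, so that the tangential component of the field is
  \<open>T U\<^sub>\<phi> \<bullet> V\<^sub>\<phi> = - \<psi> (r cos \<alpha>) r sin \<alpha>\<close> (lemma \<open>frame_polar_coordinates\<close>).  The law of a Haar frame
  is invariant under rotation of the frame in its plane, hence given the plane the phase is
  uniformly distributed, and every statement about \<open>T\<close> becomes one about \<open>\<psi>\<close> on a circle.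

  If \<open>\<psi> t = \<plusminus> 1 / t\<close>, the component is \<open>\<plusminus> tan \<alpha>\<close> with a sign that depends on \<open>cos \<alpha>\<close> only.
  The reflection \<open>\<alpha> \<mapsto> - \<alpha>\<close> keeps the sign and reverses the tangent, so the law is that of
  \<open>tan \<alpha>\<close>, which is the Cauchy law (lemma \<open>nn_integral_signed_tan_circle\<close>).

  Conversely, for \<open>0 < s < 1\<close> the conditional absolute moment of order \<open>s\<close> is, as a function of
  \<open>r\<^sup>2\<close>, an Abel integral of \<open>\<bar>\<psi> t\<bar>\<^sup>s + \<bar>\<psi> (- t)\<bar>\<^sup>s\<close>.  The Cauchy law prescribes it for almost every
  plane.  In dimension at least three the law of \<open>r\<^sup>2\<close> charges every Borel subset of \<open>(0, 1)\<close> of positive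
  Lebesgue measure (lemma \<open>AE_frame_squared_length\<close>), so it is prescribed for almost every \<open>r\<close>.
  An integrable solution of Abel's equation is the only one (lemma \<open>abel_equation_unique\<close>), and
  \<open>1 / t\<close> provides one, because its component is Cauchy.  Hence the sum equals \<open>2 / \<bar>t\<bar>\<^sup>s\<close>, and the two exponents
  \<open>1/4\<close> and \<open>1/2\<close> together force \<open>\<bar>\<psi> t\<bar> = \<bar>\<psi> (- t)\<bar> = 1 / \<bar>t\<bar>\<close>.

  For the analytic part put \<open>w = e\<^bsup>2 i \<alpha>\<^esup>\<close>, a rotation of the variable of \<open>b\<^sub>P\<close>.  Since
  \<open>F\<^sub>P = \<plusminus> tan \<alpha>\<close>, the value of \<open>b\<^sub>P\<close> is \<open>w\<close> or \<open>1 / w\<close>, according to the sign.  If \<open>f\<close> is bounded and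
  analytic with these boundary values, then \<open>(w f - 1) (f - w)\<close> is bounded and analytic with
  boundary values \<open>0\<close>, so it vanishes identically; near the origin the first factor is not zero,
  and therefore \<open>f = w\<close> (lemma \<open>boundary_rotation_of_two_branches\<close>).  The sign is thus \<open>+\<close> almost
  everywhere, which says \<open>\<psi> t = 1 / t\<close>.  In the other direction \<open>b\<^sub>P = w\<close> is itself the boundary
  function of a rotation.
\<close>

section \<open>Null sets and periodic integrals on the line\<close>

lemma negligible_iff_AE_lborel: "negligible S \<longleftrightarrow> (AE x in lborel. x \<notin> S)"
proof -
  have "S \<in> null_sets lebesgue" if "AE x in lebesgue. x \<notin> S"
  proof -
    from that obtain N where "{x. \<not> x \<notin> S} \<subseteq> N" "N \<in> null_sets lebesgue"
      by (auto simp: eventually_ae_filter)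
    then show ?thesis
      by (metis (no_types, lifting) Collect_mem_eq null_sets_completion_subset not_not Collect_cong)
  qed
  then have "negligible S \<longleftrightarrow> (AE x in lebesgue. x \<notin> S)"
    unfolding negligible_iff_null_sets by (auto intro: AE_not_in)
  then show ?thesis by (simp add: AE_completion_iff)
qed

text \<open>
  Transports almost-everywhere statements along translations, dilations, squaring and the
  angle of a sinusoid.
\<close>

lemma AE_not_vimage_null:
  fixes f f' :: "real \<Rightarrow> real"
  assumes "AE y in lborel. y \<notin> N"
    and "\<And>x. x \<in> S \<Longrightarrow> (f has_real_derivative f' x) (at x)" "\<And>x. x \<in> S \<Longrightarrow> f' x \<noteq> 0"
    and "AE x in lborel. x \<in> S"
  shows "AE x in lborel. f x \<notin> N"
proof -
  have "negligible {x \<in> S. f x \<in> N}"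
  proof (rule negligible_differentiable_vimage)
    show "negligible N" using assms(1) by (simp add: negligible_iff_AE_lborel)
    show "inj ((*) (f' x))" if "x \<in> S" for x
      using assms(3)[OF that] by (auto simp: inj_def)
    show "(f has_derivative (*) (f' x)) (at x within S)" if "x \<in> S" for x
      using assms(2)[OF that] by (auto simp: has_field_derivative_def intro: has_derivative_at_withinI)
  qed
  then show ?thesis using assms(4) by (auto simp: negligible_iff_AE_lborel)
qed

lemma countable_sinusoid_zeros:
  assumes "(A, B) \<noteq> (0, 0 :: real)"
  shows "countable {\<phi>. A * cos \<phi> + B * sin \<phi> = 0}"
proof -
  define r where "r = sqrt (A\<^sup>2 + B\<^sup>2)"
  have r: "r > 0" using assms by (auto simp: r_def sum_power2_gt_zero_iff)
  have "(A / r)\<^sup>2 + (B / r)\<^sup>2 = 1"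
    using r by (simp add: power_divide r_def flip: add_divide_distrib) (use assms in \<open>auto simp: sum_power2_eq_zero_iff\<close>)
  then obtain t where t: "A / r = cos t" "B / r = sin t"
    using sincos_total_2pi by metis
  have eq: "A * cos \<phi> + B * sin \<phi> = r * cos (\<phi> - t)" for \<phi>
  proof -
    have "A = r * cos t" "B = r * sin t" using t r by (auto simp: field_simps)
    then show ?thesis by (simp add: cos_diff algebra_simps)
  qed
  have "{\<phi>. A * cos \<phi> + B * sin \<phi> = 0} \<subseteq> (\<lambda>n. of_int n * (pi / 2) + t) ` (UNIV :: int set)"
  proof (intro subsetI, goal_cases)
    case (1 x)
    then have "cos (x - t) = 0" using r eq by auto
    then obtain i :: int where "x - t = of_int i * (pi / 2)" unfolding cos_zero_iff_int by blast
    then have "x = of_int i * (pi / 2) + t" by simp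
    then show ?case by blast
  qed
  then show ?thesis by (rule countable_subset) simp
qed

lemma AE_sinusoid_nonzero:
  assumes "(A, B) \<noteq> (0, 0 :: real)"
  shows "AE \<phi> in lborel. A * cos \<phi> + B * sin \<phi> \<noteq> 0"
  using AE_not_in[OF countable_imp_null_set_lborel[OF countable_sinusoid_zeros[OF assms]]] by simp

text \<open>
  The sinusoid is the coordinate of a vector rotated in a plane by a random angle; this is how
  absolute continuity of the law of a coordinate is obtained from rotation invariance alone.
\<close>

lemma AE_sinusoid_not_in_null:
  assumes "(A, B) \<noteq> (0, 0 :: real)" "AE y in lborel. y \<notin> N"
  shows "AE \<phi> in lborel. A * cos \<phi> + B * sin \<phi> \<notin> N"
proof (rule AE_not_vimage_null[OF assms(2), where S = "{\<phi>. B * cos \<phi> + - A * sin \<phi> \<noteq> 0}" and f' = "\<lambda>\<phi>. B * cos \<phi> + - A * sin \<phi>"])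
  show "AE \<phi> in lborel. \<phi> \<in> {\<phi>. B * cos \<phi> + - A * sin \<phi> \<noteq> 0}"
    using AE_sinusoid_nonzero[of B "-A"] assms(1) by auto
qed (auto intro!: derivative_eq_intros)

text \<open>
  For \<open>0 \<le> c \<le> p\<close> the part of the shifted interval that leaves \<open>(0,
  p]\<close> on the left is moved back by one period.
\<close>

lemma nn_integral_period_shift:
  fixes f :: "real \<Rightarrow> ennreal"
  assumes [measurable]: "f \<in> borel_measurable borel" and per: "\<And>x. f (x + p) = f x"
    and c: "0 \<le> c" "c \<le> p"
  shows "(\<integral>\<^sup>+x\<in>{0<..p}. f (x - c) \<partial>lborel) = (\<integral>\<^sup>+x\<in>{0<..p}. f x \<partial>lborel)"
proof -
  have "(\<integral>\<^sup>+x\<in>{0<..p}. f (x - c) \<partial>lborel) = (\<integral>\<^sup>+x\<in>{-c<..p-c}. f x \<partial>lborel)"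
    by (subst nn_integral_real_affine[where c = 1 and t = c])
       (auto simp: indicator_def algebra_simps intro!: nn_integral_cong)
  also have "\<dots> = (\<integral>\<^sup>+x\<in>{-c<..0}. f x \<partial>lborel) + (\<integral>\<^sup>+x\<in>{0<..p-c}. f x \<partial>lborel)"
    using c by (subst nn_integral_add[symmetric]) (auto simp: indicator_def intro!: nn_integral_cong)
  also have "(\<integral>\<^sup>+x\<in>{-c<..0}. f x \<partial>lborel) = (\<integral>\<^sup>+x\<in>{p-c<..p}. f x \<partial>lborel)"
  proof (subst nn_integral_real_affine[where c = 1 and t = "-p"])
    have "f (- p + 1 * x) = f x" for x using per[of "x - p"] by (simp add: algebra_simps)
    then show "ennreal \<bar>1\<bar> * (\<integral>\<^sup>+ x. f (- p + 1 * x) * indicator {- c<..0} (- p + 1 * x) \<partial>lborel) =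
       (\<integral>\<^sup>+x\<in>{p-c<..p}. f x \<partial>lborel)"
      by (auto simp: indicator_def intro!: nn_integral_cong)
  qed auto
  also have "\<dots> + (\<integral>\<^sup>+x\<in>{0<..p-c}. f x \<partial>lborel) = (\<integral>\<^sup>+x\<in>{0<..p}. f x \<partial>lborel)"
    using c by (subst nn_integral_add[symmetric]) (auto simp: indicator_def intro!: nn_integral_cong)
  finally show ?thesis .
qed

lemma nn_integral_reflect:
  fixes f :: "real \<Rightarrow> ennreal"
  assumes [measurable]: "f \<in> borel_measurable borel"
  shows "(\<integral>\<^sup>+x\<in>{a<..b}. f (a + b - x) \<partial>lborel) = (\<integral>\<^sup>+x\<in>{a<..b}. f x \<partial>lborel)"
proof (subst (2) nn_integral_real_affine[where c = "-1" and t = "a + b"])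
  have "AE x in lborel. x \<noteq> a" "AE x in lborel. x \<noteq> b"
    by (auto intro: AE_lborel_singleton)
  then have "(\<integral>\<^sup>+x\<in>{a<..b}. f (a + b - x) \<partial>lborel) =
      (\<integral>\<^sup>+ x. f (a + b + - 1 * x) * indicator {a<..b} (a + b + - 1 * x) \<partial>lborel)"
    by (intro nn_integral_cong_AE, eventually_elim) (auto simp: indicator_def)
  then show "(\<integral>\<^sup>+x\<in>{a<..b}. f (a + b - x) \<partial>lborel) = ennreal \<bar>-1\<bar> *
      (\<integral>\<^sup>+ x. f (a + b + - 1 * x) * indicator {a<..b} (a + b + - 1 * x) \<partial>lborel)" by simp
qed auto

section \<open>The Cauchy law and Abel's integral equation\<close>

text \<open>
  The tangent of an angle uniform on \<open>(-\<pi>/2, \<pi>/2)\<close> is Cauchy, because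
  both laws, multiplied by \<open>\<pi>\<close>, have the tail \<open>\<pi>/2 - arctan
  x\<close>.
\<close>

lemma nn_integral_tan:
  fixes f :: "real \<Rightarrow> ennreal"
  assumes [measurable]: "f \<in> borel_measurable borel"
  shows "(\<integral>\<^sup>+x\<in>{-(pi/2)<..<pi/2}. f (tan x) \<partial>lborel) = ennreal pi * (\<integral>\<^sup>+x. f x \<partial>std_cauchy)"
proof -
  let ?I = "{-(pi/2)<..<pi/2}"
  let ?A = "distr (density lborel (indicator ?I)) borel (tan :: real \<Rightarrow> real)"
  let ?B = "density lborel (\<lambda>x::real. ennreal (1 / (1 + x\<^sup>2)))"
  have [measurable]: "(tan :: real \<Rightarrow> real) \<in> borel_measurable borel"
    unfolding tan_def[abs_def] by measurable
  have A: "emeasure ?A {x<..} = ennreal (pi / 2 - arctan x)" for x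
  proof -
    have "{y \<in> ?I. x < tan y} = {arctan x<..<pi/2}"
    proof (intro set_eqI iffI)
      fix y assume "y \<in> {y \<in> ?I. x < tan y}"
      then have "arctan x < arctan (tan y)" "arctan (tan y) = y" "y < pi/2"
        by (auto intro: arctan_monotone arctan_tan)
      then show "y \<in> {arctan x<..<pi/2}" by simp
    next
      fix y assume y: "y \<in> {arctan x<..<pi/2}"
      then have "tan (arctan x) < tan y" using arctan_lbound[of x] by (intro tan_monotone) auto
      then show "y \<in> {y \<in> ?I. x < tan y}" using y arctan_lbound[of x] by (auto simp: tan_arctan)
    qed
    moreover have "emeasure ?A {x<..} = emeasure lborel {y \<in> ?I. x < tan y}"
      by (subst emeasure_distr, simp, simp, subst emeasure_density)
         (auto simp: vimage_def indicator_def nn_integral_indicator[symmetric] simp del: nn_integral_indicator intro!: nn_integral_cong)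
    ultimately show ?thesis using arctan_ubound[of x] by simp
  qed
  have B: "emeasure ?B {x<..} = ennreal (pi / 2 - arctan x)" for x
  proof -
    have "emeasure ?B {x<..} = (\<integral>\<^sup>+y\<in>{x<..}. ennreal (1 / (1 + y\<^sup>2)) \<partial>lborel)"
      by (subst emeasure_density) auto
    also have "\<dots> = (\<integral>\<^sup>+y\<in>{x..}. ennreal (1 / (1 + y\<^sup>2)) \<partial>lborel)"
      using AE_lborel_singleton[of x] by (intro nn_integral_cong_AE) (auto simp: indicator_def)
    also have "\<dots> = ennreal (pi / 2 - arctan x)"
      by (rule nn_integral_FTC_atLeast)
         (auto intro!: tendsto_arctan_at_top derivative_eq_intros simp: field_simps)
    finally show ?thesis .
  qed
  have AB: "?A = ?B"
    by (rule measure_eqI_lessThan) (simp_all only: A B, auto)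
  have "(\<integral>\<^sup>+x\<in>?I. f (tan x) \<partial>lborel) = (\<integral>\<^sup>+x. f x \<partial>?A)"
    by (subst nn_integral_distr, simp, simp, subst nn_integral_density) (auto simp: mult.commute)
  also have "\<dots> = (\<integral>\<^sup>+x. ennreal (1 / (1 + x\<^sup>2)) * f x \<partial>lborel)"
    unfolding AB by (subst nn_integral_density) auto
  also have "\<dots> = (\<integral>\<^sup>+x. ennreal pi * (ennreal (1 / (pi * (1 + x\<^sup>2))) * f x) \<partial>lborel)"
    by (intro nn_integral_cong) (simp add: mult.assoc[symmetric] flip: ennreal_mult)
  also have "\<dots> = ennreal pi * (\<integral>\<^sup>+x. f x \<partial>std_cauchy)"
    unfolding std_cauchy_def by (subst nn_integral_cmult, measurable, subst nn_integral_density) auto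
  finally show ?thesis .
qed

lemma nn_integral_tan_circle:
  fixes f :: "real \<Rightarrow> ennreal"
  assumes [measurable]: "f \<in> borel_measurable borel"
  shows "(\<integral>\<^sup>+x\<in>{0<..2*pi}. f (tan x) \<partial>lborel) = ennreal (2 * pi) * (\<integral>\<^sup>+x. f x \<partial>std_cauchy)"
proof -
  have [measurable]: "(tan :: real \<Rightarrow> real) \<in> borel_measurable borel"
    unfolding tan_def[abs_def] by measurable
  have "(\<integral>\<^sup>+x\<in>{0<..pi}. f (tan x) \<partial>lborel) = (\<integral>\<^sup>+x\<in>{0<..pi}. f (tan (x - pi/2)) \<partial>lborel)"
    by (rule nn_integral_period_shift[symmetric]) auto
  also have "\<dots> = (\<integral>\<^sup>+x\<in>{-(pi/2)<..<pi/2}. f (tan x) \<partial>lborel)"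
  proof -
    have "(\<integral>\<^sup>+x. f (tan x) * indicator {0<..pi} (pi/2 + x) \<partial>lborel) =
        (\<integral>\<^sup>+x\<in>{-(pi/2)<..<pi/2}. f (tan x) \<partial>lborel)"
      using AE_lborel_singleton[of "pi/2"]
      by (intro nn_integral_cong_AE, eventually_elim) (auto simp: indicator_def)
    then show ?thesis
      by (subst nn_integral_real_affine[where c = 1 and t = "pi/2"]) auto
  qed
  finally have half: "(\<integral>\<^sup>+x\<in>{0<..pi}. f (tan x) \<partial>lborel) = ennreal pi * (\<integral>\<^sup>+x. f x \<partial>std_cauchy)"
    by (simp add: nn_integral_tan)
  have "(\<integral>\<^sup>+x\<in>{0<..2*pi}. f (tan x) \<partial>lborel) =
      (\<integral>\<^sup>+x\<in>{0<..pi}. f (tan x) \<partial>lborel) + (\<integral>\<^sup>+x\<in>{pi<..2*pi}. f (tan x) \<partial>lborel)"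
    by (subst nn_integral_add[symmetric]) (auto simp: indicator_def intro!: nn_integral_cong)
  also have "(\<integral>\<^sup>+x\<in>{pi<..2*pi}. f (tan x) \<partial>lborel) = (\<integral>\<^sup>+x\<in>{0<..pi}. f (tan x) \<partial>lborel)"
  proof (subst nn_integral_real_affine[where c = 1 and t = pi])
    have "tan (pi + 1 * x) = tan x" for x :: real using tan_periodic_pi[of x] by (simp add: add.commute)
    then show "ennreal \<bar>1\<bar> * (\<integral>\<^sup>+ x. f (tan (pi + 1 * x)) * indicator {pi<..2*pi} (pi + 1 * x) \<partial>lborel) =
       (\<integral>\<^sup>+x\<in>{0<..pi}. f (tan x) \<partial>lborel)"
      by (auto simp: indicator_def intro!: nn_integral_cong)
  qed auto
  also have "(\<integral>\<^sup>+x\<in>{0<..pi}. f (tan x) \<partial>lborel) + (\<integral>\<^sup>+x\<in>{0<..pi}. f (tan x) \<partial>lborel) =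
      (ennreal pi + ennreal pi) * (\<integral>\<^sup>+x. f x \<partial>std_cauchy)"
    unfolding half by (simp only: distrib_right)
  also have "ennreal pi + ennreal pi = ennreal (2 * pi)"
    by (simp flip: ennreal_plus)
  finally show ?thesis .
qed

text \<open>
  Up to sign the integrand is evaluated at \<open>tan x\<close>.  The sign is a function of
  \<open>cos x\<close>, which is unchanged under \<open>x \<mapsto> 2\<pi> - x\<close> whereas
  the tangent changes sign.  Averaging over this reflection replaces \<open>f\<close> by its
  even part and removes the sign.
\<close>

lemma nn_integral_signed_tan_circle:
  fixes f :: "real \<Rightarrow> ennreal" and h :: "real \<Rightarrow> real"
  assumes [measurable]: "f \<in> borel_measurable borel" "h \<in> borel_measurable borel"
    and h: "AE x in lborel. \<bar>h (r * cos x)\<bar> = 1 / \<bar>r * cos x\<bar>" and r: "r > 0"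
  shows "(\<integral>\<^sup>+x\<in>{0<..2*pi}. f (- (h (r * cos x) * (r * sin x))) \<partial>lborel) =
    ennreal (2 * pi) * (\<integral>\<^sup>+x. f x \<partial>std_cauchy)" (is "?L = ?R")
proof -
  let ?X = "\<lambda>x. h (r * cos x) * (r * sin x)"
  have [measurable]: "(tan :: real \<Rightarrow> real) \<in> borel_measurable borel"
    unfolding tan_def[abs_def] by measurable
  have sc: "cos (2 * pi - x) = cos x" "sin (2 * pi - x) = - sin x" "tan (2 * pi - x) = - tan x" for x :: real
    by (simp_all add: cos_diff sin_diff tan_def)
  have 1: "?L = (\<integral>\<^sup>+x\<in>{0<..2*pi}. f (?X x) \<partial>lborel)"
    by (subst nn_integral_reflect[symmetric]) (auto simp: sc)
  have 2: "?R = (\<integral>\<^sup>+x\<in>{0<..2*pi}. f (- tan x) \<partial>lborel)"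
    by (subst nn_integral_tan_circle[symmetric], simp, subst nn_integral_reflect[symmetric]) (auto simp: sc)
  have "2 * ?L = ?L + (\<integral>\<^sup>+x\<in>{0<..2*pi}. f (?X x) \<partial>lborel)"
    unfolding 1[symmetric] by (rule mult_2)
  also have "\<dots> = (\<integral>\<^sup>+x\<in>{0<..2*pi}. (f (- ?X x) + f (?X x)) \<partial>lborel)"
    by (subst nn_integral_add[symmetric]) (auto simp: distrib_right)
  also have "\<dots> = (\<integral>\<^sup>+x\<in>{0<..2*pi}. (f (- tan x) + f (tan x)) \<partial>lborel)"
  proof (intro nn_integral_cong_AE)
    have "AE x in lborel. 1 * cos x + 0 * sin x \<noteq> (0::real)" by (rule AE_sinusoid_nonzero) simp
    with h show "AE x in lborel. (f (- ?X x) + f (?X x)) * indicator {0<..2*pi} x =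
        (f (- tan x) + f (tan x)) * indicator {0<..2*pi} x"
    proof eventually_elim
      case (elim x)
      then have "\<bar>?X x\<bar> = \<bar>tan x\<bar>" using r by (simp add: abs_mult tan_def)
      then have "?X x = tan x \<or> ?X x = - tan x" by linarith
      then show ?case by (auto simp: add.commute)
    qed
  qed
  also have "\<dots> = (\<integral>\<^sup>+x\<in>{0<..2*pi}. f (- tan x) \<partial>lborel) + (\<integral>\<^sup>+x\<in>{0<..2*pi}. f (tan x) \<partial>lborel)"
    by (subst nn_integral_add[symmetric]) (auto simp: distrib_right)
  also have "\<dots> = 2 * ?R"
    unfolding 2[symmetric] nn_integral_tan_circle[OF assms(1)] by (rule mult_2[symmetric])
  finally show ?thesis by (simp add: ennreal_mult_cancel_left)
qed

lemma sets_std_cauchy [simp, measurable_cong]: "sets std_cauchy = sets borel"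
  by (simp add: std_cauchy_def)

lemma prob_space_std_cauchy: "prob_space std_cauchy"
proof
  have "ennreal pi * emeasure std_cauchy (space std_cauchy) = ennreal pi * 1"
    using nn_integral_tan[of "\<lambda>_. 1"] by (simp add: ennreal_mult_cancel_left)
  then show "emeasure std_cauchy (space std_cauchy) = 1"
    unfolding ennreal_mult_cancel_left by auto
qed

text \<open>
  After the affine substitution \<open>x = y + (Z - y) z\<close> all powers of \<open>Z -
  y\<close> cancel, so the composed kernel does not depend on \<open>y\<close>.  This is what
  makes Abel's equation invertible.
\<close>

lemma nn_integral_abel_kernel:
  assumes p: "0 < p" "p < 1" and "y < Z"
  shows "(\<integral>\<^sup>+x\<in>{y<..<Z}. ennreal ((x - y) powr (p - 1) * (Z - x) powr (- p)) \<partial>lborel) = ennreal (Beta p (1 - p))"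
proof -
  define c where "c = Z - y"
  have c: "c > 0" using assms by (simp add: c_def)
  have "(\<integral>\<^sup>+x\<in>{y<..<Z}. ennreal ((x - y) powr (p - 1) * (Z - x) powr (- p)) \<partial>lborel) =
     ennreal c * (\<integral>\<^sup>+z. ennreal ((c * z) powr (p - 1) * (Z - (y + c * z)) powr (- p)) * indicator {y<..<Z} (y + c * z) \<partial>lborel)"
    using c by (subst nn_integral_real_affine[where c = c and t = y]) auto
  also have "\<dots> = ennreal c * (\<integral>\<^sup>+z. ennreal (1 / c) * ennreal (indicator {0..1} z * (z powr (p - 1) * (1 - z) powr (1 - p - 1))) \<partial>lborel)"
  proof (intro arg_cong[where f = "(*) (ennreal c)"] nn_integral_cong_AE, goal_cases)
    case 1
    show ?case using AE_lborel_singleton[of 0] AE_lborel_singleton[of 1]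
    proof eventually_elim
      case (elim z)
      have ind: "y < y + c * z \<and> y + c * z < Z \<longleftrightarrow> 0 < z \<and> z < 1" 
      proof -
        have "c * z < c \<longleftrightarrow> z < 1" "0 < c * z \<longleftrightarrow> 0 < z" using c by (auto simp: zero_less_mult_iff)
        moreover have "Z = y + c" by (simp add: c_def)
        ultimately show ?thesis by simp
      qed
      show ?case
      proof (cases "0 < z \<and> z < 1")
        case True
        have "Z - (y + c * z) = c * (1 - z)" by (simp add: c_def algebra_simps)
        then have "(c * z) powr (p - 1) * (Z - (y + c * z)) powr (- p) = c powr (p - 1) * c powr (-p) * (z powr (p - 1) * (1 - z) powr (-p))"
          using c True by (simp add: powr_mult)
        also have "c powr (p - 1) * c powr (-p) = 1 / c"
          using c powr_add[of c "p - 1" "- p"] by (simp add: powr_minus_divide)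
        finally show ?thesis using True ind c by (simp add: indicator_def flip: ennreal_mult)
      next
        case False
        then show ?thesis using elim ind by (auto simp: indicator_def)
      qed
    qed
  qed
  also have "\<dots> = ennreal c * (ennreal (1 / c) * ennreal (Beta p (1 - p)))"
    using has_integral_Beta_real[of p "1 - p"] p
    by (subst nn_integral_cmult) (auto intro!: arg_cong[where f = "\<lambda>x. _ * (_ * x)"] nn_integral_has_integral_lebesgue)
  also have "\<dots> = ennreal (Beta p (1 - p))"
    using c by (simp add: mult.assoc[symmetric] flip: ennreal_mult)
  finally show ?thesis .
qed

text \<open>
  Integrating an Abel transform against the conjugate kernel gives back the primitive of
  \<open>G\<close> by Tonelli's theorem.
\<close>

lemma nn_integral_abel_transform:
  fixes G :: "real \<Rightarrow> ennreal"
  assumes [measurable]: "G \<in> borel_measurable borel" and p: "0 < p" "p < 1"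
  shows "(\<integral>\<^sup>+x\<in>{0<..<Z}. ennreal ((Z - x) powr (- p)) *
             (\<integral>\<^sup>+y\<in>{0<..<x}. G y * ennreal ((x - y) powr (p - 1)) \<partial>lborel) \<partial>lborel) =
    ennreal (Beta p (1 - p)) * (\<integral>\<^sup>+y\<in>{0<..<Z}. G y \<partial>lborel)" (is "?L = ?R")
proof -
  let ?K = "\<lambda>x y. ennreal ((x - y) powr (p - 1) * (Z - x) powr (- p))"
  have "?L = (\<integral>\<^sup>+x. \<integral>\<^sup>+y. (if 0 < y \<and> y < x \<and> x < Z then G y * ?K x y else 0) \<partial>lborel \<partial>lborel)"
    by (auto simp: indicator_def ennreal_mult mult_ac simp flip: nn_integral_cmult intro!: nn_integral_cong)
  also have "\<dots> = (\<integral>\<^sup>+y. \<integral>\<^sup>+x. (if 0 < y \<and> y < x \<and> x < Z then G y * ?K x y else 0) \<partial>lborel \<partial>lborel)"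
    by (rule lborel_pair.Fubini') measurable
  also have "\<dots> = (\<integral>\<^sup>+y. G y * indicator {0<..<Z} y * (\<integral>\<^sup>+x\<in>{y<..<Z}. ?K x y \<partial>lborel) \<partial>lborel)"
    by (subst nn_integral_cmult[symmetric]) (auto simp: indicator_def intro!: nn_integral_cong)
  also have "\<dots> = (\<integral>\<^sup>+y. ennreal (Beta p (1 - p)) * (G y * indicator {0<..<Z} y) \<partial>lborel)"
  proof (intro nn_integral_cong)
    fix y
    show "G y * indicator {0<..<Z} y * (\<integral>\<^sup>+x\<in>{y<..<Z}. ?K x y \<partial>lborel) =
       ennreal (Beta p (1 - p)) * (G y * indicator {0<..<Z} y)"
    proof (cases "y \<in> {0<..<Z}")
      case True
      then show ?thesis using nn_integral_abel_kernel[OF p, of y Z] by (simp add: mult_ac)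
    qed simp
  qed
  also have "\<dots> = ?R" by (rule nn_integral_cmult) measurable
  finally show ?thesis .
qed

text \<open>
  Equal Abel transforms have equal primitives.  As one primitive is finite, the measures with
  densities \<open>G\<close> and \<open>G'\<close> on \<open>(0, 1)\<close> coincide.
\<close>

lemma abel_equation_unique:
  fixes G G' :: "real \<Rightarrow> ennreal"
  assumes [measurable]: "G \<in> borel_measurable borel" "G' \<in> borel_measurable borel" and p: "0 < p" "p < 1"
    and eq: "AE x in lborel. x \<in> {0<..<1} \<longrightarrow>
       (\<integral>\<^sup>+y\<in>{0<..<x}. G y * ennreal ((x - y) powr (p - 1)) \<partial>lborel) =
       (\<integral>\<^sup>+y\<in>{0<..<x}. G' y * ennreal ((x - y) powr (p - 1)) \<partial>lborel)"
    and fin: "(\<integral>\<^sup>+y\<in>{0<..<1}. G' y \<partial>lborel) < \<infinity>"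
  shows "AE y in lborel. y \<in> {0<..<1} \<longrightarrow> G y = G' y"
proof -
  have B: "Beta p (1 - p) > 0" using p by (simp add: Beta_def Gamma_real_pos)
  have I: "(\<integral>\<^sup>+y\<in>{0<..<Z}. G y \<partial>lborel) = (\<integral>\<^sup>+y\<in>{0<..<Z}. G' y \<partial>lborel)" if "Z \<le> 1" for Z
  proof -
    have "ennreal (Beta p (1 - p)) * (\<integral>\<^sup>+y\<in>{0<..<Z}. G y \<partial>lborel) =
          ennreal (Beta p (1 - p)) * (\<integral>\<^sup>+y\<in>{0<..<Z}. G' y \<partial>lborel)"
      unfolding nn_integral_abel_transform[OF assms(1) p, symmetric] nn_integral_abel_transform[OF assms(2) p, symmetric]
    proof (intro nn_integral_cong_AE)
      show "AE x in lborel. ennreal ((Z - x) powr (- p)) *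
             (\<integral>\<^sup>+y\<in>{0<..<x}. G y * ennreal ((x - y) powr (p - 1)) \<partial>lborel) * indicator {0<..<Z} x =
             ennreal ((Z - x) powr (- p)) *
             (\<integral>\<^sup>+y\<in>{0<..<x}. G' y * ennreal ((x - y) powr (p - 1)) \<partial>lborel) * indicator {0<..<Z} x"
        using eq by eventually_elim (use that in \<open>auto simp: indicator_def\<close>)
    qed
    then show ?thesis using B by (simp add: ennreal_mult_cancel_left)
  qed
  let ?D = "\<lambda>G y. (G y :: ennreal) * indicator {0<..<1::real} y"
  have "density lborel (?D G) = density lborel (?D G')"
  proof (rule measure_eqI_lessThan)
    fix x :: real
    have em: "emeasure (density lborel (?D H)) {x<..} = (\<integral>\<^sup>+y\<in>{max 0 x<..<1}. H y \<partial>lborel)"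
      if [measurable]: "H \<in> borel_measurable borel" for H
      by (subst emeasure_density) (auto simp: indicator_def intro!: nn_integral_cong)
    have split: "(\<integral>\<^sup>+y\<in>{0<..<max 0 x}. H y \<partial>lborel) + (\<integral>\<^sup>+y\<in>{max 0 x<..<1}. H y \<partial>lborel) = (\<integral>\<^sup>+y\<in>{0<..<1}. H y \<partial>lborel)"
      if [measurable]: "H \<in> borel_measurable borel" and "x < 1" for H
    proof (subst nn_integral_add[symmetric])
      show "(\<integral>\<^sup>+y. H y * indicator {0<..<max 0 x} y + H y * indicator {max 0 x<..<1} y \<partial>lborel) =
         (\<integral>\<^sup>+y\<in>{0<..<1}. H y \<partial>lborel)"
        using AE_lborel_singleton[of "max 0 x"]
        by (intro nn_integral_cong_AE, eventually_elim) (use \<open>x < 1\<close> in \<open>auto simp: indicator_def\<close>)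
    qed auto
    have le: "(\<integral>\<^sup>+y\<in>A. G' y \<partial>lborel) < \<infinity>" if "A \<subseteq> {0<..<1}" for A
      by (rule le_less_trans[OF nn_integral_mono fin]) (use that in \<open>auto simp: indicator_def\<close>)
    have eqx: "(\<integral>\<^sup>+y\<in>{max 0 x<..<1}. G y \<partial>lborel) = (\<integral>\<^sup>+y\<in>{max 0 x<..<1}. G' y \<partial>lborel)"
    proof (cases "x < 1")
      case True
      have "(\<integral>\<^sup>+y\<in>{0<..<max 0 x}. G' y \<partial>lborel) + (\<integral>\<^sup>+y\<in>{max 0 x<..<1}. G y \<partial>lborel) =
            (\<integral>\<^sup>+y\<in>{0<..<max 0 x}. G' y \<partial>lborel) + (\<integral>\<^sup>+y\<in>{max 0 x<..<1}. G' y \<partial>lborel)"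
        using split[OF assms(1) True] split[OF assms(2) True] I[of "max 0 x"] I[of 1] True by simp
      moreover have "(\<integral>\<^sup>+y\<in>{0<..<max 0 x}. G' y \<partial>lborel) < \<infinity>" using True by (intro le) auto
      ultimately show ?thesis by (auto simp: ennreal_add_left_cancel)
    qed (auto simp: indicator_def)
    then show "emeasure (density lborel (?D G)) {x<..} = emeasure (density lborel (?D G')) {x<..}"
      by (simp add: em)
    show "emeasure (density lborel (?D G)) {x<..} < \<infinity>"
      unfolding em[OF assms(1)] eqx by (rule le) auto
  qed auto
  then have "AE y in lborel. ?D G y = ?D G' y"
    by (intro sigma_finite_measure.density_unique[OF sigma_finite_lborel]) auto
  then show ?thesis by eventually_elim (auto simp: indicator_def)
qed

section \<open>Circular moments determine the modulus\<close>

text \<open>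
  The two points \<open>\<plusminus>\<surd>y\<close> of the line lie over the same squared
  height \<open>y\<close>; the factor \<open>1 / (2 \<surd>y)\<close> is the Jacobian of
  \<open>t = \<surd>y\<close>.
\<close>

definition folded_moment :: "real \<Rightarrow> (real \<Rightarrow> real) \<Rightarrow> real \<Rightarrow> ennreal" where
  "folded_moment s h y = ennreal ((\<bar>h (sqrt y)\<bar> powr s + \<bar>h (- sqrt y)\<bar> powr s) / (2 * sqrt y))"

lemma measurable_folded_moment [measurable]:
  assumes [measurable]: "h \<in> borel_measurable borel"
  shows "folded_moment s h \<in> borel_measurable borel"
  unfolding folded_moment_def[abs_def] by measurable

text \<open>
  On a quarter of the circle the substitution \<open>y = r\<^sup>2 cos\<^sup>2
  \<alpha>\<close> turns the power of \<open>r sin \<alpha> = \<surd>(r\<^sup>2 - y)\<close>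
  into an Abel kernel; the four quarters contribute through the symmetries \<open>\<alpha>
  \<mapsto> \<pi> + \<alpha>\<close> and \<open>\<alpha> \<mapsto> \<pi> - \<alpha>\<close>,
  which fold the values of \<open>h\<close> at \<open>t\<close> and \<open>- t\<close>
  together.
\<close>

lemma circle_moment_eq_abel:
  assumes [measurable]: "h \<in> borel_measurable borel" and r: "r > 0" and s: "0 < s" "s < 1"
  shows "(\<integral>\<^sup>+\<alpha>\<in>{0<..2*pi}. ennreal (\<bar>h (r * cos \<alpha>) * (r * sin \<alpha>)\<bar> powr s) \<partial>lborel) =
     2 * (\<integral>\<^sup>+y\<in>{0<..<r\<^sup>2}. folded_moment s h y * ennreal ((r\<^sup>2 - y) powr ((s + 1) / 2 - 1)) \<partial>lborel)"
proof -
  define k where "k t = \<bar>h t\<bar> powr s + \<bar>h (- t)\<bar> powr s" for t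
  have [measurable]: "k \<in> borel_measurable borel" unfolding k_def[abs_def] by measurable
  have k_even: "k (- t) = k t" and k0: "k t \<ge> 0" for t by (auto simp: k_def)
  define m where "m \<alpha> = ennreal (\<bar>h (r * cos \<alpha>) * (r * sin \<alpha>)\<bar> powr s)" for \<alpha>
  define n where "n \<alpha> = ennreal (k (r * cos \<alpha>) * \<bar>r * sin \<alpha>\<bar> powr s)" for \<alpha>
  have [measurable]: "m \<in> borel_measurable borel" "n \<in> borel_measurable borel"
    unfolding m_def[abs_def] n_def[abs_def] by measurable
  have n: "n \<alpha> = m \<alpha> + m (pi + \<alpha>)" for \<alpha>
    by (auto simp: n_def m_def k_def cos_add sin_add abs_mult powr_mult distrib_right simp flip: ennreal_plus)
  have "(\<integral>\<^sup>+\<alpha>\<in>{0<..2*pi}. m \<alpha> \<partial>lborel) = (\<integral>\<^sup>+\<alpha>\<in>{0<..pi}. m \<alpha> \<partial>lborel) + (\<integral>\<^sup>+\<alpha>\<in>{pi<..2*pi}. m \<alpha> \<partial>lborel)"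
    by (subst nn_integral_add[symmetric]) (auto simp: indicator_def intro!: nn_integral_cong)
  also have "(\<integral>\<^sup>+\<alpha>\<in>{pi<..2*pi}. m \<alpha> \<partial>lborel) = (\<integral>\<^sup>+\<alpha>\<in>{0<..pi}. m (pi + \<alpha>) \<partial>lborel)"
    by (subst nn_integral_real_affine[where c = 1 and t = pi]) (auto simp: indicator_def intro!: nn_integral_cong)
  also have "(\<integral>\<^sup>+\<alpha>\<in>{0<..pi}. m \<alpha> \<partial>lborel) + \<dots> = (\<integral>\<^sup>+\<alpha>\<in>{0<..pi}. n \<alpha> \<partial>lborel)"
    by (subst nn_integral_add[symmetric]) (auto simp: indicator_def n intro!: nn_integral_cong)
  also have "\<dots> = (\<integral>\<^sup>+\<alpha>\<in>{0<..<pi/2}. n \<alpha> \<partial>lborel) + (\<integral>\<^sup>+\<alpha>\<in>{pi/2<..<pi}. n \<alpha> \<partial>lborel)"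
  proof (subst nn_integral_add[symmetric])
    show "(\<integral>\<^sup>+\<alpha>\<in>{0<..pi}. n \<alpha> \<partial>lborel) =
        (\<integral>\<^sup>+\<alpha>. n \<alpha> * indicator {0<..<pi/2} \<alpha> + n \<alpha> * indicator {pi/2<..<pi} \<alpha> \<partial>lborel)"
      using AE_lborel_singleton[of pi] AE_lborel_singleton[of "pi/2"]
      by (intro nn_integral_cong_AE, eventually_elim) (auto simp: indicator_def)
  qed auto
  also have "(\<integral>\<^sup>+\<alpha>\<in>{0<..<pi/2}. n \<alpha> \<partial>lborel) = (\<integral>\<^sup>+\<alpha>\<in>{pi/2<..<pi}. n \<alpha> \<partial>lborel)"
  proof (subst nn_integral_real_affine[where c = "-1" and t = pi])
    have "n (pi + -1 * x) = n x" for x by (simp add: n_def k_even cos_diff sin_diff)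
    then show "ennreal \<bar>-1\<bar> * (\<integral>\<^sup>+ x. n (pi + -1 * x) * indicator {0<..<pi/2} (pi + -1 * x) \<partial>lborel) =
        (\<integral>\<^sup>+\<alpha>\<in>{pi/2<..<pi}. n \<alpha> \<partial>lborel)"
      by (auto simp: indicator_def intro!: nn_integral_cong)
  qed auto
  also have "(\<integral>\<^sup>+\<alpha>\<in>{pi/2<..<pi}. n \<alpha> \<partial>lborel) =
     (\<integral>\<^sup>+y\<in>{0<..<r\<^sup>2}. folded_moment s h y * ennreal ((r\<^sup>2 - y) powr ((s + 1) / 2 - 1)) \<partial>lborel)" (is "_ = ?R")
  proof -
    define f where "f y = k (sqrt y) / (2 * sqrt y) * (r\<^sup>2 - y) powr ((s + 1) / 2 - 1)" for y
    define g where "g \<alpha> = r\<^sup>2 * (cos \<alpha>)\<^sup>2" for \<alpha>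
    define g' where "g' \<alpha> = - 2 * r\<^sup>2 * cos \<alpha> * sin \<alpha>" for \<alpha>
    have [measurable]: "f \<in> borel_measurable borel" unfolding f_def[abs_def] by measurable
    have "?R = (\<integral>\<^sup>+y. ennreal (f y * indicator {g (pi/2)..g pi} y) \<partial>lborel)"
    proof (intro nn_integral_cong_AE)
      show "AE y in lborel. folded_moment s h y * ennreal ((r\<^sup>2 - y) powr ((s + 1) / 2 - 1)) * indicator {0<..<r\<^sup>2} y =
         ennreal (f y * indicator {g (pi/2)..g pi} y)"
        using AE_lborel_singleton[of 0] AE_lborel_singleton[of "r\<^sup>2"]
        by eventually_elim (auto simp: indicator_def folded_moment_def f_def g_def k_def simp flip: ennreal_mult)
    qed
    also have "\<dots> = (\<integral>\<^sup>+\<alpha>. ennreal (f (g \<alpha>) * g' \<alpha> * indicator {pi/2..pi} \<alpha>) \<partial>lborel)"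
    proof (subst nn_integral_substitution[where f = f and g = g and g' = g' and a = "pi/2" and b = pi])
      show "continuous_on {pi/2..pi} g'" unfolding g'_def by (intro continuous_intros)
      show "(g has_real_derivative g' x) (at x)" for x
        unfolding g_def g'_def by (auto intro!: derivative_eq_intros simp: power2_eq_square)
      show "g' x \<ge> 0" if "x \<in> {pi/2..pi}" for x
      proof -
        have "cos x \<le> 0" "sin x \<ge> 0" using that cos_ge_zero[of "pi - x"] sin_ge_zero[of x] pi_gt_zero
          by (auto simp: cos_diff)
        then show ?thesis by (auto simp: g'_def mult_nonpos_nonneg mult_nonneg_nonpos)
      qed
    qed (auto simp: ennreal_mult'' ennreal_indicator[symmetric] set_borel_measurable_def indicator_def intro!: nn_integral_cong)
    also have "\<dots> = (\<integral>\<^sup>+\<alpha>\<in>{pi/2<..<pi}. n \<alpha> \<partial>lborel)"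
    proof (intro nn_integral_cong_AE)
      show "AE x in lborel. ennreal (f (g x) * g' x * indicator {pi/2..pi} x) = n x * indicator {pi/2<..<pi} x"
        using AE_lborel_singleton[of "pi/2"] AE_lborel_singleton[of "pi"]
      proof eventually_elim
        case (elim x)
        show ?case
        proof (cases "x \<in> {pi/2<..<pi}")
          case True
          then have c: "cos x < 0" and sn: "sin x > 0"
            using cos_gt_zero_pi[of "pi - x"] sin_gt_zero[of x] pi_gt_zero by (auto simp: cos_diff)
          have sq: "sqrt (g x) = - (r * cos x)"
            using c r by (simp add: g_def real_sqrt_mult)
          have "r\<^sup>2 - g x = (r * sin x)\<^sup>2"
            by (simp add: g_def power_mult_distrib sin_squared_eq algebra_simps)
          moreover have "w\<^sup>2 powr u = w powr (2 * u)" if "w > 0" for w u :: real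
            using that powr_powr[of w 2 u] by (simp add: powr_numeral)
          ultimately have "(r\<^sup>2 - g x) powr ((s + 1) / 2 - 1) = (r * sin x) powr (2 * ((s + 1) / 2 - 1))"
            using r sn by simp
          also have "2 * ((s + 1) / 2 - 1) = s - 1" by simp
          finally have pw: "(r\<^sup>2 - g x) powr ((s + 1) / 2 - 1) * (r * sin x) = (r * sin x) powr s"
            using r sn by (simp add: powr_diff)
          have "f (g x) * g' x = k (r * cos x) * (((r\<^sup>2 - g x) powr ((s + 1) / 2 - 1)) * (r * sin x))"
            using c r by (simp add: f_def sq k_even g'_def power2_eq_square)
          then have "f (g x) * g' x = k (r * cos x) * (r * sin x) powr s" by (simp only: pw)
          moreover have "indicator {pi/2..pi} x = (1::real)" "indicator {pi/2<..<pi} x = (1::ennreal)"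
            "\<bar>r * sin x\<bar> = r * sin x" using True r sn by auto
          ultimately show ?thesis by (simp only: n_def mult_1_right)
        qed (use elim in \<open>auto simp: indicator_def\<close>)
      qed
    qed
    finally show ?thesis by simp
  qed
  finally show ?thesis by (simp only: m_def mult_2)
qed

text \<open>The case of equality between the arithmetic and the quadratic mean.\<close>

lemma eq_of_power_means:
  fixes A B c :: real
  assumes "A + B = 2 * c" "A\<^sup>2 + B\<^sup>2 = 2 * c\<^sup>2"
  shows "A = c" "B = c"
proof -
  have "(A - B)\<^sup>2 + (A + B)\<^sup>2 = 2 * (A\<^sup>2 + B\<^sup>2)" by (simp add: power2_eq_square algebra_simps)
  then have "(A - B)\<^sup>2 = 0" unfolding assms by (simp add: power_mult_distrib)
  then show "A = c" "B = c" using assms(1) by auto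
qed

text \<open>
  The function \<open>1 / t\<close> has the prescribed circular moments, so uniqueness for
  Abel's equation identifies the folded moments of \<open>h\<close> with those of \<open>1 /
  t\<close>.  One exponent only determines a sum over \<open>\<plusminus>t\<close>; with the
  exponents \<open>1/4\<close> and \<open>1/2\<close> the numbers \<open>\<bar>h
  t\<bar>\<^bsup>1/4\<^esup>\<close> and \<open>\<bar>h (- t)\<bar>\<^bsup>1/4\<^esup>\<close>
  have equal arithmetic and quadratic means and must agree.
\<close>

lemma reciprocal_modulus_of_moments:
  assumes [measurable]: "h \<in> borel_measurable borel"
    and mom: "\<And>s. 0 < s \<Longrightarrow> s < 1 \<Longrightarrow> AE x in lborel. x \<in> {0<..<1} \<longrightarrow>
      (\<integral>\<^sup>+\<alpha>\<in>{0<..2*pi}. ennreal (\<bar>h (sqrt x * cos \<alpha>) * (sqrt x * sin \<alpha>)\<bar> powr s) \<partial>lborel) =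
      (\<integral>\<^sup>+\<alpha>\<in>{0<..2*pi}. ennreal (\<bar>tan \<alpha>\<bar> powr s) \<partial>lborel)"
  shows "AE t in lborel. t \<in> {-1<..<1} \<longrightarrow> \<bar>h t\<bar> = 1 / \<bar>t\<bar>"
proof -
  have fm: "AE y in lborel. y \<in> {0<..<1} \<longrightarrow> folded_moment s h y = folded_moment s (\<lambda>t. 1 / t) y"
    if s: "0 < s" "s < 1" for s
  proof (rule abel_equation_unique)
    show "0 < (s + 1) / 2" "(s + 1) / 2 < 1" using s by auto
    have inv: "(\<integral>\<^sup>+\<alpha>\<in>{0<..2*pi}. ennreal (\<bar>tan \<alpha>\<bar> powr s) \<partial>lborel) =
       2 * (\<integral>\<^sup>+y\<in>{0<..<x}. folded_moment s (\<lambda>t. 1 / t) y * ennreal ((x - y) powr ((s + 1) / 2 - 1)) \<partial>lborel)"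
      if "x > 0" for x
      using circle_moment_eq_abel[of "\<lambda>t. 1 / t" "sqrt x" s] that s by (simp add: tan_def)
    show "AE x in lborel. x \<in> {0<..<1} \<longrightarrow>
       (\<integral>\<^sup>+y\<in>{0<..<x}. folded_moment s h y * ennreal ((x - y) powr ((s + 1) / 2 - 1)) \<partial>lborel) =
       (\<integral>\<^sup>+y\<in>{0<..<x}. folded_moment s (\<lambda>t. 1 / t) y * ennreal ((x - y) powr ((s + 1) / 2 - 1)) \<partial>lborel)"
      using mom[OF s]
    proof eventually_elim
      case (elim x)
      then show ?case using circle_moment_eq_abel[of h "sqrt x" s] inv[of x] s by (auto simp: ennreal_mult_cancel_left)
    qed
    have "(\<integral>\<^sup>+y\<in>{0<..<1}. folded_moment s (\<lambda>t. 1 / t) y \<partial>lborel) =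
       (\<integral>\<^sup>+y. ennreal (indicator {0..1} y * (y powr ((1 - s) / 2 - 1) * (1 - y) powr (1 - 1))) \<partial>lborel)"
    proof (intro nn_integral_cong_AE)
      show "AE y in lborel. folded_moment s (\<lambda>t. 1 / t) y * indicator {0<..<1} y =
         ennreal (indicator {0..1} y * (y powr ((1 - s) / 2 - 1) * (1 - y) powr (1 - 1)))"
        using AE_lborel_singleton[of 0] AE_lborel_singleton[of 1]
      proof eventually_elim
        case (elim y)
        have "(\<bar>1 / sqrt y\<bar> powr s + \<bar>1 / - sqrt y\<bar> powr s) / (2 * sqrt y) = y powr ((1 - s) / 2 - 1)" if "0 < y"
        proof -
          have "\<bar>1 / sqrt y\<bar> powr s = y powr (- s / 2)" "1 / sqrt y = y powr (- 1 / 2)"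
            using that by (simp_all add: powr_half_sqrt[symmetric] powr_minus_divide powr_divide powr_powr)
          then have "\<bar>1 / sqrt y\<bar> powr s * (1 / sqrt y) = y powr ((1 - s) / 2 - 1)"
            by (simp add: powr_add[symmetric] field_simps)
          then show ?thesis using that by (simp add: field_simps)
        qed
        then show ?case using elim by (auto simp: indicator_def folded_moment_def)
      qed
    qed
    also have "\<dots> = ennreal (Beta ((1 - s) / 2) 1)"
      using s by (intro nn_integral_has_integral_lebesgue has_integral_Beta_real) auto
    finally show "(\<integral>\<^sup>+y\<in>{0<..<1}. folded_moment s (\<lambda>t. 1 / t) y \<partial>lborel) < \<infinity>" by simp
  qed auto
  have "AE y in lborel. y \<in> {0<..<1} \<longrightarrow> folded_moment (1/4) h y = folded_moment (1/4) (\<lambda>t. 1 / t) y"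
    "AE y in lborel. y \<in> {0<..<1} \<longrightarrow> folded_moment (1/2) h y = folded_moment (1/2) (\<lambda>t. 1 / t) y"
    by (rule fm; simp)+
  then have "AE y in lborel. y \<in> {0<..<1} \<longrightarrow> \<bar>h (sqrt y)\<bar> = 1 / sqrt y \<and> \<bar>h (- sqrt y)\<bar> = 1 / sqrt y"
  proof eventually_elim
    case (elim y)
    show ?case
    proof
      assume "y \<in> {0<..<1}"
      then have y: "0 < y \<and> y < 1" by simp
      define t where "t = sqrt y"
      have t: "t > 0" using y by (simp add: t_def)
      \<comment> \<open>the fourth roots have mean \<open>c\<close> and mean square \<open>c\<^sup>2\<close>\<close>
      define A B c where "A = \<bar>h t\<bar> powr (1/4)" and "B = \<bar>h (-t)\<bar> powr (1/4)" and "c = (1 / t) powr (1/4)"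
      have sq: "(u powr (1/4))\<^sup>2 = u powr (1/2)" "(u powr (1/4)) ^ 4 = u" if "u \<ge> 0" for u :: real
        using that by (cases "u = 0"; simp add: powr_power)+
      \<comment> \<open>cancel the common Jacobian\<close>
      have *: "\<bar>h t\<bar> powr s + \<bar>h (- t)\<bar> powr s = 2 * (1 / t) powr s"
        if "folded_moment s h y = folded_moment s (\<lambda>t. 1 / t) y" for s
      proof -
        have "(\<bar>h t\<bar> powr s + \<bar>h (- t)\<bar> powr s) / (2 * t) = (2 * (1 / t) powr s) / (2 * t)"
          using that t y by (simp add: folded_moment_def t_def[symmetric] ennreal_inj)
        then show ?thesis unfolding divide_cancel_right using t by simp
      qed
      have "A + B = 2 * c" "A\<^sup>2 + B\<^sup>2 = 2 * c\<^sup>2"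
        using *[of "1/4"] *[of "1/2"] elim y t by (simp_all add: A_def B_def c_def sq)
      from eq_of_power_means[OF this] have "A ^ 4 = c ^ 4" "B ^ 4 = c ^ 4" by simp_all
      then have "\<bar>h t\<bar> = 1 / t" "\<bar>h (- t)\<bar> = 1 / t" using t by (simp_all add: A_def B_def c_def sq(2))
      then show "\<bar>h (sqrt y)\<bar> = 1 / sqrt y \<and> \<bar>h (- sqrt y)\<bar> = 1 / sqrt y" by (simp add: t_def)
    qed
  qed
  then have "AE y in lborel. y \<notin> {y \<in> {0<..<1}. \<not> (\<bar>h (sqrt y)\<bar> = 1 / sqrt y \<and> \<bar>h (- sqrt y)\<bar> = 1 / sqrt y)}"
    by eventually_elim auto
  then have "AE t in lborel. t\<^sup>2 \<notin> {y \<in> {0<..<1}. \<not> (\<bar>h (sqrt y)\<bar> = 1 / sqrt y \<and> \<bar>h (- sqrt y)\<bar> = 1 / sqrt y)}"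
    by (rule AE_not_vimage_null[where f' = "\<lambda>t. 2 * t" and S = "- {0}"])
       (auto intro!: derivative_eq_intros AE_lborel_singleton)
  then show ?thesis
    using AE_lborel_singleton[of 0]
  proof eventually_elim
    case (elim t)
    show ?case
    proof
      assume "t \<in> {-1<..<1}"
      then have "t\<^sup>2 \<in> {0<..<1}" using elim by (auto simp: abs_square_less_1)
      then show "\<bar>h t\<bar> = 1 / \<bar>t\<bar>" using elim(1) by (cases "t \<ge> 0") auto
    qed
  qed
qed

section \<open>Boundary values of bounded analytic functions\<close>

text \<open>
  Cauchy's integral formula on circles of radius \<open>r\<close> tending to \<open>1\<close>:
  the integrands are uniformly bounded and tend to \<open>0\<close> almost everywhere, so the
  integrals, which all equal \<open>2 \<pi> i f z\<close>, tend to \<open>0\<close>.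
\<close>

lemma bounded_holomorphic_zero_boundary:
  assumes hol: "f holomorphic_on ball 0 1" and bd: "bounded (f ` ball 0 1)"
    and lim: "AE \<theta> in lborel. ((\<lambda>r. f (of_real r * cis \<theta>)) \<longlongrightarrow> 0) (at_left 1)"
    and z: "z \<in> ball 0 1"
  shows "f z = 0"
proof -
  obtain C where C: "\<And>w. w \<in> ball 0 1 \<Longrightarrow> cmod (f w) \<le> C"
    using bd unfolding bounded_iff by blast
  define d where "d = 1 - cmod z"
  have d: "0 < d" "d \<le> 1" using z by (auto simp: d_def)
  \<comment> \<open>radii between \<open>1 - d / 2\<close> and \<open>1\<close>, so that the circles stay at distance \<open>d / 2\<close> from \<open>z\<close>\<close>
  define r where "r n = 1 - d / (real n + 2)" for n
  have rn: "1 - d / 2 \<le> r n" "r n < 1" for n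
    using d by (auto simp: r_def field_simps)
  have r0: "0 < r n" for n using rn(1)[of n] d by linarith
  have rz: "cmod z < r n" for n proof -
    have "cmod z = 1 - d" by (simp add: d_def)
    then show ?thesis using rn(1)[of n] d by linarith
  qed
  have r_lim: "filterlim r (at_left 1) sequentially"
  proof -
    have "r \<longlonglongrightarrow> 1" unfolding r_def by real_asymp
    moreover have "r n \<noteq> 1" for n using rn(2)[of n] by simp
    ultimately show ?thesis by (auto simp: filterlim_at rn)
  qed
  define g where "g n t = f (r n * cis (2 * pi * t)) / (r n * cis (2 * pi * t) - z) *
      (2 * pi * \<i> * r n * cis (2 * pi * t))" for n t
  have inball: "r n * cis \<theta> \<in> ball 0 1" for n \<theta> using rn[of n] r0[of n] by (simp add: norm_mult)
  have den: "d / 2 \<le> cmod (r n * cis \<theta> - z)" for n \<theta>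
  proof -
    have "cmod z = 1 - d" by (simp add: d_def)
    moreover have "cmod (r n * cis \<theta>) = r n" using r0[of n] by (simp add: norm_mult)
    ultimately show ?thesis using norm_triangle_ineq2[of "r n * cis \<theta>" z] rn(1)[of n] by linarith
  qed
  have cont: "continuous_on UNIV (g n)" for n
  proof -
    have "continuous_on UNIV (\<lambda>t. f (r n * cis (2 * pi * t)))"
      by (rule continuous_on_compose2[OF holomorphic_on_imp_continuous_on[OF hol]])
         (use inball in \<open>auto intro!: continuous_intros simp del: mem_ball\<close>)
    moreover have "r n * cis \<theta> - z \<noteq> 0" for \<theta>
      using den[of n \<theta>] d by (metis norm_zero half_gt_zero not_less)
    ultimately show ?thesis unfolding g_def by (intro continuous_intros) auto
  qed
  have hi: "(g n has_integral 2 * of_real pi * \<i> * f z) {0..1}" for n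
  proof -
    let ?\<gamma> = "circlepath 0 (r n)"
    have "((\<lambda>u. f u / (u - z)) has_contour_integral 2 * of_real pi * \<i> * f z) ?\<gamma>"
      by (rule Cauchy_integral_circlepath_simple[OF holomorphic_on_subset[OF hol]])
         (use rz[of n] rn(2)[of n] in auto)
    moreover have "f (?\<gamma> t) / (?\<gamma> t - z) * vector_derivative ?\<gamma> (at t within {0..1}) = g n t"
      if "t \<in> {0..1}" for t
    proof -
      have "exp (2 * of_real pi * \<i> * of_real t) = cis (2 * pi * t)"
        by (simp add: cis_conv_exp mult_ac)
      then show ?thesis
        using that vector_derivative_circlepath01[of t 0 "r n"]
        by (simp add: circlepath g_def)
    qed
    ultimately show ?thesis
      unfolding has_contour_integral_def by (rule has_integral_eq[rotated])
  qed
  have int: "(\<integral>t. indicator {0..1} t *\<^sub>R g n t \<partial>lborel) = 2 * of_real pi * \<i> * f z" for n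
  proof -
    have "set_integrable lborel {0..1} (g n)"
      unfolding set_integrable_def by (intro borel_integrable_compact continuous_on_subset[OF cont]) auto
    from set_borel_integral_eq_integral(2)[OF this] integral_unique[OF hi]
    show ?thesis by (simp add: set_lebesgue_integral_def)
  qed
  have "(\<lambda>n. \<integral>t. indicator {0..1} t *\<^sub>R g n t \<partial>lborel) \<longlonglongrightarrow> (\<integral>t. 0 \<partial>(lborel :: real measure))"
  proof (rule integral_dominated_convergence)
    have "AE \<theta> in lborel. \<theta> \<notin> {\<theta>. \<not> ((\<lambda>r. f (of_real r * cis \<theta>)) \<longlongrightarrow> 0) (at_left 1)}"
      using lim by eventually_elim auto
    then have "AE t in lborel. 2 * pi * t \<notin> {\<theta>. \<not> ((\<lambda>r. f (of_real r * cis \<theta>)) \<longlongrightarrow> 0) (at_left 1)}"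
      by (rule AE_not_vimage_null[where S = UNIV and f' = "\<lambda>_. 2 * pi"]) (auto intro!: derivative_eq_intros)
    then show "AE t in lborel. (\<lambda>n. indicator {0..1} t *\<^sub>R g n t) \<longlonglongrightarrow> 0"
    proof eventually_elim
      case (elim t)
      then have "(\<lambda>n. f (r n * cis (2 * pi * t))) \<longlonglongrightarrow> 0"
        by (auto intro: filterlim_compose[OF _ r_lim])
      moreover have "(\<lambda>n. complex_of_real (r n)) \<longlonglongrightarrow> 1"
        using r_lim tendsto_of_real[of r 1 sequentially] by (auto simp: filterlim_at)
      moreover have "1 * cis (2 * pi * t) - z \<noteq> 0" using z by auto
      ultimately have "(\<lambda>n. g n t) \<longlonglongrightarrow> 0 / (1 * cis (2 * pi * t) - z) * (2 * pi * \<i> * 1 * cis (2 * pi * t))"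
        unfolding g_def by (intro tendsto_intros) auto
      from tendsto_scaleR[OF tendsto_const this, of "indicator {0..1} t"] show ?case by simp
    qed
    have "C \<ge> 0" using C[of 0] norm_ge_zero[of "f 0"] by (simp del: norm_ge_zero)
    show "AE t in lborel. norm (indicator {0..1} t *\<^sub>R g n t) \<le> indicator {0..1} t *\<^sub>R (C / (d / 2) * (2 * pi))" for n
    proof (intro AE_I2)
      fix t
      have "cmod (g n t) = cmod (f (r n * cis (2 * pi * t))) / cmod (r n * cis (2 * pi * t) - z) * (2 * pi * r n)"
        using r0[of n] by (simp add: g_def norm_mult norm_divide)
      also have "\<dots> \<le> C / (d / 2) * (2 * pi * r n)"
        using C[OF inball[of n "2 * pi * t"]] den[of n "2 * pi * t"] d r0[of n] \<open>C \<ge> 0\<close>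
        by (intro mult_right_mono frac_le) auto
      also have "\<dots> \<le> C / (d / 2) * (2 * pi)"
        using rn(2)[of n] r0[of n] \<open>C \<ge> 0\<close> d by (intro mult_left_mono) auto
      finally show "norm (indicator {0..1} t *\<^sub>R g n t) \<le> indicator {0..1} t *\<^sub>R (C / (d / 2) * (2 * pi))"
        by (auto simp: indicator_def)
    qed
    show "integrable (lborel :: real measure) (\<lambda>t. indicator {0..1} t *\<^sub>R (C / (d / 2) * (2 * pi)))"
      by (rule borel_integrable_compact) auto
    show "(\<lambda>t. indicator {0..1} t *\<^sub>R g n t) \<in> borel_measurable lborel" for n
      using borel_measurable_continuous_onI[OF cont[of n]] by simp
  qed simp
  then show ?thesis unfolding int by (simp add: LIMSEQ_const_iff)
qed

text \<open>
  With \<open>w = c z\<close>, both admissible boundary values are roots of \<open>(w x - 1)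
  (x - w) = 0\<close>.  Hence \<open>(w f - 1) (f - w)\<close> vanishes on the disk; its first
  factor is close to \<open>-1\<close> near the origin, so \<open>f = w\<close> there, and
  everywhere by analytic continuation.
\<close>

lemma boundary_rotation_of_two_branches:
  assumes f: "f \<in> H_infinity" and bf: "boundary_function f b" and c: "cmod c = 1"
    and br: "AE \<theta> in lborel. b (cis \<theta>) = c * cis \<theta> \<or> b (cis \<theta>) = inverse (c * cis \<theta>)"
  shows "AE \<theta> in lborel. b (cis \<theta>) = c * cis \<theta>"
proof -
  have hol: "f holomorphic_on ball 0 1" and bd: "bounded (f ` ball 0 1)"
    using f by (auto simp: H_infinity_def)
  obtain C where C: "\<And>w. w \<in> ball 0 1 \<Longrightarrow> cmod (f w) \<le> C" and C0: "C > 0"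
    using bd unfolding bounded_pos by blast
  define g where "g z = (c * z * f z - 1) * (f z - c * z)" for z
  have g0: "g z = 0" if "z \<in> ball 0 1" for z
  proof (rule bounded_holomorphic_zero_boundary[OF _ _ _ that])
    show "g holomorphic_on ball 0 1" unfolding g_def by (intro holomorphic_intros hol)
    have "cmod (g w) \<le> (C + 1) * (C + 1)" if w: "w \<in> ball 0 1" for w
    proof -
      have "cmod (c * w) \<le> 1" using w c by (simp add: norm_mult)
      moreover have "cmod (c * w * f w) \<le> 1 * C"
        unfolding norm_mult[of "c * w"] using C[OF w] calculation by (intro mult_mono) auto
      ultimately have "cmod (c * w * f w - 1) \<le> C + 1" "cmod (f w - c * w) \<le> C + 1"
        using C[OF w] norm_triangle_ineq4[of "c * w * f w" 1] norm_triangle_ineq4[of "f w" "c * w"] by auto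
      then show ?thesis unfolding g_def norm_mult using C0 by (intro mult_mono) auto
    qed
    then show "bounded (g ` ball 0 1)" unfolding bounded_iff by blast
    show "AE \<theta> in lborel. ((\<lambda>r. g (of_real r * cis \<theta>)) \<longlongrightarrow> 0) (at_left 1)"
      using br bf[unfolded boundary_function_def]
    proof eventually_elim
      case (elim \<theta>)
      have r: "((\<lambda>r. complex_of_real r * cis \<theta>) \<longlongrightarrow> of_real 1 * cis \<theta>) (at_left 1)"
        by (intro tendsto_intros)
      have "((\<lambda>r. g (of_real r * cis \<theta>)) \<longlongrightarrow> (c * (of_real 1 * cis \<theta>) * b (cis \<theta>) - 1) * (b (cis \<theta>) - c * (of_real 1 * cis \<theta>))) (at_left 1)"
        unfolding g_def by (intro tendsto_intros r elim(2))
      moreover have "c * cis \<theta> \<noteq> 0" using c by auto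
      then have "c * cis \<theta> * b (cis \<theta>) = 1 \<or> b (cis \<theta>) = c * cis \<theta>"
        using elim(1) right_inverse by metis
      then have "(c * (of_real 1 * cis \<theta>) * b (cis \<theta>) - 1) * (b (cis \<theta>) - c * (of_real 1 * cis \<theta>)) = 0" by auto
      ultimately show ?case by (simp only:)
    qed
  qed
  \<comment> \<open>the radius \<open>1 / C\<close> keeps the modulus of \<open>c z f z\<close> below \<open>1\<close>\<close>
  have small: "f z = c * z" if z: "z \<in> ball 0 (min 1 (1 / C))" for z
  proof -
    have "cmod (c * z * f z) = cmod z * cmod (f z)" by (simp add: norm_mult c)
    also have "\<dots> \<le> cmod z * C" using z C[of z] by (intro mult_left_mono) auto
    also have "\<dots> < 1" using z C0 by (auto simp: field_simps)
    finally have "c * z * f z \<noteq> 1" by auto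
    then show ?thesis using g0[of z] z by (auto simp: g_def)
  qed
  have eq: "f z = c * z" if "z \<in> ball 0 1" for z
  proof (rule analytic_continuation_open[where s = "ball 0 (min 1 (1 / C))" and s' = "ball 0 1" and g = "\<lambda>z. c * z"])
    have "0 \<in> ball (0 :: complex) (min 1 (1 / C))" using C0 by simp
    then show "ball 0 (min 1 (1 / C)) \<noteq> ({} :: complex set)" by blast
  qed (use hol that small in \<open>auto intro!: holomorphic_intros\<close>)
  show ?thesis using bf[unfolded boundary_function_def]
  proof eventually_elim
    case (elim \<theta>)
    have "((\<lambda>r. c * (complex_of_real r * cis \<theta>)) \<longlongrightarrow> c * (of_real 1 * cis \<theta>)) (at_left 1)"
      by (intro tendsto_intros)
    moreover have "\<forall>\<^sub>F r in at_left (1::real). c * (complex_of_real r * cis \<theta>) = f (of_real r * cis \<theta>)"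
      using eventually_at_left_real[of 0 1] by (auto elim!: eventually_mono simp: eq norm_mult)
    ultimately have "((\<lambda>r. f (of_real r * cis \<theta>)) \<longlongrightarrow> c * (of_real 1 * cis \<theta>)) (at_left 1)"
      by (rule Lim_transform_eventually)
    from tendsto_unique[OF _ elim this] show ?case by simp
  qed
qed

lemma rotation_in_H_infinity: "(\<lambda>z. c * z) \<in> H_infinity"
  by (auto simp: H_infinity_def bounded_iff norm_mult intro!: holomorphic_intros exI[of _ "cmod c"] mult_left_le)

text \<open>
  The half argument differs from \<open>\<theta> / 2\<close> by one of countably many
  translations.
\<close>

lemma AE_half_Arg:
  assumes "AE \<phi> in lborel. P \<phi>"
  shows "AE \<theta> in lborel. P (Arg (cis \<theta>) / 2)"
proof -
  have "AE \<phi> in lborel. \<phi> \<notin> {\<phi>. \<not> P \<phi>}" using assms by eventually_elim auto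
  then have "AE \<theta> in lborel. (\<theta> - 2 * pi * of_int k) / 2 \<notin> {\<phi>. \<not> P \<phi>}" for k :: int
    by (rule AE_not_vimage_null[where S = UNIV and f' = "\<lambda>_. 1 / 2"]) (auto intro!: derivative_eq_intros)
  then have "AE \<theta> in lborel. \<forall>k::int. P ((\<theta> - 2 * pi * of_int k) / 2)"
    by (auto simp: AE_all_countable)
  then show ?thesis
  proof eventually_elim
    case (elim \<theta>)
    have "cis (Arg (cis \<theta>)) = cis \<theta>"
      using cis_Arg[of "cis \<theta>"] by (simp add: sgn_div_norm)
    then obtain k :: int where "Arg (cis \<theta>) = \<theta> + 2 * pi * of_int k"
      by (metis cis.sel(1,2) sin_cos_eq_iff Ints_cases mult.commute)
    then have "Arg (cis \<theta>) / 2 = (\<theta> - 2 * pi * of_int (- k)) / 2" by simp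
    then show ?case using elim by (simp only:)
  qed
qed

section \<open>Haar measure on the orthogonal group\<close>

lemma borel_measurable_matrix_mult [measurable]:
  fixes f g :: "_ \<Rightarrow> real ^ 'n ^ 'n"
  assumes "f \<in> borel_measurable M" "g \<in> borel_measurable M"
  shows "(\<lambda>x. f x ** g x) \<in> borel_measurable M"
  using assms(1,2)
proof (rule borel_measurable_continuous_Pair)
  show "continuous_on UNIV (\<lambda>x. fst x ** snd x :: real ^ 'n ^ 'n)"
    unfolding matrix_matrix_mult_def by (intro continuous_intros)
qed

lemma borel_measurable_transpose [measurable]:
  fixes f :: "_ \<Rightarrow> real ^ 'n ^ 'm"
  assumes "f \<in> borel_measurable M"
  shows "(\<lambda>x. transpose (f x)) \<in> borel_measurable M"
proof -
  have "transpose \<in> borel_measurable (borel :: (real ^ 'n ^ 'm) measure)"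
    unfolding transpose_def by (intro borel_measurable_continuous_onI continuous_intros)
  from measurable_compose[OF assms this] show ?thesis .
qed

lemma borel_measurable_matrix_vector_mult [measurable]:
  fixes f :: "_ \<Rightarrow> real ^ 'n ^ 'm"
  assumes "f \<in> borel_measurable M"
  shows "(\<lambda>x. f x *v a) \<in> borel_measurable M"
proof -
  have "(\<lambda>A. A *v a) \<in> borel_measurable (borel :: (real ^ 'n ^ 'm) measure)"
    unfolding matrix_vector_mult_def by (intro borel_measurable_continuous_onI continuous_intros)
  from measurable_compose[OF assms this] show ?thesis .
qed

lemma haar_orthogonalD:
  assumes "haar_orthogonal \<mu>"
  shows "prob_space \<mu>" "space \<mu> = orthogonal_group"
    "R \<in> orthogonal_group \<Longrightarrow> distr \<mu> \<mu> (\<lambda>Q. R ** Q) = \<mu>"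
  using assms by (auto simp: haar_orthogonal_def)

lemma measurable_haar_domain:
  assumes "haar_orthogonal \<mu>" "f \<in> borel_measurable borel"
  shows "f \<in> borel_measurable \<mu>"
proof -
  have "f \<in> borel_measurable (restrict_space borel orthogonal_group)"
    by (rule measurable_restrict_space1) fact
  then show ?thesis using assms(1) by (simp add: haar_orthogonal_def cong: measurable_cong_sets)
qed

lemma measurable_haar_codomain:
  assumes "haar_orthogonal \<mu>" "g \<in> borel_measurable N" "\<And>x. x \<in> space N \<Longrightarrow> g x \<in> orthogonal_group"
  shows "g \<in> N \<rightarrow>\<^sub>M \<mu>"
proof -
  have "g \<in> N \<rightarrow>\<^sub>M restrict_space borel orthogonal_group"
    using assms(2,3) by (intro measurable_restrict_space2) auto
  moreover have "sets \<mu> = sets (restrict_space borel orthogonal_group)"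
    using assms(1) by (simp add: haar_orthogonal_def)
  ultimately show ?thesis using measurable_cong_sets[OF refl] by blast
qed

lemma orthogonal_group_mult: "P \<in> orthogonal_group \<Longrightarrow> Q \<in> orthogonal_group \<Longrightarrow> P ** Q \<in> orthogonal_group"
  by (simp add: orthogonal_group_def orthogonal_matrix_mul)

lemma orthogonal_group_transpose: "P \<in> orthogonal_group \<Longrightarrow> transpose P \<in> orthogonal_group"
  by (simp add: orthogonal_group_def orthogonal_matrix_transpose)

lemma nn_integral_haar_left:
  assumes h: "haar_orthogonal \<mu>" and f [measurable]: "f \<in> borel_measurable borel" and R: "R \<in> orthogonal_group"
  shows "(\<integral>\<^sup>+Q. f (R ** Q) \<partial>\<mu>) = (\<integral>\<^sup>+Q. f Q \<partial>\<mu>)"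
proof -
  have [measurable]: "(\<lambda>Q. Q) \<in> borel_measurable \<mu>" by (rule measurable_haar_domain[OF h]) simp
  have "(\<integral>\<^sup>+Q. f Q \<partial>\<mu>) = (\<integral>\<^sup>+Q. f Q \<partial>distr \<mu> \<mu> (\<lambda>Q. R ** Q))"
    by (simp only: haar_orthogonalD(3)[OF h R])
  also have "\<dots> = (\<integral>\<^sup>+Q. f (R ** Q) \<partial>\<mu>)"
    using R haar_orthogonalD(2)[OF h]
    by (intro nn_integral_distr measurable_haar_codomain[OF h] orthogonal_group_mult)
       (simp_all add: measurable_haar_domain[OF h])
  finally show ?thesis by simp
qed

text \<open>
  The standard argument that a left-invariant probability measure on a group is invariant
  under inversion: evaluate \<open>\<integral>\<integral> f ((P\<^sup>T Q)\<^sup>T) d\<mu>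
  d\<mu>\<close> in both orders.
\<close>

lemma nn_integral_haar_transpose:
  fixes f :: "real ^ 'n ^ 'n \<Rightarrow> ennreal"
  assumes h: "haar_orthogonal \<mu>" and f [measurable]: "f \<in> borel_measurable borel"
  shows "(\<integral>\<^sup>+Q. f (transpose Q) \<partial>\<mu>) = (\<integral>\<^sup>+Q. f Q \<partial>\<mu>)"
proof -
  interpret prob_space \<mu> by (rule haar_orthogonalD(1)[OF h])
  interpret pair_prob_space \<mu> \<mu> ..
  note total = prob_space.emeasure_space_1[OF haar_orthogonalD(1)[OF h]]
  have [measurable]: "(\<lambda>Q. Q) \<in> borel_measurable \<mu>" by (rule measurable_haar_domain[OF h]) simp
  have sp: "Q \<in> orthogonal_group" if "Q \<in> space \<mu>" for Q using that haar_orthogonalD(2)[OF h] by simp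
  have "(\<integral>\<^sup>+Q. f (transpose Q) \<partial>\<mu>) = (\<integral>\<^sup>+P. \<integral>\<^sup>+Q. f (transpose Q) \<partial>\<mu> \<partial>\<mu>)"
    by (simp add: total)
  also have "\<dots> = (\<integral>\<^sup>+P. \<integral>\<^sup>+Q. f (transpose (transpose P ** Q)) \<partial>\<mu> \<partial>\<mu>)"
    by (intro nn_integral_cong nn_integral_haar_left[OF h, where f = "\<lambda>Q. f (transpose Q)", symmetric])
       (auto intro: orthogonal_group_transpose sp)
  also have "\<dots> = (\<integral>\<^sup>+Q. \<integral>\<^sup>+P. f (transpose (transpose P ** Q)) \<partial>\<mu> \<partial>\<mu>)"
    by (rule Fubini') measurable
  also have "\<dots> = (\<integral>\<^sup>+Q. \<integral>\<^sup>+P. f (transpose Q ** P) \<partial>\<mu> \<partial>\<mu>)"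
    by (simp add: matrix_transpose_mul transpose_transpose)
  also have "\<dots> = (\<integral>\<^sup>+Q. \<integral>\<^sup>+P. f P \<partial>\<mu> \<partial>\<mu>)"
    by (intro nn_integral_cong nn_integral_haar_left[OF h]) (auto intro: orthogonal_group_transpose sp)
  also have "\<dots> = (\<integral>\<^sup>+Q. f Q \<partial>\<mu>)" by (simp add: total)
  finally show ?thesis .
qed

lemma nn_integral_haar_right:
  fixes f :: "real ^ 'n ^ 'n \<Rightarrow> ennreal"
  assumes h: "haar_orthogonal \<mu>" and f [measurable]: "f \<in> borel_measurable borel" and R: "R \<in> orthogonal_group"
  shows "(\<integral>\<^sup>+Q. f (Q ** R) \<partial>\<mu>) = (\<integral>\<^sup>+Q. f Q \<partial>\<mu>)"
proof -
  have "(\<integral>\<^sup>+Q. f (Q ** R) \<partial>\<mu>) = (\<integral>\<^sup>+Q. f (transpose Q ** R) \<partial>\<mu>)"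
    by (rule nn_integral_haar_transpose[OF h, where f = "\<lambda>Q. f (Q ** R)", symmetric]) simp
  also have "\<dots> = (\<integral>\<^sup>+Q. f (transpose (transpose R ** Q)) \<partial>\<mu>)"
    by (simp add: matrix_transpose_mul transpose_transpose)
  also have "\<dots> = (\<integral>\<^sup>+Q. f (transpose Q) \<partial>\<mu>)"
    using R by (intro nn_integral_haar_left[OF h, where f = "\<lambda>Q. f (transpose Q)"]) (auto intro: orthogonal_group_transpose)
  also have "\<dots> = (\<integral>\<^sup>+Q. f Q \<partial>\<mu>)" by (rule nn_integral_haar_transpose[OF h]) simp
  finally show ?thesis .
qed

text \<open>
  A property that holds almost surely is stable under a measurable flow that preserves the
  measure, and it can be verified along almost all orbits; both directions are Fubini's
  theorem for null sets.
\<close>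

lemma AE_average:
  assumes M: "sigma_finite_measure M"
    and \<rho>: "(\<lambda>(\<phi>::real, x). \<rho> \<phi> x) \<in> lborel \<Otimes>\<^sub>M M \<rightarrow>\<^sub>M M"
    and inv: "\<And>\<phi>. distr M M (\<rho> \<phi>) = M"
    and P [measurable]: "Measurable.pred M P"
  shows "(AE x in M. P x) \<longleftrightarrow> (AE x in M. AE \<phi> in lborel. P (\<rho> \<phi> x))"
proof -
  interpret M: sigma_finite_measure M by fact
  interpret pair_sigma_finite lborel M ..
  note [measurable] = \<rho>
  have [measurable]: "\<rho> \<phi> \<in> M \<rightarrow>\<^sub>M M" for \<phi>
    using measurable_Pair2[OF \<rho>, of \<phi>] by simp
  have "(AE x in M. P x) \<longleftrightarrow> (AE x in M. P (\<rho> \<phi> x))" for \<phi>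
  proof -
    have "(AE x in M. P x) \<longleftrightarrow> (AE x in distr M M (\<rho> \<phi>). P x)" by (simp only: inv)
    also have "\<dots> \<longleftrightarrow> (AE x in M. P (\<rho> \<phi> x))" by (rule AE_distr_iff) auto
    finally show ?thesis .
  qed
  moreover have "ae_filter (lborel :: real measure) \<noteq> bot"
    by (simp add: ae_filter_eq_bot_iff)
  ultimately have "(AE x in M. P x) \<longleftrightarrow> (AE \<phi> in lborel. AE x in M. P (\<rho> \<phi> x))"
    by (simp flip: \<open>\<And>\<phi>. _ = (AE x in M. P (\<rho> \<phi> x))\<close>)
  also have "\<dots> \<longleftrightarrow> (AE x in M. AE \<phi> in lborel. P (\<rho> \<phi> x))"
    by (rule AE_commute) measurable
  finally show ?thesis .
qed

section \<open>Rotation-invariant laws on the sphere\<close>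

definition spherical_law :: "(real ^ 'n::finite) measure \<Rightarrow> bool" where
  "spherical_law W \<longleftrightarrow> prob_space W \<and> sets W = sets borel \<and> (AE x in W. norm x = 1) \<and>
     (\<forall>f. orthogonal_transformation f \<longrightarrow> distr W W f = W)"

definition rotate_coords :: "'n::finite \<Rightarrow> 'n \<Rightarrow> real \<Rightarrow> real ^ 'n \<Rightarrow> real ^ 'n" where
  "rotate_coords i j \<phi> x =
     (\<chi> m. if m = i then cos \<phi> * x $ i + sin \<phi> * x $ j
           else if m = j then - sin \<phi> * x $ i + cos \<phi> * x $ j else x $ m)"

lemma rotate_coords_nth [simp]:
  "rotate_coords i j \<phi> x $ i = cos \<phi> * x $ i + sin \<phi> * x $ j"
  "i \<noteq> j \<Longrightarrow> rotate_coords i j \<phi> x $ j = - sin \<phi> * x $ i + cos \<phi> * x $ j"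
  "m \<noteq> i \<Longrightarrow> m \<noteq> j \<Longrightarrow> rotate_coords i j \<phi> x $ m = x $ m"
  by (auto simp: rotate_coords_def)

lemma orthogonal_transformation_rotate_coords:
  assumes "i \<noteq> j"
  shows "orthogonal_transformation (rotate_coords i j \<phi>)"
  unfolding orthogonal_transformation_def
proof (intro conjI allI)
  show "linear (rotate_coords i j \<phi>)"
    by (rule linearI) (auto simp: vec_eq_iff rotate_coords_def algebra_simps)
  fix x y :: "real ^ 'a"
  have split: "v \<bullet> w = v $ i * w $ i + v $ j * w $ j + (\<Sum>m\<in>UNIV - {i} - {j}. v $ m * w $ m)" for v w :: "real ^ 'a"
    using assms by (simp add: inner_vec_def sum.remove[of UNIV i] sum.remove[of "UNIV - {i}" j])
  have "(c * a + s * b) * (c * a' + s * b') + (- s * a + c * b) * (- s * a' + c * b') = a * a' + b * b'"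
    if "s\<^sup>2 + c\<^sup>2 = 1" for a b a' b' c s :: real
  proof -
    have "(c * a + s * b) * (c * a' + s * b') + (- s * a + c * b) * (- s * a' + c * b') = (s\<^sup>2 + c\<^sup>2) * (a * a' + b * b')"
      by (simp add: algebra_simps power2_eq_square)
    then show ?thesis using that by simp
  qed
  from this[OF sin_cos_squared_add, of \<phi>] assms
  show "rotate_coords i j \<phi> x \<bullet> rotate_coords i j \<phi> y = x \<bullet> y"
    by (simp add: split)
qed

lemma measurable_rotate_coords:
  "(\<lambda>(\<phi>, x). rotate_coords i j \<phi> x) \<in> borel_measurable (lborel \<Otimes>\<^sub>M (borel :: (real ^ 'n) measure))"
proof -
  have "continuous_on UNIV (\<lambda>p. rotate_coords i j (fst p) (snd p) :: real ^ 'n)"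
    unfolding rotate_coords_def
  proof (rule continuous_on_vec_lambda)
    fix m
    show "continuous_on UNIV (\<lambda>p :: real \<times> (real ^ 'n).
        if m = i then cos (fst p) * snd p $ i + sin (fst p) * snd p $ j
        else if m = j then - sin (fst p) * snd p $ i + cos (fst p) * snd p $ j else snd p $ m)"
      by (cases "m = i"; cases "m = j") (auto intro!: continuous_intros)
  qed
  then have "(\<lambda>p. rotate_coords i j (fst p) (snd p) :: real ^ 'n) \<in> borel_measurable (borel \<Otimes>\<^sub>M borel)"
    unfolding borel_prod by (rule borel_measurable_continuous_onI)
  then show ?thesis by (simp add: split_beta' cong: measurable_cong_sets)
qed

lemma spherical_law_average:
  assumes W: "spherical_law W" and ij: "i \<noteq> j" and P: "Measurable.pred borel P"
  shows "(AE x in W. P x) \<longleftrightarrow> (AE x in W. AE \<phi> in lborel. P (rotate_coords i j \<phi> x))"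
proof (rule AE_average)
  have s: "sets W = sets borel" and pW: "prob_space W" using W by (auto simp: spherical_law_def)
  then interpret prob_space W by simp
  show "sigma_finite_measure W" ..
  have "sets (lborel \<Otimes>\<^sub>M W) = sets (lborel \<Otimes>\<^sub>M borel)"
    by (intro sets_pair_measure_cong s refl)
  then show "(\<lambda>(\<phi>, x). rotate_coords i j \<phi> x) \<in> lborel \<Otimes>\<^sub>M W \<rightarrow>\<^sub>M W"
    using measurable_rotate_coords[of i j] measurable_cong_sets[OF _ s] by blast
  show "Measurable.pred W P" using P s by (simp cong: measurable_cong_sets)
  show "distr W W (rotate_coords i j \<phi>) = W" for \<phi>
    using W orthogonal_transformation_rotate_coords[OF ij] by (auto simp: spherical_law_def)
qed

text \<open>
  By induction on \<open>C\<close>, almost surely not all coordinates outside \<open>C\<close>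
  vanish; the case that \<open>C\<close> omits only \<open>i\<close> is the claim.  To add
  \<open>l\<close> to \<open>C\<close>, rotate in the plane of the coordinates
  \<open>i\<close> and \<open>l\<close>: unless both are zero, the rotated coordinate
  \<open>i\<close> vanishes for countably many angles only.
\<close>

lemma spherical_law_coordinate_nonzero:
  assumes W: "spherical_law (W :: (real ^ 'n) measure)"
  shows "AE x in W. x $ i \<noteq> 0"
proof -
  have "AE x in W. \<exists>m\<in>- C. x $ m \<noteq> 0" if "i \<notin> C" for C
    using finite[of C] that
  proof (induction C rule: finite_induct)
    case empty
    have "AE x in W. norm x = 1" using W by (simp add: spherical_law_def)
    then show ?case
    proof eventually_elim
      case (elim x)
      then have "x \<noteq> 0" by auto
      then show ?case by (auto simp: vec_eq_iff)
    qed
  next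
    case (insert l C)
    then have il: "i \<noteq> l" "i \<notin> C" by auto
    have "AE x in W. \<exists>m\<in>- C. x $ m \<noteq> 0" using insert.IH il by simp
    then have "AE x in W. AE \<phi> in lborel. \<exists>m\<in>- insert l C. rotate_coords i l \<phi> x $ m \<noteq> 0"
    proof eventually_elim
      case (elim x)
      show ?case
      proof (cases "(x $ i, x $ l) = (0, 0)")
        case False
        have "AE \<phi> in lborel. x $ i * cos \<phi> + x $ l * sin \<phi> \<noteq> 0" by (rule AE_sinusoid_nonzero[OF False])
        then show ?thesis
          by eventually_elim (use il in \<open>auto intro!: bexI[of _ i] simp: mult.commute\<close>)
      next
        case True
        then obtain m where m: "m \<notin> C" "x $ m \<noteq> 0" "m \<noteq> i" "m \<noteq> l" using elim by auto
        then have "\<exists>m\<in>- insert l C. rotate_coords i l \<phi> x $ m \<noteq> 0" for \<phi>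
          by (intro bexI[of _ m]) auto
        then show ?thesis by simp
      qed
    qed
    then show ?case
      by (subst spherical_law_average[OF W il(1)]) auto
  qed
  from this[of "UNIV - {i}"] show ?thesis by (simp add: Compl_eq_Diff_UNIV double_diff)
qed

lemma spherical_law_coordinate_not_in_null:
  assumes W: "spherical_law (W :: (real ^ 'n) measure)" and card: "CARD('n) \<ge> 2"
    and N: "AE y in lborel. y \<notin> N" and [measurable]: "N \<in> sets borel"
  shows "AE x in W. x $ i \<notin> N"
proof -
  obtain j where ij: "i \<noteq> j"
  proof -
    have "card {i} < card (UNIV :: 'n set)" using card by simp
    then have "\<not> UNIV \<subseteq> {i}" by (metis less_irrefl top.extremum_uniqueI)
    then obtain x where "x \<noteq> i" by auto
    then show ?thesis using that[of x] by simp
  qed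
  show ?thesis
  proof (subst spherical_law_average[OF W ij])
    show "AE x in W. AE \<phi> in lborel. rotate_coords i j \<phi> x $ i \<notin> N"
      using spherical_law_coordinate_nonzero[OF W, of i]
    proof eventually_elim
      case (elim x)
      then show ?case using AE_sinusoid_not_in_null[OF _ N, of "x $ i" "x $ j"] by (simp add: mult.commute)
    qed
  qed measurable
qed

text \<open>
  By compactness finitely many balls of radius \<open>e\<close> cover the sphere.  They all
  have the same measure, since the orthogonal group is transitive on the sphere, so this
  measure cannot be \<open>0\<close>.
\<close>

lemma spherical_law_ball_pos:
  assumes W: "spherical_law (W :: (real ^ 'n) measure)" and e: "e > 0" and v: "norm v = 1"
  shows "emeasure W (ball v e) > 0"
proof (rule ccontr)
  assume "\<not> ?thesis"
  then have v0: "ball v e \<in> null_sets W" using W by (auto simp: null_sets_def spherical_law_def)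
  have y0: "ball y e \<in> null_sets W" if y: "norm y = 1" for y :: "real ^ 'n"
  proof -
    obtain f where f: "orthogonal_transformation f" "f v = y"
      by (rule orthogonal_transformation_exists[of v y]) (use v y in auto)
    have [measurable]: "f \<in> W \<rightarrow>\<^sub>M W"
      using W linear_continuous_on[OF orthogonal_transformation_linear[OF f(1), THEN linear_conv_bounded_linear[THEN iffD1]]]
      by (auto simp: spherical_law_def cong: measurable_cong_sets intro!: borel_measurable_continuous_onI)
    have "f x \<in> ball y e \<longleftrightarrow> x \<in> ball v e" for x
      using f(1) f(2) unfolding orthogonal_transformation_isometry by (auto simp flip: f(2))
    then have vim: "f -` ball y e \<inter> space W = ball v e \<inter> space W" by auto
    have "emeasure W (ball y e) = emeasure (distr W W f) (ball y e)"
      using W f(1) by (simp add: spherical_law_def)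
    also have "\<dots> = emeasure W (f -` ball y e \<inter> space W)"
      using W by (intro emeasure_distr) (auto simp: spherical_law_def)
    also have "\<dots> = 0" unfolding vim using v0 W by (auto simp: spherical_law_def dest: sets_eq_imp_space_eq)
    finally show ?thesis using W by (auto simp: null_sets_def spherical_law_def)
  qed
  have "compact (sphere (0 :: real ^ 'n) 1)" by simp
  then obtain Y where Y: "Y \<subseteq> sphere (0 :: real ^ 'n) 1" "finite Y" "sphere 0 1 \<subseteq> (\<Union>y\<in>Y. ball y e)"
    by (rule compactE_image[where f = "\<lambda>y. ball y e" and C = "sphere 0 1"]) (use e in auto)
  have "(\<Union>y\<in>Y. ball y e) \<in> null_sets W"
    using Y by (intro null_sets_UN' countable_finite y0) auto
  then have "AE x in W. x \<notin> (\<Union>y\<in>Y. ball y e)" by (rule AE_not_in)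
  moreover have "AE x in W. norm x = 1" using W by (simp add: spherical_law_def)
  ultimately have "AE x in W. False"
    by eventually_elim (use Y in \<open>auto simp: subset_iff\<close>)
  then show False using W by (simp add: spherical_law_def prob_space.AE_False)
qed

text \<open>
  Here the third dimension enters.  Rotation in the plane of the coordinates \<open>j\<close>
  and \<open>k\<close> makes \<open>(x\<^sub>i)\<^sup>2 + (x\<^sub>j)\<^sup>2\<close> a smooth
  function of the angle.  For \<open>x\<close> in a small ball around the \<open>j\<close>-th
  basis vector, which has positive measure, this function runs through every value between
  \<open>e\<^sup>2\<close> and \<open>(1 - e)\<^sup>2\<close>, where \<open>e\<close> is the
  radius of the ball.  It avoids \<open>D\<close> for almost all angles, and smooth maps
  preserve null sets, so \<open>D\<close> is null in that range.
\<close>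

lemma spherical_law_two_coordinates:
  assumes W: "spherical_law (W :: (real ^ 'n) measure)" and card: "CARD('n) \<ge> 3" and ij: "i \<noteq> j"
    and D [measurable]: "D \<in> sets borel" and AE_D: "AE x in W. (x $ i)\<^sup>2 + (x $ j)\<^sup>2 \<notin> D"
  shows "AE t in lborel. t \<in> {0<..<1} \<longrightarrow> t \<notin> D"
proof -
  obtain k where k: "k \<noteq> i" "k \<noteq> j"
  proof -
    have "card {i, j} < card (UNIV :: 'n set)" using card ij by simp
    then have "UNIV \<noteq> {i, j}" by auto
    then show ?thesis using that by auto
  qed
  have "AE x in W. AE \<phi> in lborel. (x $ i)\<^sup>2 + (cos \<phi> * x $ j + sin \<phi> * x $ k)\<^sup>2 \<notin> D"
    using AE_D by (subst (asm) spherical_law_average[OF W k(2)[symmetric]]) (use k ij in auto)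
  then obtain N where N: "{x \<in> space W. \<not> (AE \<phi> in lborel. (x $ i)\<^sup>2 + (cos \<phi> * x $ j + sin \<phi> * x $ k)\<^sup>2 \<notin> D)} \<subseteq> N" "N \<in> null_sets W"
    by (auto simp: eventually_ae_filter)
  have piece: "negligible (D \<inter> {e\<^sup>2<..<(1 - e)\<^sup>2})" if e: "0 < e" "e < 1" for e :: real
  proof -
    let ?B = "ball (axis j 1 :: real ^ 'n) e"
    have "emeasure W ?B > 0" by (rule spherical_law_ball_pos[OF W e(1)]) simp
    moreover have "emeasure W ?B \<le> emeasure W N" if "?B \<subseteq> N"
      using that N(2) by (intro emeasure_mono) auto
    ultimately obtain x where x: "x \<in> ?B" "x \<notin> N" using N(2) by fastforce
    let ?F = "\<lambda>\<phi>. (x $ i)\<^sup>2 + (cos \<phi> * x $ j + sin \<phi> * x $ k)\<^sup>2"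
    have "space W = UNIV" using W sets_eq_imp_space_eq[of W borel] by (simp add: spherical_law_def)
    then have F: "negligible {\<phi>. ?F \<phi> \<in> D}" using N(1) x(2) by (auto simp: negligible_iff_AE_lborel)
    have xi: "\<bar>x $ i\<bar> < e" and xj: "1 - e < x $ j"
    proof -
      have "\<bar>(axis j 1 - x) $ m\<bar> < e" for m
        using component_le_norm_cart[of "axis j 1 - x" m] x(1) by (simp add: dist_norm)
      from this[of i] this[of j] show "\<bar>x $ i\<bar> < e" "1 - e < x $ j" using ij by (auto simp: axis_def)
    qed
    have "D \<inter> {e\<^sup>2<..<(1 - e)\<^sup>2} \<subseteq> ?F ` {\<phi>. ?F \<phi> \<in> D}"
    proof
      fix t assume t: "t \<in> D \<inter> {e\<^sup>2<..<(1 - e)\<^sup>2}"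
      \<comment> \<open>an angle at which the rotated coordinate \<open>j\<close> vanishes; the value there is at most \<open>e\<^sup>2\<close>\<close>
      obtain \<theta> where "cos \<theta> * x $ j + sin \<theta> * x $ k = 0"
      proof -
        have "x $ j \<noteq> 0" using xj e by auto
        show ?thesis
        proof (cases "x $ k = 0")
          case True then show ?thesis using that[of "pi/2"] by simp
        next
          case False
          let ?t = "arctan (- (x $ j) / x $ k)"
          have "sin ?t = - (x $ j) / x $ k * cos ?t"
            using tan_arctan[of "- (x $ j) / x $ k"] by (simp add: tan_def field_simps)
          then show ?thesis using that[of ?t] False by (simp add: field_simps)
        qed
      qed
      then have "?F \<theta> \<le> t"
        using xi t e abs_le_square_iff[of "x $ i" e] by simp
      moreover have "t \<le> ?F 0"
        using xj t e power_strict_mono[of "1 - e" "x $ j" 2] by (simp add: add_nonneg_pos less_imp_le) (smt (verit) zero_le_power2)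
      moreover have "connected (range ?F)"
        by (intro connected_continuous_image continuous_intros) simp
      ultimately have "t \<in> range ?F" by (meson connectedD_interval rangeI)
      then show "t \<in> ?F ` {\<phi>. ?F \<phi> \<in> D}" using t by auto
    qed
    moreover have "negligible (?F ` {\<phi>. ?F \<phi> \<in> D})"
    proof (intro negligible_differentiable_image_negligible F)
      have "(?F has_real_derivative 2 * (cos \<phi> * x $ j + sin \<phi> * x $ k) * (- sin \<phi> * x $ j + cos \<phi> * x $ k)) (at \<phi> within S)" for \<phi> S
        by (auto intro!: derivative_eq_intros)
      then show "?F differentiable_on {\<phi>. ?F \<phi> \<in> D}"
        unfolding differentiable_on_def differentiable_def has_field_derivative_def by blast
    qed simp
    ultimately show ?thesis using negligible_subset by blast
  qed
  have "negligible (\<Union>n::nat. D \<inter> {(1 / (real n + 2))\<^sup>2<..<(1 - 1 / (real n + 2))\<^sup>2})"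
    by (intro negligible_countable_Union) (auto intro!: piece)
  moreover have "D \<inter> {0<..<1} \<subseteq> (\<Union>n::nat. D \<inter> {(1 / (real n + 2))\<^sup>2<..<(1 - 1 / (real n + 2))\<^sup>2})"
  proof
    fix t assume t: "t \<in> D \<inter> {0<..<1}"
    have "(\<lambda>n. (1 / (real n + 2))\<^sup>2) \<longlonglongrightarrow> 0" "(\<lambda>n. (1 - 1 / (real n + 2))\<^sup>2) \<longlonglongrightarrow> 1" by real_asymp+
    then have "\<forall>\<^sub>F n in sequentially. (1 / (real n + 2))\<^sup>2 < t" "\<forall>\<^sub>F n in sequentially. t < (1 - 1 / (real n + 2))\<^sup>2"
      using t by (auto intro: order_tendstoD simp del: power_tendsto_0_iff)
    then have "\<forall>\<^sub>F n in sequentially. (1 / (real n + 2))\<^sup>2 < t \<and> t < (1 - 1 / (real n + 2))\<^sup>2" by eventually_elim auto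
    then obtain n :: nat where "(1 / (real n + 2))\<^sup>2 < t \<and> t < (1 - 1 / (real n + 2))\<^sup>2"
      using eventually_happens by force
    then show "t \<in> (\<Union>n::nat. D \<inter> {(1 / (real n + 2))\<^sup>2<..<(1 - 1 / (real n + 2))\<^sup>2})" using t by auto
  qed
  ultimately have "negligible (D \<inter> {0<..<1})" using negligible_subset by blast
  then show ?thesis by (auto simp: negligible_iff_AE_lborel)
qed

text \<open>
  The orbit map of \<open>a\<close> under transposed matrices turns right translations of the
  group into orthogonal transformations of the sphere.
\<close>

lemma spherical_law_haar:
  fixes a :: "real ^ 'n"
  assumes h: "haar_orthogonal \<mu>" and a: "norm a = 1"
  shows "spherical_law (distr \<mu> borel (\<lambda>Q. transpose Q *v a))" (is "spherical_law ?W")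
  unfolding spherical_law_def
proof (intro conjI allI impI)
  note [simp del] = transpose_matrix_vector
  have [measurable]: "(\<lambda>Q. transpose Q *v a) \<in> borel_measurable \<mu>"
    by (intro measurable_haar_domain[OF h] borel_measurable_matrix_vector_mult borel_measurable_transpose) simp
  interpret prob_space \<mu> by (rule haar_orthogonalD(1)[OF h])
  show "prob_space ?W" by (rule prob_space_distr) simp
  show "sets ?W = sets borel" by simp
  have "norm (transpose Q *v a) = 1" if "Q \<in> space \<mu>" for Q
  proof -
    have "orthogonal_matrix (transpose Q)"
      using that haar_orthogonalD(2)[OF h] by (simp add: orthogonal_group_def)
    then have "orthogonal_transformation ((*v) (transpose Q))"
      by (simp add: orthogonal_transformation_matrix)
    then show ?thesis using a by (simp add: orthogonal_transformation)
  qed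
  then show "AE x in ?W. norm x = 1" by (subst AE_distr_iff) auto
  fix f :: "real ^ 'n \<Rightarrow> real ^ 'n" assume f: "orthogonal_transformation f"
  let ?R = "matrix f"
  have R: "transpose ?R \<in> orthogonal_group" and lin: "linear f"
    using f by (auto simp: orthogonal_group_def orthogonal_transformation_matrix)
  have [measurable]: "f \<in> borel_measurable borel"
    using lin by (intro borel_measurable_continuous_onI linear_continuous_on) (simp add: linear_conv_bounded_linear)
  have fR: "f (transpose Q *v a) = transpose (Q ** transpose ?R) *v a" for Q
    using fun_cong[OF matrix_vector_mul(2)[OF lin]] by (simp add: matrix_transpose_mul matrix_vector_mul_assoc[symmetric])
  show "distr ?W ?W f = ?W"
  proof (rule measure_eqI)
    fix A assume "A \<in> sets (distr ?W ?W f)"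
    then have [measurable]: "A \<in> sets borel" by simp
    have "emeasure (distr ?W ?W f) A = (\<integral>\<^sup>+x. indicator A (f x) \<partial>?W)"
      by (subst nn_integral_indicator[symmetric], simp, subst nn_integral_distr) auto
    also have "\<dots> = (\<integral>\<^sup>+Q. indicator A (transpose (Q ** transpose ?R) *v a) \<partial>\<mu>)"
      by (subst nn_integral_distr) (auto simp: fR)
    also have "\<dots> = (\<integral>\<^sup>+Q. indicator A (transpose Q *v a) \<partial>\<mu>)"
      by (rule nn_integral_haar_right[OF h _ R, where f = "\<lambda>Q. indicator A (transpose Q *v a)"]) simp
    also have "\<dots> = emeasure ?W A"
      by (subst nn_integral_indicator[symmetric], simp, subst nn_integral_distr) auto
    finally show "emeasure (distr ?W ?W f) A = emeasure ?W A" .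
  qed simp
qed

section \<open>Haar two-frames and their planes\<close>

lemma space_frame_space: "space frame_space = (two_frames :: 'n::finite frame set)"
  by (simp add: frame_space_def space_restrict_space)

lemma two_framesD:
  assumes "e \<in> two_frames"
  shows "norm (fst e) = 1" "norm (snd e) = 1" "fst e \<bullet> snd e = 0"
  using assms by (auto simp: two_frames_def)

lemma rotate_frame_add: "rotate_frame \<phi> (rotate_frame \<psi> e) = rotate_frame (\<phi> + \<psi>) e"
  by (simp add: rotate_frame_def cos_add sin_add algebra_simps)

lemma rotate_frame_0 [simp]: "rotate_frame 0 e = e"
  by (simp add: rotate_frame_def)

lemma rotate_frame_in_two_frames:
  assumes "e \<in> two_frames"
  shows "rotate_frame \<phi> e \<in> two_frames"
proof -
  obtain u v where e: "e = (u, v)" by (cases e)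
  have ip: "u \<bullet> u = 1" "v \<bullet> v = 1" "u \<bullet> v = 0" "v \<bullet> u = 0"
    using assms by (auto simp: e two_frames_def norm_eq_1 inner_commute)
  have sc: "cos \<phi> * cos \<phi> + sin \<phi> * sin \<phi> = 1"
    using sin_cos_squared_add3 by (simp add: add.commute)
  show ?thesis
    using sc by (simp add: e two_frames_def rotate_frame_def norm_eq_1 inner_add_left inner_add_right
        inner_diff_left inner_diff_right ip algebra_simps)
qed

lemma oriented_plane_rotate_frame: "oriented_plane (rotate_frame \<psi> e) = oriented_plane e"
proof -
  have "rotate_frame \<phi> e \<in> range (\<lambda>\<phi>. rotate_frame (\<phi> + \<psi>) e)" for \<phi>
    by (rule range_eqI[of _ _ "\<phi> - \<psi>"]) simp
  then show ?thesis unfolding oriented_plane_def rotate_frame_add by blast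
qed

lemma mem_oriented_plane: "e \<in> oriented_plane e"
  unfolding oriented_plane_def by (metis rotate_frame_0 rangeI)

lemma measurable_frame_components:
  assumes "sets M = sets frame_space"
  shows "fst \<in> borel_measurable M" "snd \<in> borel_measurable M"
proof -
  have "fst \<in> borel_measurable frame_space" "snd \<in> borel_measurable frame_space"
    unfolding frame_space_def
    by (auto intro!: measurable_restrict_space1 borel_measurable_continuous_onI continuous_intros)
  then show "fst \<in> borel_measurable M" "snd \<in> borel_measurable M"
    using assms by (simp_all cong: measurable_cong_sets)
qed

lemma measurable_rotate_frame:
  fixes M :: "'n::finite frame measure"
  assumes s: "sets M = sets frame_space"
  shows "(\<lambda>(\<phi>, e). rotate_frame \<phi> e) \<in> lborel \<Otimes>\<^sub>M M \<rightarrow>\<^sub>M M"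
proof -
  note [measurable] = measurable_frame_components[OF s]
  have "(\<lambda>p. rotate_frame (fst p) (snd p)) \<in> lborel \<Otimes>\<^sub>M M \<rightarrow>\<^sub>M borel \<Otimes>\<^sub>M borel"
    unfolding rotate_frame_def by measurable
  then have "(\<lambda>p. rotate_frame (fst p) (snd p)) \<in> lborel \<Otimes>\<^sub>M M \<rightarrow>\<^sub>M frame_space"
    unfolding frame_space_def borel_prod
  proof (rule measurable_restrict_space2[rotated])
    show "(\<lambda>p. rotate_frame (fst p) (snd p)) \<in> space (lborel \<Otimes>\<^sub>M M) \<rightarrow> two_frames"
      using sets_eq_imp_space_eq[OF s]
      by (simp add: space_pair_measure space_frame_space rotate_frame_in_two_frames Pi_iff mem_Times_iff)
  qed
  then show ?thesis unfolding split_beta' using measurable_cong_sets[OF refl s] by blast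
qed

lemma measurable_compose_rotate_frame:
  fixes M :: "'n::finite frame measure"
  assumes s: "sets M = sets frame_space" and f: "f \<in> borel_measurable N" and g: "g \<in> N \<rightarrow>\<^sub>M M"
  shows "(\<lambda>x. rotate_frame (f x) (g x)) \<in> N \<rightarrow>\<^sub>M M"
proof -
  have "f \<in> N \<rightarrow>\<^sub>M lborel" using f by simp
  from measurable_compose[OF measurable_Pair[OF this g] measurable_rotate_frame[OF s]]
  show ?thesis by simp
qed

lemma haar_two_frameD:
  assumes "haar_two_frame M"
  shows "prob_space M" "sets M = sets frame_space" "space M = two_frames"
proof -
  obtain \<mu> i j where h: "haar_orthogonal \<mu>" "i \<noteq> j" and M: "M = distr \<mu> frame_space (\<lambda>Q. (column i Q, column j Q))"
    using assms by (auto simp: haar_two_frame_def)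
  show "prob_space M" unfolding M
    using prob_space.prob_space_distr[OF haar_orthogonalD(1)[OF h(1)] measurable_columns[OF h]] .
  show "sets M = sets frame_space" "space M = two_frames" by (simp_all add: M space_frame_space)
qed

lemma closed_two_frames: "closed (two_frames :: 'n::finite frame set)"
proof -
  have eq: "two_frames = {e :: 'n frame. norm (fst e) = 1} \<inter> {e. norm (snd e) = 1} \<inter> {e. fst e \<bullet> snd e = 0}"
    by (auto simp: two_frames_def)
  show ?thesis
    unfolding eq by (intro closed_Int closed_Collect_eq continuous_intros)
qed

lemma sets_frame_space_borel:
  fixes A :: "'n::finite frame set"
  assumes "A \<in> sets frame_space"
  shows "A \<in> sets borel"
proof -
  obtain B where "B \<in> sets borel" "A = two_frames \<inter> B"
    using assms unfolding frame_space_def sets_restrict_space by blast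
  then show ?thesis by (simp add: sets.Int[OF borel_closed[OF closed_two_frames]])
qed

text \<open>
  Rotating the frame formed by two columns of \<open>Q\<close> amounts to multiplying
  \<open>Q\<close> on the right by a rotation of the corresponding coordinate plane.
\<close>

lemma distr_rotate_frame:
  fixes M :: "'n::finite frame measure"
  assumes haar: "haar_two_frame M"
  shows "distr M M (rotate_frame \<phi>) = M"
proof -
  obtain \<mu> i j where h: "haar_orthogonal \<mu>" and ij: "i \<noteq> j"
    and M: "M = distr \<mu> frame_space (\<lambda>Q. (column i Q, column j Q))"
    using haar unfolding haar_two_frame_def by blast
  note MD = haar_two_frameD[OF haar]
  let ?c = "\<lambda>Q. (column i Q, column j Q)"
  have c [measurable]: "?c \<in> \<mu> \<rightarrow>\<^sub>M frame_space" by (rule measurable_columns[OF h ij])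
  have [measurable]: "?c \<in> borel_measurable borel"
    unfolding column_def by (intro borel_measurable_continuous_onI continuous_intros)
  have rot [measurable]: "rotate_frame \<phi> \<in> M \<rightarrow>\<^sub>M M"
    by (rule measurable_compose_rotate_frame[OF MD(2)]) auto
  \<comment> \<open>column \<open>m\<close> of \<open>Q R\<close> is \<open>Q\<close> applied to column \<open>m\<close> of \<open>R\<close>; \<open>rotate_coords i j \<phi>\<close> turns the basis vectors by \<open>- \<phi>\<close>\<close>
  let ?f = "rotate_coords i j (- \<phi>) :: real ^ 'n \<Rightarrow> _"
  have f: "orthogonal_transformation ?f" by (rule orthogonal_transformation_rotate_coords[OF ij])
  have R: "matrix ?f \<in> orthogonal_group"
    using f by (simp add: orthogonal_group_def orthogonal_transformation_matrix)
  have fR: "matrix ?f *v x = ?f x" for x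
    using fun_cong[OF matrix_vector_mul(2)[OF orthogonal_transformation_linear[OF f]]] by simp
  have basis: "?f (axis i 1) = cos \<phi> *\<^sub>R axis i 1 + sin \<phi> *\<^sub>R axis j 1"
    "?f (axis j 1) = - sin \<phi> *\<^sub>R axis i 1 + cos \<phi> *\<^sub>R axis j 1"
    using ij by (auto simp: vec_eq_iff rotate_coords_def axis_def)
  have mul: "column m (Q ** matrix ?f) = Q *v ?f (axis m 1)" for Q m
    by (simp only: matrix_vector_mul_assoc[symmetric] fR matrix_vector_mult_basis[symmetric])
  have cols: "rotate_frame \<phi> (?c Q) = ?c (Q ** matrix ?f)" for Q
    unfolding mul basis
    by (simp add: rotate_frame_def matrix_vector_right_distrib matrix_vector_mult_scaleR
        matrix_vector_mult_basis matrix_vector_mult_diff_distrib del: rotate_coords_nth)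
  show ?thesis
  proof (rule measure_eqI)
    fix A assume "A \<in> sets (distr M M (rotate_frame \<phi>))"
    then have A [measurable]: "A \<in> sets M" by simp
    then have [measurable]: "A \<in> sets borel" using sets_frame_space_borel MD(2) by auto
    have "emeasure (distr M M (rotate_frame \<phi>)) A = (\<integral>\<^sup>+e. indicator A (rotate_frame \<phi> e) \<partial>M)"
      by (subst nn_integral_indicator[symmetric], simp, subst nn_integral_distr) auto
    also have "\<dots> = (\<integral>\<^sup>+Q. indicator A (rotate_frame \<phi> (?c Q)) \<partial>\<mu>)"
    proof (subst M, rule nn_integral_distr[OF c])
      have "(\<lambda>e. indicator A (rotate_frame \<phi> e)) \<in> borel_measurable M" by simp
      then show "(\<lambda>e. indicator A (rotate_frame \<phi> e) :: ennreal) \<in> borel_measurable (distr \<mu> frame_space ?c)"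
        unfolding M[symmetric] by simp
    qed
    also have "\<dots> = (\<integral>\<^sup>+Q. indicator A (?c (Q ** matrix ?f)) \<partial>\<mu>)" unfolding cols ..
    also have "\<dots> = (\<integral>\<^sup>+Q. indicator A (?c Q) \<partial>\<mu>)"
      by (rule nn_integral_haar_right[OF h _ R, where f = "\<lambda>Q. indicator A (?c Q)"]) simp
    also have "\<dots> = (\<integral>\<^sup>+e. indicator A e \<partial>M)"
    proof (subst M, rule nn_integral_distr[OF c, symmetric])
      have "(\<lambda>e. indicator A e) \<in> borel_measurable M" by simp
      then show "(\<lambda>e. indicator A e :: ennreal) \<in> borel_measurable (distr \<mu> frame_space ?c)"
        unfolding M[symmetric] by simp
    qed
    also have "\<dots> = emeasure M A" by simp
    finally show "emeasure (distr M M (rotate_frame \<phi>)) A = emeasure M A" .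
  qed simp
qed

lemma AE_frame_average:
  assumes haar: "haar_two_frame M" and P: "Measurable.pred M P"
  shows "(AE e in M. P e) \<longleftrightarrow> (AE e in M. AE \<phi> in lborel. P (rotate_frame \<phi> e))"
proof (rule AE_average)
  interpret prob_space M by (rule haar_two_frameD(1)[OF haar])
  show "sigma_finite_measure M" ..
  show "(\<lambda>(\<phi>, e). rotate_frame \<phi> e) \<in> lborel \<Otimes>\<^sub>M M \<rightarrow>\<^sub>M M"
    by (rule measurable_rotate_frame[OF haar_two_frameD(2)[OF haar]])
qed (rule distr_rotate_frame[OF haar] P)+

lemma nn_integral_frame_average:
  assumes haar: "haar_two_frame M" and f [measurable]: "f \<in> borel_measurable M"
  shows "ennreal (2 * pi) * (\<integral>\<^sup>+e. f e \<partial>M) = (\<integral>\<^sup>+e. (\<integral>\<^sup>+\<phi>\<in>{0<..2*pi}. f (rotate_frame \<phi> e) \<partial>lborel) \<partial>M)"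
proof -
  interpret prob_space M by (rule haar_two_frameD(1)[OF haar])
  interpret pair_sigma_finite lborel M ..
  note rot2 [measurable] = measurable_rotate_frame[OF haar_two_frameD(2)[OF haar]]
  have rot [measurable]: "rotate_frame \<phi> \<in> M \<rightarrow>\<^sub>M M" for \<phi>
    using measurable_Pair2[OF rot2, of \<phi>] by simp
  have "(\<integral>\<^sup>+e. f e \<partial>M) = (\<integral>\<^sup>+e. f (rotate_frame \<phi> e) \<partial>M)" for \<phi>
    by (subst (1) distr_rotate_frame[OF haar, of \<phi>, symmetric], rule nn_integral_distr) auto
  then have "ennreal (2 * pi) * (\<integral>\<^sup>+e. f e \<partial>M) = (\<integral>\<^sup>+\<phi>\<in>{0<..2*pi}. (\<integral>\<^sup>+e. f (rotate_frame \<phi> e) \<partial>M) \<partial>lborel)"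
    by (simp add: nn_integral_cmult mult.commute)
  also have "\<dots> = (\<integral>\<^sup>+\<phi>. \<integral>\<^sup>+e. f (rotate_frame \<phi> e) * indicator {0<..2*pi} \<phi> \<partial>M \<partial>lborel)"
    by (simp add: nn_integral_multc)
  also have "\<dots> = (\<integral>\<^sup>+e. \<integral>\<^sup>+\<phi>. f (rotate_frame \<phi> e) * indicator {0<..2*pi} \<phi> \<partial>lborel \<partial>M)"
    by (rule Fubini'[symmetric]) measurable
  finally show ?thesis .
qed

text \<open>
  The inner products of \<open>a\<close> with the columns of \<open>Q\<close> are the
  coordinates of the uniformly distributed vector \<open>Q\<^sup>T a\<close>.
\<close>

lemma frame_spherical_coordinates:
  fixes a :: "real ^ 'n::finite" and M :: "'n frame measure"
  assumes haar: "haar_two_frame M" and a: "norm a = 1"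
  shows "\<exists>(W :: (real ^ 'n) measure) i j. spherical_law W \<and> i \<noteq> j \<and>
    (\<forall>P. Measurable.pred borel P \<longrightarrow>
       (AE e in M. P (a \<bullet> fst e, a \<bullet> snd e)) \<longleftrightarrow> (AE x in W. P (x $ i, x $ j)))"
proof -
  obtain \<mu> i j where h: "haar_orthogonal \<mu>" and ij: "i \<noteq> j"
    and M: "M = distr \<mu> frame_space (\<lambda>Q. (column i Q, column j Q))"
    using haar unfolding haar_two_frame_def by blast
  let ?W = "distr \<mu> borel (\<lambda>Q. transpose Q *v a)"
  have coord: "(transpose Q *v a) $ m = a \<bullet> column m Q" for Q m
    by (simp add: matrix_vector_mult_def transpose_def column_def inner_vec_def mult.commute del: transpose_matrix_vector)
  have "(AE e in M. P (a \<bullet> fst e, a \<bullet> snd e)) \<longleftrightarrow> (AE x in ?W. P (x $ i, x $ j))"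
    if [measurable]: "Measurable.pred borel P" for P
  proof -
    note MD = haar_two_frameD[OF haar]
    note [measurable] = measurable_frame_components[OF MD(2)]
    have [measurable]: "Measurable.pred (borel \<Otimes>\<^sub>M borel) P" using that by (simp add: borel_prod)
    have "Measurable.pred M (\<lambda>e. P (a \<bullet> fst e, a \<bullet> snd e))" by measurable
    then have "Measurable.pred frame_space (\<lambda>e. P (a \<bullet> fst e, a \<bullet> snd e))"
      using MD(2) by (simp cong: measurable_cong_sets)
    then have "(AE e in M. P (a \<bullet> fst e, a \<bullet> snd e)) \<longleftrightarrow> (AE Q in \<mu>. P (a \<bullet> column i Q, a \<bullet> column j Q))"
      unfolding M by (subst AE_distr_iff[OF measurable_columns[OF h ij]]) auto
    also have "\<dots> \<longleftrightarrow> (AE x in ?W. P (x $ i, x $ j))"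
    proof (subst AE_distr_iff)
      show "(\<lambda>Q. transpose Q *v a) \<in> borel_measurable \<mu>"
        by (intro measurable_haar_domain[OF h] borel_measurable_matrix_vector_mult borel_measurable_transpose) simp
    qed (auto simp: coord simp del: transpose_matrix_vector)
    finally show ?thesis .
  qed
  with spherical_law_haar[OF h a] ij show ?thesis by blast
qed

lemma AE_frame_coordinate_not_in_null:
  fixes a :: "real ^ 'n::finite"
  assumes "haar_two_frame M" "norm a = 1" "CARD('n) \<ge> 2"
    and N: "AE y in lborel. y \<notin> N" and [measurable]: "N \<in> sets borel"
  shows "AE e in M. a \<bullet> fst e \<notin> N"
proof -
  obtain W i j where W: "spherical_law (W :: (real ^ 'n) measure)"
    and eq: "\<And>P. Measurable.pred borel P \<Longrightarrow>
       (AE e in M. P (a \<bullet> fst e, a \<bullet> snd e)) \<longleftrightarrow> (AE x in W. P (x $ i, x $ j))"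
    using frame_spherical_coordinates[OF assms(1,2)] by blast
  have "Measurable.pred (borel \<Otimes>\<^sub>M borel) (\<lambda>p :: real \<times> real. fst p \<notin> N)" by measurable
  from eq[OF this[unfolded borel_prod]] show ?thesis
    using spherical_law_coordinate_not_in_null[OF W assms(3) N] by simp
qed

lemma AE_frame_squared_length:
  fixes a :: "real ^ 'n::finite"
  assumes "haar_two_frame M" "norm a = 1" "CARD('n) \<ge> 3"
    and D [measurable]: "D \<in> sets borel" and AE_D: "AE e in M. (a \<bullet> fst e)\<^sup>2 + (a \<bullet> snd e)\<^sup>2 \<notin> D"
  shows "AE t in lborel. t \<in> {0<..<1} \<longrightarrow> t \<notin> D"
proof -
  obtain W i j where W: "spherical_law (W :: (real ^ 'n) measure)" "i \<noteq> j"
    and eq: "\<And>P. Measurable.pred borel P \<Longrightarrow>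
       (AE e in M. P (a \<bullet> fst e, a \<bullet> snd e)) \<longleftrightarrow> (AE x in W. P (x $ i, x $ j))"
    using frame_spherical_coordinates[OF assms(1,2)] by blast
  have "Measurable.pred (borel \<Otimes>\<^sub>M borel) (\<lambda>p :: real \<times> real. (fst p)\<^sup>2 + (snd p)\<^sup>2 \<notin> D)" by measurable
  from eq[OF this[unfolded borel_prod]] AE_D show ?thesis
    by (intro spherical_law_two_coordinates[OF W(1) assms(3) W(2) D]) simp
qed

text \<open>
  Events of the quotient \<open>\<sigma>\<close>-algebra are obtained from rotation-invariant
  events of frames.
\<close>

lemma invariant_plane_event:
  assumes G: "Measurable.pred frame_space G"
    and inv: "\<And>\<phi> e. e \<in> two_frames \<Longrightarrow> G (rotate_frame \<phi> e) \<longleftrightarrow> G e"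
  shows "{P \<in> oriented_planes. \<forall>e\<in>P. G e} \<in> sets plane_space"
    "e \<in> two_frames \<Longrightarrow> oriented_plane e \<in> {P \<in> oriented_planes. \<forall>e\<in>P. G e} \<longleftrightarrow> G e"
proof -
  let ?A = "{P \<in> oriented_planes. \<forall>e\<in>P. G e}"
  show mem: "oriented_plane e \<in> ?A \<longleftrightarrow> G e" if "e \<in> two_frames" for e
    using that inv mem_oriented_plane[of e] by (auto simp: oriented_planes_def oriented_plane_def)
  have "{e \<in> two_frames. oriented_plane e \<in> ?A} = {e \<in> space frame_space. G e}"
    using mem by (auto simp: space_frame_space)
  also have "\<dots> \<in> sets frame_space" using G by simp
  finally show "?A \<in> sets plane_space"
    unfolding plane_space_def by (intro in_measure_of) auto
qed

lemma measurable_plane: "haar_two_frame M \<Longrightarrow> oriented_plane \<in> M \<rightarrow>\<^sub>M plane_space"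
  using measurable_oriented_plane measurable_cong_sets[OF haar_two_frameD(2) refl] by blast

text \<open>
  The exceptional set is enlarged to a measurable null set \<open>N\<close> first, so that
  having almost no phase in \<open>N\<close> is an event on planes even when \<open>Q\<close>
  is not measurable.
\<close>

lemma AE_plane_AE_phase:
  fixes M :: "'n::finite frame measure"
  assumes haar: "haar_two_frame M" and AE_Q: "AE e in M. Q e"
  shows "AE P in plane_law M. \<forall>e\<in>P. AE \<phi> in lborel. Q (rotate_frame \<phi> e)"
proof -
  note MD = haar_two_frameD[OF haar]
  obtain N where N: "{e \<in> space M. \<not> Q e} \<subseteq> N" "N \<in> null_sets M"
    using AE_Q by (auto simp: eventually_ae_filter)
  have [measurable]: "N \<in> sets M" using N by auto
  define G where "G e \<longleftrightarrow> (AE \<phi> in lborel. rotate_frame \<phi> e \<notin> N)" for e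
  have "G e \<longleftrightarrow> (\<integral>\<^sup>+\<phi>. indicator N (rotate_frame \<phi> e) \<partial>lborel) = 0" if "e \<in> space M" for e
  proof -
    have [measurable]: "(\<lambda>\<phi>. rotate_frame \<phi> e) \<in> lborel \<rightarrow>\<^sub>M M"
      using measurable_compose_rotate_frame[OF MD(2), of "\<lambda>\<phi>. \<phi>" lborel "\<lambda>_. e"] that by simp
    show ?thesis unfolding G_def by (subst nn_integral_0_iff_AE) (auto simp: indicator_eq_0_iff)
  qed
  moreover have "(\<lambda>p. rotate_frame (snd p) (fst p)) \<in> M \<Otimes>\<^sub>M lborel \<rightarrow>\<^sub>M M"
    by (rule measurable_compose_rotate_frame[OF MD(2)]) auto
  then have "Measurable.pred M (\<lambda>e. (\<integral>\<^sup>+\<phi>. indicator N (rotate_frame \<phi> e) \<partial>lborel) = 0)"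
    by measurable
  ultimately have "Measurable.pred M G" by (simp cong: measurable_cong)
  then have G: "Measurable.pred frame_space G" using MD(2) by (simp cong: measurable_cong_sets)
  have shift: "G (rotate_frame \<psi> e)" if "G e" for \<psi> e
  proof -
    have "AE \<phi> in lborel. \<phi> \<notin> {\<phi>. rotate_frame \<phi> e \<in> N}" using that by (simp add: G_def)
    then have "AE \<phi> in lborel. \<phi> + \<psi> \<notin> {\<phi>. rotate_frame \<phi> e \<in> N}"
      by (rule AE_not_vimage_null[where S = UNIV and f' = "\<lambda>_. 1"]) (auto intro!: derivative_eq_intros)
    then show ?thesis by (simp add: G_def rotate_frame_add)
  qed
  then have inv: "G (rotate_frame \<psi> e) \<longleftrightarrow> G e" for \<psi> e
    by (metis rotate_frame_add rotate_frame_0 add.left_inverse)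
  note ev = invariant_plane_event[OF G inv]
  have "AE e in M. e \<notin> N" by (rule AE_not_in) fact
  then have "AE e in M. G e" unfolding G_def by (subst (asm) AE_frame_average[OF haar]) auto
  then have "AE e in M. oriented_plane e \<in> {P \<in> oriented_planes. \<forall>e\<in>P. G e}"
    using AE_space by eventually_elim (simp only: MD(3) ev(2))
  then have "AE P in plane_law M. P \<in> {P \<in> oriented_planes. \<forall>e\<in>P. G e}"
    unfolding plane_law_def by (subst AE_distr_iff[OF measurable_plane[OF haar]]) (use ev(1) sets.sets_into_space in \<open>auto simp: Int_absorb1 Collect_conj_eq\<close>)
  then show ?thesis
  proof eventually_elim
    case (elim P)
    show ?case
    proof
      fix e assume e: "e \<in> P"
      then have "e \<in> two_frames"
        using elim rotate_frame_in_two_frames by (auto simp: oriented_planes_def oriented_plane_def)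
      then have "rotate_frame \<phi> e \<in> space M" for \<phi> using MD(3) rotate_frame_in_two_frames by simp
      moreover have "AE \<phi> in lborel. rotate_frame \<phi> e \<notin> N" using elim e by (auto simp: G_def)
      ultimately show "AE \<phi> in lborel. Q (rotate_frame \<phi> e)"
        by (auto elim!: eventually_mono) (use N(1) in blast)
    qed
  qed
qed

text \<open>
  Whichever basis \<open>b P\<close> of the plane is used, it differs from the frame at hand
  by a shift of the phase, which does not affect null sets of phases.
\<close>

lemma AE_frame_if_AE_plane_phase:
  fixes M :: "'n::finite frame measure"
  assumes haar: "haar_two_frame M" and Q: "Measurable.pred M Q"
    and b: "\<And>P. P \<in> oriented_planes \<Longrightarrow> b P \<in> P"
    and AE_P: "AE P in plane_law M. AE \<phi> in lborel. Q (rotate_frame \<phi> (b P))"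
  shows "AE e in M. Q e"
proof (subst AE_frame_average[OF haar Q])
  have "AE e in M. AE \<phi> in lborel. Q (rotate_frame \<phi> (b (oriented_plane e)))"
    by (rule AE_distrD[OF measurable_plane[OF haar] AE_P[unfolded plane_law_def]])
  then show "AE e in M. AE \<phi> in lborel. Q (rotate_frame \<phi> e)"
    using AE_space
  proof eventually_elim
    case (elim e)
    then have "b (oriented_plane e) \<in> oriented_plane e"
      using haar_two_frameD(3)[OF haar] by (intro b) (auto simp: oriented_planes_def)
    then obtain \<psi> where \<psi>: "b (oriented_plane e) = rotate_frame \<psi> e" by (auto simp: oriented_plane_def)
    have "AE \<phi> in lborel. \<phi> \<notin> {\<phi>. \<not> Q (rotate_frame (\<phi> + \<psi>) e)}"
      using elim(1) by (simp add: \<psi> rotate_frame_add)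
    then have "AE \<phi> in lborel. \<phi> - \<psi> \<notin> {\<phi>. \<not> Q (rotate_frame (\<phi> + \<psi>) e)}"
      by (rule AE_not_vimage_null[where S = UNIV and f' = "\<lambda>_. 1"]) (auto intro!: derivative_eq_intros)
    then show ?case by simp
  qed
qed

section \<open>The conditional law of the tangential component\<close>

text \<open>
  The phase \<open>\<phi>\<^sub>0\<close> is the direction in the plane of the projection of
  \<open>a\<close>.
\<close>

lemma frame_polar_coordinates:
  obtains \<phi>\<^sub>0 where "0 \<le> \<phi>\<^sub>0" "\<phi>\<^sub>0 \<le> 2 * pi"
    "\<And>\<phi>. a \<bullet> fst (rotate_frame \<phi> e) = sqrt ((a \<bullet> fst e)\<^sup>2 + (a \<bullet> snd e)\<^sup>2) * cos (\<phi> - \<phi>\<^sub>0)"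
    "\<And>\<phi>. a \<bullet> snd (rotate_frame \<phi> e) = - (sqrt ((a \<bullet> fst e)\<^sup>2 + (a \<bullet> snd e)\<^sup>2) * sin (\<phi> - \<phi>\<^sub>0))"
proof -
  let ?x = "a \<bullet> fst e" and ?y = "a \<bullet> snd e"
  let ?r = "sqrt (?x\<^sup>2 + ?y\<^sup>2)"
  obtain t where t: "0 \<le> t" "t \<le> 2 * pi" "?x = ?r * cos t" "?y = ?r * sin t"
  proof (cases "?r = 0")
    case True
    then have "?x = 0" "?y = 0" by (auto simp: sum_power2_eq_zero_iff)
    then show ?thesis using that[of 0] by simp
  next
    case False
    have "(?x / ?r)\<^sup>2 + (?y / ?r)\<^sup>2 = (?x\<^sup>2 + ?y\<^sup>2) / ?r\<^sup>2"
      by (simp only: power_divide add_divide_distrib)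
    also have "\<dots> = 1" using False by simp
    finally obtain t where "0 \<le> t" "t < 2 * pi" "?x / ?r = cos t" "?y / ?r = sin t"
      by (rule sincos_total_2pi)
    then show ?thesis using that[of t] False by (simp add: field_simps)
  qed
  show ?thesis
  proof (rule that[OF t(1,2)])
    fix \<phi>
    have "a \<bullet> fst (rotate_frame \<phi> e) = cos \<phi> * ?x + sin \<phi> * ?y"
      by (simp add: rotate_frame_def inner_add_right)
    also have "\<dots> = cos \<phi> * (?r * cos t) + sin \<phi> * (?r * sin t)"
      using t(3,4) by simp
    finally show "a \<bullet> fst (rotate_frame \<phi> e) = ?r * cos (\<phi> - t)"
      by (simp add: cos_diff algebra_simps)
    have "a \<bullet> snd (rotate_frame \<phi> e) = - sin \<phi> * ?x + cos \<phi> * ?y"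
      by (simp add: rotate_frame_def inner_add_right inner_diff_right)
    also have "\<dots> = - sin \<phi> * (?r * cos t) + cos \<phi> * (?r * sin t)"
      using t(3,4) by simp
    finally show "a \<bullet> snd (rotate_frame \<phi> e) = - (?r * sin (\<phi> - t))"
      by (simp add: sin_diff algebra_simps)
  qed
qed

text \<open>
  The real-valued Borel version of \<open>\<psi>\<close> on the whole line.
\<close>

definition profile :: "(real \<Rightarrow> ereal) \<Rightarrow> real \<Rightarrow> real" where
  "profile \<psi> t = real_of_ereal (if t \<in> {-1<..<0} \<union> {0<..<1} then \<psi> t else 0)"

lemma measurable_profile:
  assumes "\<psi> \<in> borel_measurable (restrict_space borel ({-1<..<0} \<union> {0<..<1}))"
  shows "profile \<psi> \<in> borel_measurable borel"
proof -
  have "(\<lambda>t. if t \<in> {-1<..<0} \<union> {0<..<1} then \<psi> t else 0) \<in> borel_measurable borel"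
    using assms by (subst (asm) measurable_restrict_space_iff[where c = 0]) auto
  then show ?thesis unfolding profile_def[abs_def] by measurable
qed

lemma reciprocal_modulus_iff_profile:
  "reciprocal_modulus \<psi> \<longleftrightarrow> (AE t in lborel. t \<in> {-1<..<1} \<longrightarrow> \<bar>profile \<psi> t\<bar> = 1 / \<bar>t\<bar>)"
proof -
  have "\<bar>\<psi> t\<bar> = ereal (1 / \<bar>t\<bar>) \<longleftrightarrow> \<bar>profile \<psi> t\<bar> = 1 / \<bar>t\<bar>" if "t \<noteq> 0" "t \<in> {-1<..<1}" for t
    using that by (cases "\<psi> t") (auto simp: profile_def)
  moreover have "AE t in lborel. t \<noteq> (0 :: real)" by (rule AE_lborel_singleton)
  ultimately show ?thesis
    unfolding reciprocal_modulus_def by (intro AE_cong_simp eventually_subst) (auto elim: eventually_mono)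
qed

lemma norm_tangent_part:
  fixes a u :: "'a::real_inner"
  assumes "norm a = 1" "norm u = 1"
  shows "(norm (a - (a \<bullet> u) *\<^sub>R u))\<^sup>2 = 1 - (a \<bullet> u)\<^sup>2"
  using assms unfolding power2_norm_eq_inner norm_eq_1
  by (simp add: inner_diff_left inner_diff_right inner_commute power2_eq_square)

locale frame_field =
  fixes a :: "real ^ 'n" and \<psi> :: "real \<Rightarrow> ereal" and T :: "real ^ 'n \<Rightarrow> real ^ 'n"
    and M :: "'n frame measure"
  assumes dim: "CARD('n) \<ge> 3"
    and norm_a: "norm a = 1"
    and psi_borel: "\<psi> \<in> borel_measurable (restrict_space borel ({-1<..<0} \<union> {0<..<1}))"
    and field: "field_of \<psi> a T"
    and haar: "haar_two_frame M"
begin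

abbreviation "h \<equiv> profile \<psi>"
abbreviation "plane_radius e \<equiv> sqrt ((a \<bullet> fst e)\<^sup>2 + (a \<bullet> snd e)\<^sup>2)"

sublocale prob_space M by (rule haar_two_frameD(1)[OF haar])

lemmas sets_M = haar_two_frameD(2)[OF haar]
lemmas space_M = haar_two_frameD(3)[OF haar]

lemma h_measurable [measurable]: "h \<in> borel_measurable borel"
  by (rule measurable_profile[OF psi_borel])

lemma fst_measurable [measurable]: "fst \<in> borel_measurable M"
  and snd_measurable [measurable]: "snd \<in> borel_measurable M"
  by (rule measurable_frame_components[OF sets_M])+

lemma plane_measurable [measurable]: "oriented_plane \<in> M \<rightarrow>\<^sub>M plane_space"
  by (rule measurable_plane[OF haar])

lemma fst_measurable_sphere: "fst \<in> M \<rightarrow>\<^sub>M restrict_space borel (sphere 0 1)"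
  using measurable_frame_fst measurable_cong_sets[OF sets_M refl] by blast

lemma field_measurable [measurable]: "(\<lambda>e. T (fst e)) \<in> borel_measurable M"
  by (rule measurable_compose[OF fst_measurable_sphere]) (use field in \<open>simp add: field_of_def\<close>)

text \<open>
  The coordinate \<open>a \<bullet> u\<close> has an absolutely continuous law on \<open>[-1,
  1]\<close>; the endpoints and the equator are null.
\<close>

lemma AE_coordinate:
  assumes "AE y in lborel. y \<in> {-1<..<1} \<longrightarrow> P y" and [measurable]: "Measurable.pred borel P"
  shows "AE e in M. a \<bullet> fst e \<noteq> 0 \<and> \<bar>a \<bullet> fst e\<bar> < 1 \<and> P (a \<bullet> fst e)"
proof -
  \<comment> \<open>the closed interval, since \<open>\<bar>a \<bullet> u\<bar> \<le> 1\<close> holds surely while \<open>P\<close> is known inside only\<close>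
  let ?N = "{y :: real. \<bar>y\<bar> \<le> 1 \<and> \<not> (y \<noteq> 0 \<and> \<bar>y\<bar> < 1 \<and> P y)}"
  have "AE y in lborel. y \<notin> ?N"
    using assms(1) AE_lborel_singleton[of 0] AE_lborel_singleton[of 1] AE_lborel_singleton[of "-1"]
    by eventually_elim (auto simp: abs_le_iff)
  moreover have "?N \<in> sets borel" by measurable
  ultimately have "AE e in M. a \<bullet> fst e \<notin> ?N"
    using dim by (intro AE_frame_coordinate_not_in_null[OF haar norm_a]) auto
  then show ?thesis using AE_space
  proof eventually_elim
    case (elim e)
    have "\<bar>a \<bullet> fst e\<bar> \<le> 1"
      using Cauchy_Schwarz_ineq2[of a "fst e"] norm_a two_framesD[of e] elim(2) space_M by simp
    then show ?case using elim(1) by blast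
  qed
qed

lemma field_eq_profile:
  assumes "norm u = 1" "a \<bullet> u \<noteq> 0" "\<bar>a \<bullet> u\<bar> < 1"
  shows "T u = h (a \<bullet> u) *\<^sub>R (a - (a \<bullet> u) *\<^sub>R u)"
  using assms field by (auto simp: field_of_def profile_def)

lemma field_inner_eq_profile:
  assumes e: "e \<in> two_frames" and nz: "a \<bullet> fst e \<noteq> 0"
  shows "T (fst e) \<bullet> snd e = h (a \<bullet> fst e) * (a \<bullet> snd e)"
proof (cases "\<bar>a \<bullet> fst e\<bar> < 1")
  case True
  then show ?thesis
    using two_framesD[OF e] nz by (simp add: field_eq_profile inner_diff_left)
next
  case False
  \<comment> \<open>then \<open>u = \<plusminus>a\<close> and both sides vanish\<close>
  then have "1 \<le> (a \<bullet> fst e)\<^sup>2" using abs_le_square_iff[of 1 "a \<bullet> fst e"] by simp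
  then have "(norm (a - (a \<bullet> fst e) *\<^sub>R fst e))\<^sup>2 \<le> 0"
    using norm_tangent_part[OF norm_a two_framesD(1)[OF e]] by simp
  then have z: "a - (a \<bullet> fst e) *\<^sub>R fst e = 0" by simp
  then have "a \<bullet> snd e = ((a \<bullet> fst e) *\<^sub>R fst e) \<bullet> snd e" by simp
  then have "a \<bullet> snd e = 0" using two_framesD[OF e] by simp
  moreover have "T (fst e) = 0"
    using field nz two_framesD[OF e] z by (simp add: field_of_def)
  ultimately show ?thesis by simp
qed

lemma AE_field_inner_eq_profile: "AE e in M. T (fst e) \<bullet> snd e = h (a \<bullet> fst e) * (a \<bullet> snd e)"
proof -
  have "AE e in M. a \<bullet> fst e \<noteq> 0 \<and> \<bar>a \<bullet> fst e\<bar> < 1 \<and> True" by (rule AE_coordinate) auto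
  then show ?thesis using AE_space
    by eventually_elim (auto simp: space_M field_inner_eq_profile)
qed

lemma squared_radius_rotate_frame:
  "(a \<bullet> fst (rotate_frame \<phi> e))\<^sup>2 + (a \<bullet> snd (rotate_frame \<phi> e))\<^sup>2 = (a \<bullet> fst e)\<^sup>2 + (a \<bullet> snd e)\<^sup>2"
proof -
  obtain \<phi>0 where *: "a \<bullet> fst (rotate_frame \<phi> e) = plane_radius e * cos (\<phi> - \<phi>0)"
    "a \<bullet> snd (rotate_frame \<phi> e) = - (plane_radius e * sin (\<phi> - \<phi>0))"
    by (rule frame_polar_coordinates[of a e]) blast
  have "(plane_radius e * cos t)\<^sup>2 + (- (plane_radius e * sin t))\<^sup>2 = (plane_radius e)\<^sup>2 * ((sin t)\<^sup>2 + (cos t)\<^sup>2)" for t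
    by (simp only: power_mult_distrib power2_minus distrib_left add.commute)
  then show ?thesis unfolding * by simp
qed

text \<open>
  Given the plane, the tangential component is averaged over a uniform phase.  The right-hand
  side uses the phase \<open>\<alpha>\<close> measured from the direction of \<open>a\<close>,
  which makes it a function of the radius only.
\<close>

lemma nn_integral_plane_average:
  assumes [measurable]: "A \<in> sets plane_space" "k \<in> borel_measurable borel"
  shows "ennreal (2 * pi) * (\<integral>\<^sup>+e. indicator A (oriented_plane e) * k (T (fst e) \<bullet> snd e) \<partial>M) =
    (\<integral>\<^sup>+e. indicator A (oriented_plane e) *
       (\<integral>\<^sup>+\<alpha>\<in>{0<..2*pi}. k (- (h (plane_radius e * cos \<alpha>) * (plane_radius e * sin \<alpha>))) \<partial>lborel) \<partial>M)"
proof -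
  let ?f = "\<lambda>e. indicator A (oriented_plane e) * k (h (a \<bullet> fst e) * (a \<bullet> snd e))"
  have "(\<integral>\<^sup>+e. indicator A (oriented_plane e) * k (T (fst e) \<bullet> snd e) \<partial>M) = (\<integral>\<^sup>+e. ?f e \<partial>M)"
    using AE_field_inner_eq_profile by (intro nn_integral_cong_AE) (auto elim: eventually_mono)
  then have "ennreal (2 * pi) * (\<integral>\<^sup>+e. indicator A (oriented_plane e) * k (T (fst e) \<bullet> snd e) \<partial>M) =
      (\<integral>\<^sup>+e. (\<integral>\<^sup>+\<phi>\<in>{0<..2*pi}. ?f (rotate_frame \<phi> e) \<partial>lborel) \<partial>M)"
    using nn_integral_frame_average[OF haar, of ?f] by simp
  also have "\<dots> = (\<integral>\<^sup>+e. indicator A (oriented_plane e) *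
       (\<integral>\<^sup>+\<alpha>\<in>{0<..2*pi}. k (- (h (plane_radius e * cos \<alpha>) * (plane_radius e * sin \<alpha>))) \<partial>lborel) \<partial>M)"
  proof (intro nn_integral_cong)
    fix e
    obtain \<phi>0 where p: "0 \<le> \<phi>0" "\<phi>0 \<le> 2 * pi"
      "\<And>\<phi>. a \<bullet> fst (rotate_frame \<phi> e) = plane_radius e * cos (\<phi> - \<phi>0)"
      "\<And>\<phi>. a \<bullet> snd (rotate_frame \<phi> e) = - (plane_radius e * sin (\<phi> - \<phi>0))"
      by (rule frame_polar_coordinates[of a e]) blast
    define g where "g \<alpha> = k (- (h (plane_radius e * cos \<alpha>) * (plane_radius e * sin \<alpha>)))" for \<alpha>
    have [measurable]: "g \<in> borel_measurable borel" unfolding g_def[abs_def] by measurable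
    have "(\<integral>\<^sup>+\<phi>\<in>{0<..2*pi}. ?f (rotate_frame \<phi> e) \<partial>lborel) =
        (\<integral>\<^sup>+\<phi>. indicator A (oriented_plane e) * (g (\<phi> - \<phi>0) * indicator {0<..2*pi} \<phi>) \<partial>lborel)"
      by (simp only: oriented_plane_rotate_frame p(3,4) g_def mult.assoc mult_minus_right)
    also have "\<dots> = indicator A (oriented_plane e) * (\<integral>\<^sup>+\<phi>\<in>{0<..2*pi}. g (\<phi> - \<phi>0) \<partial>lborel)"
      by (rule nn_integral_cmult) measurable
    also have "(\<integral>\<^sup>+\<phi>\<in>{0<..2*pi}. g (\<phi> - \<phi>0) \<partial>lborel) = (\<integral>\<^sup>+\<phi>\<in>{0<..2*pi}. g \<phi> \<partial>lborel)"
      by (rule nn_integral_period_shift) (auto simp: g_def p(1,2))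
    finally show "(\<integral>\<^sup>+\<phi>\<in>{0<..2*pi}. ?f (rotate_frame \<phi> e) \<partial>lborel) = indicator A (oriented_plane e) *
       (\<integral>\<^sup>+\<alpha>\<in>{0<..2*pi}. k (- (h (plane_radius e * cos \<alpha>) * (plane_radius e * sin \<alpha>))) \<partial>lborel)"
      by (simp only: g_def)
  qed
  finally show ?thesis .
qed

lemma inner_measurable: "(\<lambda>(u, v). T u \<bullet> v) \<in> borel_measurable M"
  unfolding split_beta' by measurable

lemma emeasure_plane_inner_event:
  assumes [measurable]: "A \<in> sets plane_space" "B \<in> sets borel"
  shows "emeasure M {e \<in> space M. oriented_plane e \<in> A \<and> (case e of (u, v) \<Rightarrow> T u \<bullet> v) \<in> B} =
    (\<integral>\<^sup>+e. indicator A (oriented_plane e) * indicator B (T (fst e) \<bullet> snd e) \<partial>M)"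
proof -
  let ?E = "{e \<in> space M. oriented_plane e \<in> A \<and> T (fst e) \<bullet> snd e \<in> B}"
  have "?E \<in> sets M" by measurable
  then have "emeasure M ?E = (\<integral>\<^sup>+e. indicator ?E e \<partial>M)" by simp
  also have "\<dots> = (\<integral>\<^sup>+e. indicator A (oriented_plane e) * indicator B (T (fst e) \<bullet> snd e) \<partial>M)"
    by (intro nn_integral_cong) (auto simp: indicator_def)
  finally show ?thesis by (simp add: split_beta')
qed

lemma AE_phase_coordinate:
  assumes "AE e in M. P (a \<bullet> fst e)"
  shows "AE e in M. AE \<phi> in lborel. P (a \<bullet> fst (rotate_frame \<phi> e))"
proof -
  obtain N where N: "{e \<in> space M. \<not> P (a \<bullet> fst e)} \<subseteq> N" "N \<in> null_sets M"
    using assms by (auto simp: eventually_ae_filter)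
  have [measurable]: "N \<in> sets M" using N by auto
  have "AE e in M. e \<notin> N" by (rule AE_not_in) fact
  then have "AE e in M. AE \<phi> in lborel. rotate_frame \<phi> e \<notin> N" by (subst (asm) AE_frame_average[OF haar]) auto
  then show ?thesis using AE_space
  proof eventually_elim
    case (elim e)
    then have "rotate_frame \<phi> e \<in> space M" for \<phi> using space_M rotate_frame_in_two_frames by simp
    with elim(1) show ?case by (auto elim!: eventually_mono) (use N(1) in blast)
  qed
qed

lemma AE_plane_radius_pos: "AE e in M. plane_radius e > 0"
proof -
  have "AE e in M. a \<bullet> fst e \<noteq> 0 \<and> \<bar>a \<bullet> fst e\<bar> < 1 \<and> True" by (rule AE_coordinate) auto
  then show ?thesis by eventually_elim (auto simp: sum_power2_gt_zero_iff)
qed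

lemma AE_circle_of_AE_phase:
  assumes "AE \<phi> in lborel. P (a \<bullet> fst (rotate_frame \<phi> e))"
  shows "AE \<alpha> in lborel. P (plane_radius e * cos \<alpha>)"
proof -
  obtain \<phi>0 where p: "\<And>\<phi>. a \<bullet> fst (rotate_frame \<phi> e) = plane_radius e * cos (\<phi> - \<phi>0)"
    by (rule frame_polar_coordinates[of a e]) blast
  have "AE \<phi> in lborel. \<phi> \<notin> {\<phi>. \<not> P (plane_radius e * cos (\<phi> - \<phi>0))}" using assms by (simp add: p)
  then have "AE \<phi> in lborel. \<phi> + \<phi>0 \<notin> {\<phi>. \<not> P (plane_radius e * cos (\<phi> - \<phi>0))}"
    by (rule AE_not_vimage_null[where S = UNIV and f' = "\<lambda>_. 1"]) (auto intro!: derivative_eq_intros)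
  then show ?thesis by simp
qed

text \<open>
  The conditional law does not depend on the plane, so the constant kernel is a regular
  version of it.
\<close>

lemma conditionally_cauchy_if_reciprocal:
  assumes "reciprocal_modulus \<psi>"
  shows "conditionally_cauchy M T"
  unfolding conditionally_cauchy_def conditional_law_def
proof (intro exI[of _ "\<lambda>_. std_cauchy"] conjI ballI)
  show "(\<lambda>_. std_cauchy) \<in> plane_space \<rightarrow>\<^sub>M prob_algebra borel"
    by (rule measurable_const) (simp add: space_prob_algebra prob_space_std_cauchy)
  show "AE P in plane_law M. std_cauchy = std_cauchy" by simp
  have "AE e in M. a \<bullet> fst e \<noteq> 0 \<and> \<bar>a \<bullet> fst e\<bar> < 1 \<and> \<bar>h (a \<bullet> fst e)\<bar> = 1 / \<bar>a \<bullet> fst e\<bar>"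
    using assms unfolding reciprocal_modulus_iff_profile by (rule AE_coordinate) measurable
  then have "AE e in M. AE \<phi> in lborel. \<bar>h (a \<bullet> fst (rotate_frame \<phi> e))\<bar> = 1 / \<bar>a \<bullet> fst (rotate_frame \<phi> e)\<bar>"
    by (intro AE_phase_coordinate[where P = "\<lambda>t. \<bar>h t\<bar> = 1 / \<bar>t\<bar>"]) auto
  then have mod: "AE e in M. AE \<alpha> in lborel. \<bar>h (plane_radius e * cos \<alpha>)\<bar> = 1 / \<bar>plane_radius e * cos \<alpha>\<bar>"
    by eventually_elim (rule AE_circle_of_AE_phase[where P = "\<lambda>t. \<bar>h t\<bar> = 1 / \<bar>t\<bar>"])
  fix A :: "'n frame set set" and B :: "real set"
  assume [measurable]: "A \<in> sets plane_space" "B \<in> sets borel"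
  let ?E = "{e \<in> space M. oriented_plane e \<in> A \<and> (case e of (u, v) \<Rightarrow> T u \<bullet> v) \<in> B}"
  have "ennreal (2 * pi) * emeasure M ?E =
     ennreal (2 * pi) * (\<integral>\<^sup>+e. indicator A (oriented_plane e) * indicator B (T (fst e) \<bullet> snd e) \<partial>M)"
    by (subst emeasure_plane_inner_event) auto
  also have "\<dots> = (\<integral>\<^sup>+e. indicator A (oriented_plane e) * (ennreal (2 * pi) * emeasure std_cauchy B) \<partial>M)"
  proof (subst nn_integral_plane_average, measurable, intro nn_integral_cong_AE)
    show "AE e in M. indicator A (oriented_plane e) *
       (\<integral>\<^sup>+\<alpha>\<in>{0<..2*pi}. indicator B (- (h (plane_radius e * cos \<alpha>) * (plane_radius e * sin \<alpha>))) \<partial>lborel) =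
       indicator A (oriented_plane e) * (ennreal (2 * pi) * emeasure std_cauchy B)"
      using mod AE_plane_radius_pos
    proof eventually_elim
      case (elim e)
      then show ?case by (subst nn_integral_signed_tan_circle) auto
    qed
  qed
  also have "\<dots> = ennreal (2 * pi) * (\<integral>\<^sup>+e. emeasure std_cauchy B * indicator A (oriented_plane e) \<partial>M)"
    by (subst nn_integral_cmult[symmetric]) (auto simp: mult_ac intro!: nn_integral_cong)
  also have "(\<integral>\<^sup>+e. emeasure std_cauchy B * indicator A (oriented_plane e) \<partial>M) =
      (\<integral>\<^sup>+P\<in>A. emeasure std_cauchy B \<partial>distr M plane_space oriented_plane)"
    by (subst nn_integral_distr) auto
  finally show "emeasure M ?E = (\<integral>\<^sup>+P\<in>A. emeasure std_cauchy B \<partial>distr M plane_space oriented_plane)"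
    by (simp add: ennreal_mult_cancel_left)
qed (use inner_measurable plane_measurable in auto)

text \<open>
  Tested against events that concern only the squared radius, the conditional law yields the
  circular moments of \<open>h\<close> for almost every radius with respect to its law, and
  hence with respect to Lebesgue measure on \<open>(0, 1)\<close>.
\<close>

lemma reciprocal_if_conditionally_cauchy:
  assumes "conditionally_cauchy M T"
  shows "reciprocal_modulus \<psi>"
proof -
  obtain K where K: "AE P in distr M plane_space oriented_plane. K P = std_cauchy"
    and cond: "\<And>A B. A \<in> sets plane_space \<Longrightarrow> B \<in> sets borel \<Longrightarrow>
        emeasure M {e \<in> space M. oriented_plane e \<in> A \<and> (case e of (u, v) \<Rightarrow> T u \<bullet> v) \<in> B} =
        (\<integral>\<^sup>+P\<in>A. emeasure (K P) B \<partial>distr M plane_space oriented_plane)"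
    using assms unfolding conditionally_cauchy_def conditional_law_def plane_law_def by blast
  define L where "L = distr M borel (\<lambda>e. (a \<bullet> fst e)\<^sup>2 + (a \<bullet> snd e)\<^sup>2)"
  interpret L: prob_space L unfolding L_def by (rule prob_space_distr) measurable
  define J where "J s x = (\<integral>\<^sup>+\<alpha>\<in>{0<..2*pi}. ennreal (\<bar>h (sqrt x * cos \<alpha>) * (sqrt x * sin \<alpha>)\<bar> powr s) \<partial>lborel)" for s x :: real
  have [measurable]: "J s \<in> borel_measurable borel" for s unfolding J_def[abs_def] by measurable
  define J0 where "J0 s = (\<integral>\<^sup>+\<alpha>\<in>{0<..2*pi}. ennreal (\<bar>tan \<alpha>\<bar> powr s) \<partial>lborel)" for s :: real
  have key: "AE x in L. J s x = J0 s" for s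
  proof (rule sigma_finite_measure.density_unique2)
    show "sigma_finite_measure L" ..
    show "J s \<in> borel_measurable L" "(\<lambda>_. J0 s) \<in> borel_measurable L" by (auto simp: L_def)
    fix D assume "D \<in> sets L"
    then have [measurable]: "D \<in> sets borel" by (simp add: L_def)
    define G where "G e \<longleftrightarrow> (a \<bullet> fst e)\<^sup>2 + (a \<bullet> snd e)\<^sup>2 \<in> D" for e
    define A where "A = {P \<in> oriented_planes. \<forall>e\<in>P. G e}"
    have [measurable]: "Measurable.pred M G" unfolding G_def by measurable
    then have "Measurable.pred frame_space G" using sets_M by (simp cong: measurable_cong_sets)
    from invariant_plane_event[OF this, folded A_def]
    have A [measurable]: "A \<in> sets plane_space" and AG: "\<And>e. e \<in> space M \<Longrightarrow> oriented_plane e \<in> A \<longleftrightarrow> G e"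
      by (auto simp: G_def squared_radius_rotate_frame space_M)
    let ?k = "\<lambda>x :: real. ennreal (\<bar>x\<bar> powr s)"
    let ?X = "\<lambda>e. T (fst e) \<bullet> snd e"
    let ?p = "emeasure M {e \<in> space M. G e}"
    \<comment> \<open>independence of the component and the event \<open>A\<close>, written as an equality of measures\<close>
    have law: "distr (density M (\<lambda>e. indicator A (oriented_plane e))) borel ?X = scale_measure ?p std_cauchy"
    proof (rule measure_eqI)
      fix B assume "B \<in> sets (distr (density M (\<lambda>e. indicator A (oriented_plane e))) borel ?X)"
      then have B [measurable]: "B \<in> sets borel" by simp
      have "emeasure (distr (density M (\<lambda>e. indicator A (oriented_plane e))) borel ?X) B =
          (\<integral>\<^sup>+e. indicator A (oriented_plane e) * indicator (?X -` B \<inter> space M) e \<partial>M)"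
        by (subst emeasure_distr, simp, simp, subst emeasure_density) auto
      also have "\<dots> = emeasure M {e \<in> space M. oriented_plane e \<in> A \<and> (case e of (u, v) \<Rightarrow> T u \<bullet> v) \<in> B}"
        by (subst emeasure_plane_inner_event) (auto simp: indicator_def intro!: nn_integral_cong)
      also have "\<dots> = (\<integral>\<^sup>+P\<in>A. emeasure std_cauchy B \<partial>distr M plane_space oriented_plane)"
        unfolding cond[OF A B] using K by (intro nn_integral_cong_AE) (auto elim: eventually_mono)
      also have "\<dots> = (\<integral>\<^sup>+e. emeasure std_cauchy B * indicator {e \<in> space M. G e} e \<partial>M)"
        by (subst nn_integral_distr) (auto simp: AG indicator_def intro!: nn_integral_cong)
      also have "\<dots> = emeasure (scale_measure ?p std_cauchy) B"
        by (subst nn_integral_cmult) (auto simp: mult.commute)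
      finally show "emeasure (distr (density M (\<lambda>e. indicator A (oriented_plane e))) borel ?X) B =
          emeasure (scale_measure ?p std_cauchy) B" .
    qed simp
    have "(\<integral>\<^sup>+x\<in>D. J s x \<partial>L) = (\<integral>\<^sup>+e. indicator A (oriented_plane e) * J s ((a \<bullet> fst e)\<^sup>2 + (a \<bullet> snd e)\<^sup>2) \<partial>M)"
      unfolding L_def by (subst nn_integral_distr) (auto simp: AG G_def indicator_def intro!: nn_integral_cong)
    also have "\<dots> = ennreal (2 * pi) * (\<integral>\<^sup>+e. indicator A (oriented_plane e) * ?k (?X e) \<partial>M)"
      by (subst nn_integral_plane_average) (auto simp: J_def)
    also have "(\<integral>\<^sup>+e. indicator A (oriented_plane e) * ?k (?X e) \<partial>M) =
        (\<integral>\<^sup>+x. ?k x \<partial>distr (density M (\<lambda>e. indicator A (oriented_plane e))) borel ?X)"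
      by (subst nn_integral_distr, simp, simp, subst nn_integral_density) auto
    also have "\<dots> = ?p * (\<integral>\<^sup>+x. ?k x \<partial>std_cauchy)"
      unfolding law by (rule nn_integral_scale_measure) simp
    also have "ennreal (2 * pi) * \<dots> = ?p * J0 s"
      unfolding J0_def by (subst nn_integral_tan_circle) (auto simp: mult_ac)
    also have "\<dots> = (\<integral>\<^sup>+e. J0 s * indicator {e \<in> space M. G e} e \<partial>M)"
      by (subst nn_integral_cmult) (auto simp: mult.commute)
    also have "\<dots> = (\<integral>\<^sup>+x\<in>D. J0 s \<partial>L)"
      unfolding L_def by (subst nn_integral_distr) (auto simp: G_def indicator_def intro!: nn_integral_cong)
    finally show "(\<integral>\<^sup>+x\<in>D. J s x \<partial>L) = (\<integral>\<^sup>+x\<in>D. J0 s \<partial>L)" .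
  qed
  show ?thesis unfolding reciprocal_modulus_iff_profile
  proof (rule reciprocal_modulus_of_moments)
    fix s :: real assume "0 < s" "s < 1"
    have "AE e in M. (a \<bullet> fst e)\<^sup>2 + (a \<bullet> snd e)\<^sup>2 \<notin> {x. J s x \<noteq> J0 s}"
      using key[of s] unfolding L_def by (subst (asm) AE_distr_iff) auto
    then have "AE x in lborel. x \<in> {0<..<1} \<longrightarrow> x \<notin> {x. J s x \<noteq> J0 s}"
      by (intro AE_frame_squared_length[OF haar norm_a dim]) auto
    then show "AE x in lborel. x \<in> {0<..<1} \<longrightarrow>
      (\<integral>\<^sup>+\<alpha>\<in>{0<..2*pi}. ennreal (\<bar>h (sqrt x * cos \<alpha>) * (sqrt x * sin \<alpha>)\<bar> powr s) \<partial>lborel) =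
      (\<integral>\<^sup>+\<alpha>\<in>{0<..2*pi}. ennreal (\<bar>tan \<alpha>\<bar> powr s) \<partial>lborel)"
      by (simp add: J_def J0_def)
  qed simp
qed
end

section \<open>The phase function and its Cayley transform\<close>

text \<open>
  The Cayley transform takes \<open>tan x\<close> to \<open>e\<^bsup>i x\<^esup> / e\<^bsup>-
  i x\<^esup>\<close>.
\<close>

lemma cayley_tan:
  assumes "cos x \<noteq> 0"
  shows "(1 + \<i> * of_real (tan x)) / (1 - \<i> * of_real (tan x)) = cis (2 * x)"
proof -
  have "cis x = of_real (cos x) * (1 + \<i> * of_real (tan x))" "cis (- x) = of_real (cos x) * (1 - \<i> * of_real (tan x))"
    using assms by (auto simp: complex_eq_iff tan_def)
  then have "(1 + \<i> * of_real (tan x)) / (1 - \<i> * of_real (tan x)) = cis x / cis (- x)"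
    using assms by simp
  also have "\<dots> = cis (2 * x)" by (simp add: cis_divide)
  finally show ?thesis .
qed

lemma cayley_inj:
  assumes "(1 + \<i> * of_real x) / (1 - \<i> * of_real x) = (1 + \<i> * of_real y) / (1 - \<i> * of_real y)"
  shows "x = (y :: real)"
proof -
  have nz: "1 - \<i> * of_real t \<noteq> 0" for t :: real by (auto simp: complex_eq_iff)
  have "(1 + \<i> * of_real x) * (1 - \<i> * of_real y) = (1 + \<i> * of_real y) * (1 - \<i> * of_real x)"
    using assms nz by (simp add: frac_eq_eq)
  then show ?thesis by (simp add: complex_eq_iff)
qed

context frame_field
begin

lemma phase_fun_polar:
  assumes e: "e \<in> two_frames" and U: "a \<bullet> fst (rotate_frame \<phi> e) = r * cos \<alpha>"
    and V: "a \<bullet> snd (rotate_frame \<phi> e) = - (r * sin \<alpha>)" and nz: "r * cos \<alpha> \<noteq> 0"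
  shows "phase_fun T e \<phi> = h (r * cos \<alpha>) * (r * sin \<alpha>)"
  using field_inner_eq_profile[OF rotate_frame_in_two_frames[OF e], of \<phi>] nz
  by (simp add: phase_fun_def U V)

text \<open>
  The tangential part of \<open>a\<close> is the same nonzero vector at \<open>u\<close> and
  at \<open>- u\<close>.
\<close>

lemma profile_odd_if_field_odd:
  assumes u: "norm u = 1" and t: "a \<bullet> u \<noteq> 0" "\<bar>a \<bullet> u\<bar> < 1" and odd: "T (- u) = - T u"
  shows "h (- (a \<bullet> u)) = - h (a \<bullet> u)"
proof -
  let ?w = "a - (a \<bullet> u) *\<^sub>R u"
  have "(a \<bullet> u)\<^sup>2 < 1" using t(2) by (simp add: abs_square_less_1)
  then have "(norm ?w)\<^sup>2 \<noteq> 0" using norm_tangent_part[OF norm_a u] by simp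
  then have w: "?w \<noteq> 0" by auto
  have "h (- (a \<bullet> u)) *\<^sub>R ?w = T (- u)"
    using field_eq_profile[of "- u"] u t by simp
  also have "\<dots> = (- h (a \<bullet> u)) *\<^sub>R ?w"
    using field_eq_profile[of u] u t odd by simp
  finally show ?thesis using w by (simp only: scaleR_cancel_right) simp
qed

lemma AE_sphere_iff:
  assumes "Measurable.pred (restrict_space borel (sphere 0 1)) P"
  shows "(AE u in sphere_law M. P u) \<longleftrightarrow> (AE e in M. P (fst e))"
  unfolding sphere_law_def by (rule AE_distr_iff[OF fst_measurable_sphere predE[OF assms]])

lemma pred_field_reciprocal:
  "Measurable.pred (restrict_space borel (sphere 0 1)) (\<lambda>u. T u = (1 / (a \<bullet> u)) *\<^sub>R a - u)"
proof -
  have [measurable]: "T \<in> borel_measurable (restrict_space borel (sphere 0 1))"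
    using field by (simp add: field_of_def)
  have [measurable]: "(\<lambda>u. u) \<in> borel_measurable (restrict_space borel (sphere (0 :: real ^ 'n) 1))"
    by (rule measurable_restrict_space1) simp
  show ?thesis by measurable
qed

lemma basis_two_frames:
  assumes "\<And>P. P \<in> oriented_planes \<Longrightarrow> b P \<in> P" "P \<in> oriented_planes"
  shows "b P \<in> two_frames"
  using assms(1)[OF assms(2)] assms(2) rotate_frame_in_two_frames
  by (auto simp: oriented_planes_def oriented_plane_def)

lemma AE_plane_oriented: "AE P in plane_law M. P \<in> oriented_planes"
proof -
  have "space plane_space = (oriented_planes :: 'n frame set set)"
    unfolding plane_space_def by (rule space_measure_of) auto
  then have "space (plane_law M) = oriented_planes" by (simp add: plane_law_def)
  then show ?thesis using AE_space[of "plane_law M"] by simp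
qed

text \<open>
  The phase function is \<open>tan (\<phi> - \<phi>\<^sub>0)\<close>, so
  \<open>b\<^sub>P\<close> is the boundary function of the rotation by \<open>- 2
  \<phi>\<^sub>0\<close>.
\<close>

lemma H_infinity_phase_if_reciprocal_field:
  assumes rf: "AE u in sphere_law M. T u = (1 / (a \<bullet> u)) *\<^sub>R a - u"
    and basis: "\<And>P. P \<in> oriented_planes \<Longrightarrow> basis P \<in> P"
  shows "AE P in plane_law M. \<exists>f\<in>H_infinity. boundary_function f (phase_cayley T (basis P))"
proof -
  have "AE e in M. a \<bullet> fst e \<noteq> 0 \<and> \<bar>a \<bullet> fst e\<bar> < 1 \<and> True" by (rule AE_coordinate) auto
  moreover have "AE e in M. T (fst e) = (1 / (a \<bullet> fst e)) *\<^sub>R a - fst e"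
    using rf by (simp add: AE_sphere_iff[OF pred_field_reciprocal])
  ultimately have "AE e in M. a \<bullet> fst e \<noteq> 0 \<and> T (fst e) = (1 / (a \<bullet> fst e)) *\<^sub>R a - fst e"
    by eventually_elim auto
  from AE_plane_AE_phase[OF haar this] AE_plane_oriented show ?thesis
  proof eventually_elim
    case (elim P)
    define e where "e = basis P"
    have e: "e \<in> two_frames" "e \<in> P"
      using basis_two_frames[OF basis elim(2)] basis[OF elim(2)] by (auto simp: e_def)
    define r where "r = plane_radius e"
    obtain \<phi>0 where p: "\<And>\<phi>. a \<bullet> fst (rotate_frame \<phi> e) = r * cos (\<phi> - \<phi>0)"
      "\<And>\<phi>. a \<bullet> snd (rotate_frame \<phi> e) = - (r * sin (\<phi> - \<phi>0))"
      unfolding r_def by (rule frame_polar_coordinates[of a e]) blast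
    define c where "c = cis (- (2 * \<phi>0))"
    have "AE \<phi> in lborel. (1 + \<i> * of_real (phase_fun T e \<phi>)) / (1 - \<i> * of_real (phase_fun T e \<phi>)) = c * cis (2 * \<phi>)"
      using elim(1)[rule_format, OF e(2)]
    proof eventually_elim
      case (elim \<phi>)
      let ?f = "rotate_frame \<phi> e"
      have nz: "r \<noteq> 0" "cos (\<phi> - \<phi>0) \<noteq> 0" using elim by (auto simp: p)
      have "phase_fun T e \<phi> = - ((a \<bullet> snd ?f) / (a \<bullet> fst ?f))"
        using elim two_framesD(3)[OF rotate_frame_in_two_frames[OF e(1)]]
        by (simp add: phase_fun_def inner_diff_left)
      also have "\<dots> = tan (\<phi> - \<phi>0)" unfolding p using nz by (simp add: tan_def)
      finally show ?case
        using cayley_tan[OF nz(2)] by (simp add: c_def cis_mult algebra_simps)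
    qed
    from AE_half_Arg[OF this]
    have bd: "AE \<theta> in lborel. phase_cayley T e (cis \<theta>) = c * cis \<theta>"
    proof eventually_elim
      case (elim \<theta>)
      have "cis (2 * (Arg (cis \<theta>) / 2)) = cis \<theta>"
        using cis_Arg[of "cis \<theta>"] by (simp add: sgn_div_norm)
      then show ?case using elim by (simp only: phase_cayley_def)
    qed
    have "boundary_function (\<lambda>z. c * z) (phase_cayley T e)"
      unfolding boundary_function_def using bd
    proof eventually_elim
      case (elim \<theta>)
      have "((\<lambda>r. c * (complex_of_real r * cis \<theta>)) \<longlongrightarrow> c * (of_real 1 * cis \<theta>)) (at_left 1)"
        by (intro tendsto_intros)
      then show ?case by (simp add: elim)
    qed
    then show ?case using rotation_in_H_infinity[of c] by (auto simp: e_def)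
  qed
qed

text \<open>
  The boundary function has the two branches \<open>w\<close> and \<open>1 / w\<close> and
  analyticity selects \<open>w\<close>.  This determines the phase function at the principal
  half argument \<open>Arg (e\<^bsup>2 i \<phi>\<^esup>) / 2\<close>, which agrees with
  \<open>\<phi>\<close> up to a multiple of \<open>\<pi>\<close>; when the two points are
  antipodal, oddness of the profile transfers the conclusion to \<open>\<phi>\<close>.
\<close>

lemma reciprocal_field_if_H_infinity_phase:
  assumes rec: "reciprocal_modulus \<psi>"
    and odd: "AE u in sphere_law M. T (- u) = - T u"
    and basis: "\<And>P. P \<in> oriented_planes \<Longrightarrow> basis P \<in> P"
    and hardy: "AE P in plane_law M. \<exists>f\<in>H_infinity. boundary_function f (phase_cayley T (basis P))"
  shows "AE u in sphere_law M. T u = (1 / (a \<bullet> u)) *\<^sub>R a - u"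
proof -
  \<comment> \<open>what the hypotheses give at almost every point before analyticity is used\<close>
  define good where "good t \<longleftrightarrow> t \<noteq> 0 \<and> \<bar>h t\<bar> = 1 / \<bar>t\<bar> \<and> h (- t) = - h t" for t
  have coord: "AE e in M. a \<bullet> fst e \<noteq> 0 \<and> \<bar>a \<bullet> fst e\<bar> < 1 \<and> \<bar>h (a \<bullet> fst e)\<bar> = 1 / \<bar>a \<bullet> fst e\<bar>"
    using rec unfolding reciprocal_modulus_iff_profile by (rule AE_coordinate) measurable
  have "AE e in M. T (- fst e) = - T (fst e)"
    using AE_distrD[OF fst_measurable_sphere odd[unfolded sphere_law_def]] .
  with coord have good: "AE e in M. good (a \<bullet> fst e)"
    using AE_space
  proof eventually_elim
    case (elim e)
    then show ?case
      using profile_odd_if_field_odd[of "fst e"] two_framesD[of e] by (auto simp: good_def space_M)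
  qed
  have "AE P in plane_law M. AE \<phi> in lborel. h (a \<bullet> fst (rotate_frame \<phi> (basis P))) = 1 / (a \<bullet> fst (rotate_frame \<phi> (basis P)))"
    using AE_plane_AE_phase[OF haar good] AE_plane_oriented hardy
  proof eventually_elim
    case (elim P)
    define e where "e = basis P"
    have e: "e \<in> two_frames" "e \<in> P"
      using basis_two_frames[OF basis elim(2)] basis[OF elim(2)] by (auto simp: e_def)
    define r where "r = plane_radius e"
    obtain \<phi>0 where p: "\<And>\<phi>. a \<bullet> fst (rotate_frame \<phi> e) = r * cos (\<phi> - \<phi>0)"
      "\<And>\<phi>. a \<bullet> snd (rotate_frame \<phi> e) = - (r * sin (\<phi> - \<phi>0))"
      unfolding r_def by (rule frame_polar_coordinates[of a e]) blast
    have g: "AE \<phi> in lborel. good (r * cos (\<phi> - \<phi>0))"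
      using elim(1)[rule_format, OF e(2)] by (simp add: p)
    define c where "c = cis (- (2 * \<phi>0))"
    let ?F = "phase_fun T e"
    have F: "?F \<phi> = h (r * cos (\<phi> - \<phi>0)) * (r * sin (\<phi> - \<phi>0))" if "good (r * cos (\<phi> - \<phi>0))" for \<phi>
      using that p by (intro phase_fun_polar[OF e(1)]) (auto simp: good_def)
    \<comment> \<open>the half argument is a legitimate phase for the boundary point\<close>
    have half: "cis (2 * (Arg (cis \<theta>) / 2)) = cis \<theta>" for \<theta>
      using cis_Arg[of "cis \<theta>"] by (simp add: sgn_div_norm)
    have ccis: "c * cis \<theta> = cis (2 * (Arg (cis \<theta>) / 2 - \<phi>0))" for \<theta>
      by (subst half[symmetric]) (simp add: c_def cis_mult algebra_simps)
    obtain f where f: "f \<in> H_infinity" "boundary_function f (phase_cayley T e)"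
      using elim(3) by (auto simp: e_def)
    have "AE \<theta> in lborel. phase_cayley T e (cis \<theta>) = c * cis \<theta>"
    proof (rule boundary_rotation_of_two_branches[OF f])
      show "cmod c = 1" by (simp add: c_def)
      show "AE \<theta> in lborel. phase_cayley T e (cis \<theta>) = c * cis \<theta> \<or> phase_cayley T e (cis \<theta>) = inverse (c * cis \<theta>)"
        using AE_half_Arg[OF g]
      proof eventually_elim
        case (elim \<theta>)
        let ?\<alpha> = "Arg (cis \<theta>) / 2 - \<phi>0"
        have nz: "r \<noteq> 0" "cos ?\<alpha> \<noteq> 0" using elim by (auto simp: good_def)
        have "\<bar>?F (Arg (cis \<theta>) / 2)\<bar> = \<bar>tan ?\<alpha>\<bar>"
          using elim nz unfolding F[OF elim] by (simp add: good_def abs_mult tan_def)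
        then consider "?F (Arg (cis \<theta>) / 2) = tan ?\<alpha>" | "?F (Arg (cis \<theta>) / 2) = - tan ?\<alpha>"
          unfolding abs_eq_iff by blast
        then show ?case
        proof cases
          case 1
          then show ?thesis unfolding phase_cayley_def ccis using cayley_tan[OF nz(2)] by simp
        next
          case 2
          then have 2: "?F (Arg (cis \<theta>) / 2) = tan (- ?\<alpha>)" by (simp only: tan_minus)
          have "cos (- ?\<alpha>) \<noteq> 0" unfolding cos_minus by (rule nz(2))
          from cayley_tan[OF this] have "phase_cayley T e (cis \<theta>) = cis (2 * - ?\<alpha>)"
            unfolding phase_cayley_def 2 .
          then show ?thesis unfolding ccis cis_inverse by (intro disjI2) (simp only: mult_minus_right)
        qed
      qed
    qed
    then have "AE \<theta> in lborel. \<theta> \<notin> {\<theta>. \<not> (phase_cayley T e (cis \<theta>) = c * cis \<theta> \<and> good (r * cos (Arg (cis \<theta>) / 2 - \<phi>0)))}"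
      using AE_half_Arg[OF g] by eventually_elim auto
    then have "AE \<phi> in lborel. 2 * \<phi> \<notin> {\<theta>. \<not> (phase_cayley T e (cis \<theta>) = c * cis \<theta> \<and> good (r * cos (Arg (cis \<theta>) / 2 - \<phi>0)))}"
      by (rule AE_not_vimage_null[where S = UNIV and f' = "\<lambda>_. 2"]) (auto intro!: derivative_eq_intros)
    moreover have "AE \<phi> in lborel. - sin \<phi>0 * cos \<phi> + cos \<phi>0 * sin \<phi> \<noteq> 0"
      by (rule AE_sinusoid_nonzero) (use sin_zero_abs_cos_one in force)
    ultimately have "AE \<phi> in lborel. h (r * cos (\<phi> - \<phi>0)) = 1 / (r * cos (\<phi> - \<phi>0))"
    proof eventually_elim
      case (elim \<phi>)
      let ?\<phi> = "Arg (cis (2 * \<phi>)) / 2"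
      let ?\<alpha> = "?\<phi> - \<phi>0"
      have gd: "good (r * cos ?\<alpha>)" and b: "phase_cayley T e (cis (2 * \<phi>)) = cis (2 * ?\<alpha>)"
        using elim(1) ccis by auto
      have nz: "r \<noteq> 0" "cos ?\<alpha> \<noteq> 0" using gd by (auto simp: good_def)
      have "cis (2 * ?\<alpha>) = cis (2 * (\<phi> - \<phi>0))"
        using half[of "2 * \<phi>"] by (simp add: right_diff_distrib cis_divide[symmetric])
      \<comment> \<open>equal double angles leave only the choice between a point and its antipode\<close>
      then have cos2: "cos (2 * ?\<alpha>) = cos (2 * (\<phi> - \<phi>0))" by (metis cis.sel(1))
      then have cc: "(cos ?\<alpha>)\<^sup>2 = (cos (\<phi> - \<phi>0))\<^sup>2" by (simp only: cos_double_cos)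
      have "(sin ?\<alpha>)\<^sup>2 = (sin (\<phi> - \<phi>0))\<^sup>2" using cos2 by (simp only: cos_double_sin)
      moreover have "sin (\<phi> - \<phi>0) \<noteq> 0" using elim(2) by (simp add: sin_diff mult.commute)
      ultimately have s: "sin ?\<alpha> \<noteq> 0" by auto
      have "?F ?\<phi> = tan ?\<alpha>"
        by (rule cayley_inj) (use b cayley_tan[OF nz(2)] in \<open>simp add: phase_cayley_def\<close>)
      then have "h (r * cos ?\<alpha>) * (r * cos ?\<alpha>) * sin ?\<alpha> = 1 * sin ?\<alpha>"
        unfolding F[OF gd] using nz by (simp add: tan_def field_simps)
      then have h1: "h (r * cos ?\<alpha>) = 1 / (r * cos ?\<alpha>)"
        using s nz by (simp only: mult_cancel_right) (simp add: field_simps)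
      from cc consider "cos (\<phi> - \<phi>0) = cos ?\<alpha>" | "cos (\<phi> - \<phi>0) = - cos ?\<alpha>"
        by (auto simp: power2_eq_iff)
      then show ?case
      proof cases
        case 2
        then show ?thesis using gd h1 by (simp add: good_def)
      qed (simp add: h1)
    qed
    then show ?case by (simp add: p flip: e_def)
  qed
  then have "AE e in M. h (a \<bullet> fst e) = 1 / (a \<bullet> fst e)"
    by (intro AE_frame_if_AE_plane_phase[OF haar _ basis]) auto
  with coord AE_space have "AE e in M. T (fst e) = (1 / (a \<bullet> fst e)) *\<^sub>R a - fst e"
  proof eventually_elim
    case (elim e)
    then show ?case
      using field_eq_profile[of "fst e"] two_framesD[of e] by (simp add: space_M scaleR_diff_right)
  qed
  then show ?thesis by (simp add: AE_sphere_iff[OF pred_field_reciprocal])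
qed

end

theorem corollary6p4:
  fixes a :: "real ^ 'n" and \<psi> :: "real \<Rightarrow> ereal"
    and T :: "real ^ 'n \<Rightarrow> real ^ 'n"
    and M :: "'n frame measure"
    and basis :: "'n frame set \<Rightarrow> 'n frame"
  assumes dim: "CARD('n) \<ge> 3"
    and a: "a \<in> sphere 0 1"
    and psi_borel: "\<psi> \<in> borel_measurable (restrict_space borel ({-1<..<0} \<union> {0<..<1}))"
    and psi_finite: "AE t in lborel. t \<in> {-1<..<0} \<union> {0<..<1} \<longrightarrow> \<bar>\<psi> t\<bar> \<noteq> \<infinity>"
    and T: "field_of \<psi> a T"
    and haar: "haar_two_frame M"
    and basis: "\<And>P. P \<in> oriented_planes \<Longrightarrow> basis P \<in> P"
  shows "(conditionally_cauchy M T \<longleftrightarrow> reciprocal_modulus \<psi>) \<and>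
    (conditionally_cauchy M T \<or> reciprocal_modulus \<psi> \<longrightarrow>
     (AE u in sphere_law M. T (- u) = - T u) \<longrightarrow>
       ((AE P in plane_law M. \<exists>f\<in>H_infinity. boundary_function f (phase_cayley T (basis P)))
        \<longleftrightarrow> (AE u in sphere_law M. T u = (1 / (a \<bullet> u)) *\<^sub>R a - u)))"
proof -
  interpret frame_field a \<psi> T M
    using dim a psi_borel T haar by unfold_locales auto
  show ?thesis
    using conditionally_cauchy_if_reciprocal reciprocal_if_conditionally_cauchy
      H_infinity_phase_if_reciprocal_field[OF _ basis] reciprocal_field_if_H_infinity_phase[OF _ _ basis]
    by blast
qed

end
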